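(* Let $k\ge 2$ and $m\ge k+1$. The deletion map $\pi_{k,m}\colon X(k,m+1)\to X(k,m)$, $[P_1,\dots,P_m,P_{m+1}]\mapsto[P_1,\dots,P_m]$, defines a stratified fibration with respect to the discriminantal stratification $\mathcal{S}_{k,m}$ on the very affine variety $X(k,m)$.
   Context: All varieties are over $\mathbb{C}$. A very affine variety is a closed subvariety of an algebraic torus $(\mathbb{C}^* )^n$. $X(k,m)$ is the moduli space of $m$-tuples $[P]=[P_1,\dots,P_m]$ of points $P_i\in\mathbb{P}^{k-1}$ such that no $k$ of them lie on a hyperplane, considered up to the action of $\mathrm{GL}(k,\mathbb{C})$. Equivalently, $X(k,m)=\mathrm{Gr}(k,m)^\circ/(\mathbb{C}^* )^m$, where $\mathrm{Gr}(k,m)$ is the Grassmannian of $k$-dimensional subspaces of $\mathbb{C}^m$ and $\mathrm{Gr}(k,m)^\circ$ is the open cell where all Plücker coordinates are nonzero. Stratified fibration: a map $f\colon X\to Y$ of complex algebraic varieties such that $Y$ has a stratification $\mathcal{S}=\{S\subseteq Y\}$ by finitely many closed strata with the property that, over each open stratum $S^\circ=S\setminus\bigcup_{S'\subsetneq S}S'$ (union over strata $S'\in\mathcal{S}$ strictly contained in $S$), the map $f$ is a fibration with fiber $F_S$. Discriminantal stratification $\mathcal{S}_{k,m}$: represent a point by a $k\times m$ matrix $M$ whose columns are homogeneous coordinates of $P_1,\dots,P_m$. The exterior power $\wedge_{k-1}M$ is the $k\times\binom{m}{k-1}$ matrix whose entries are the signed $(k-1)\times(k-1)$ minors of $M$;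 its columns are the normal vectors of the hyperplanes spanned by $k-1$ of the points (a column may be zero if those $k-1$ points do not span a hyperplane, which does not happen for points in $X(k,m)$). This construction is equivariant under $\mathrm{GL}(k,\mathbb{C})$ and yields a map of Grassmannians $\mathrm{Gr}(k,m)\to\mathrm{Gr}\bigl(k,\binom{m}{k-1}\bigr)$. Pull back along this map the matroid stratification of $\mathrm{Gr}\bigl(k,\binom{m}{k-1}\bigr)$, whose strata correspond to arrangements of $\binom{m}{k-1}$ hyperplanes in $\mathbb{P}^{k-1}$ with a fixed intersection lattice. Restrict the pullback to $\mathrm{Gr}(k,m)^\circ$; it is compatible with the action of $(\mathbb{C}^* )^m$, and $\mathcal{S}_{k,m}$ is the induced stratification of the quotient $X(k,m)$. Thus, as $[P]$ ranges over an open stratum of $\mathcal{S}_{k,m}$, the arrangement of all hyperplanes spanned by $k-1$ of the points $P_1,\dots,P_m$ has a fixed intersection lattice.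
   Formalization: The fiber F_S is taken separately on each connected component of an open stratum; a single fiber up to homeomorphism for a disconnected open stratum fails in general (e.g. k=3, m=24). *)

theory Defs
  imports
    "HOL-Analysis.Function_Topology"
    "HOL-Analysis.Product_Topology"
    "Jordan_Normal_Form.Determinant"
    "Jordan_Normal_Form.DL_Submatrix"
begin

section \<open>Affine and very affine complex varieties\<close>

inductive_set poly_funs :: "'i set \<Rightarrow> (('i \<Rightarrow> complex) \<Rightarrow> complex) set" for I where
  const: "(\<lambda>_. c) \<in> poly_funs I"
| coord: "i \<in> I \<Longrightarrow> (\<lambda>z. z i) \<in> poly_funs I"
| add: "p \<in> poly_funs I \<Longrightarrow> q \<in> poly_funs I \<Longrightarrow> (\<lambda>z. p z + q z) \<in> poly_funs I"
| mult: "p \<in> poly_funs I \<Longrightarrow> q \<in> poly_funs I \<Longrightarrow> (\<lambda>z. p z * q z) \<in> poly_funs I"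

text \<open>The affine space over a finite index set \<open>I\<close>; its points are the functions in
  \<open>I \<rightarrow>\<^sub>E UNIV\<close>.\<close>

definition complex_space :: "'i set \<Rightarrow> ('i \<Rightarrow> complex) topology" where
  "complex_space I = product_topology (\<lambda>_. euclidean) I"

definition torus :: "'i set \<Rightarrow> ('i \<Rightarrow> complex) set" where
  "torus I = {z \<in> topspace (complex_space I). \<forall>i\<in>I. z i \<noteq> 0}"

text \<open>A variety is recorded by its analytic topology (whose \<open>topspace\<close> is the set of points) and its
  ring of global regular functions. Only the values of a function on the points matter, so
  \<open>regular V\<close> is closed under changing a function elsewhere. For affine varieties, the only ones
  considered here, these data determine the Zariski topology and the morphisms.\<close>

record 'a variety =
  analytic :: "'a topology"
  regular :: "('a \<Rightarrow> complex) set"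

abbreviation points :: "'a variety \<Rightarrow> 'a set" where
  "points V \<equiv> topspace (analytic V)"

definition zariski_closed :: "'a variety \<Rightarrow> 'a set \<Rightarrow> bool" where
  "zariski_closed V Z \<longleftrightarrow> (\<exists>G \<subseteq> regular V. Z = {x \<in> points V. \<forall>g\<in>G. g x = 0})"

definition variety_morphism :: "'a variety \<Rightarrow> 'b variety \<Rightarrow> ('a \<Rightarrow> 'b) \<Rightarrow> bool" where
  "variety_morphism X Y f \<longleftrightarrow> f \<in> points X \<rightarrow> points Y \<and> (\<forall>g\<in>regular Y. g \<circ> f \<in> regular X)"

definition affine_variety :: "'a variety \<Rightarrow> bool" where
  "affine_variety V \<longleftrightarrow> (\<exists>(n::nat) G \<phi>. G \<subseteq> poly_funs {..<n} \<and>
     homeomorphic_map (analytic V)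
       (subtopology (complex_space {..<n}) {z. \<forall>p\<in>G. p z = 0}) \<phi> \<and>
     regular V = {g. \<exists>p\<in>poly_funs {..<n}. \<forall>x\<in>points V. g x = p (\<phi> x)})"

text \<open>Closed subvarieties of \<open>(\<complex>\<^sup>*)\<^sup>n\<close>: since the coordinates are units on the torus, Laurent and
  ordinary polynomials have the same zero loci there, and the regular functions are the
  restrictions of Laurent polynomials.\<close>

definition very_affine_variety :: "'a variety \<Rightarrow> bool" where
  "very_affine_variety V \<longleftrightarrow> (\<exists>(n::nat) G \<phi>. G \<subseteq> poly_funs {..<n} \<and>
     homeomorphic_map (analytic V)
       (subtopology (complex_space {..<n}) {z \<in> torus {..<n}. \<forall>p\<in>G. p z = 0}) \<phi> \<and>
     regular V = {g. \<exists>p\<in>poly_funs {..<n}. \<exists>N::nat. \<forall>x\<in>points V.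
                       g x = p (\<phi> x) / (\<Prod>i<n. \<phi> x i) ^ N})"


section \<open>Stratified fibrations\<close>

definition open_stratum :: "'a set set \<Rightarrow> 'a set \<Rightarrow> 'a set" where
  "open_stratum \<S> S = S - \<Union>{S' \<in> \<S>. S' \<subset> S}"

definition stratification :: "'a variety \<Rightarrow> 'a set set \<Rightarrow> bool" where
  "stratification Y \<S> \<longleftrightarrow>
     finite \<S> \<and> (\<forall>S\<in>\<S>. zariski_closed Y S) \<and> \<Union>\<S> = points Y \<and>
     disjoint_family_on (open_stratum \<S>) \<S>"

text \<open>\<open>f\<close> is trivial with fibre \<open>F\<close> over the subspace \<open>U\<close> of the base.\<close>

definition trivial_over ::
    "'a topology \<Rightarrow> 'b topology \<Rightarrow> ('a \<Rightarrow> 'b) \<Rightarrow> 'b set \<Rightarrow> 'f topology \<Rightarrow> bool" where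
  "trivial_over X Y f U F \<longleftrightarrow>
     (\<exists>h. homeomorphic_map (subtopology X (f -` U)) (prod_topology (subtopology Y U) F) h \<and>
          (\<forall>x \<in> topspace X \<inter> f -` U. fst (h x) = f x))"

text \<open>\<open>f\<close> is a fibration over \<open>B\<close>: a locally trivial topological fibre bundle. As always for
  fibrations, the typical fibre \<open>F\<close> is attached to a connected component of \<open>B\<close>; there is no common
  fibre for different components in general. (Open strata of matroid type may be disconnected, and
  lattice-equivalent line arrangements may have non-homeomorphic complements.) It is no
  restriction to let \<open>F\<close> live on the type of the total space, as \<open>F\<close> is homeomorphic to a fibre of
  \<open>f\<close>.\<close>

definition fibration_over ::
    "'a topology \<Rightarrow> 'b topology \<Rightarrow> ('a \<Rightarrow> 'b) \<Rightarrow> 'b set \<Rightarrow> bool" where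
  "fibration_over X Y f B \<longleftrightarrow>
     (\<forall>C \<in> connected_components_of (subtopology Y B). \<exists>F :: 'a topology.
        \<forall>y\<in>C. \<exists>U. openin (subtopology Y B) U \<and> y \<in> U \<and> trivial_over X Y f U F)"

definition stratified_fibration ::
    "'a variety \<Rightarrow> 'b variety \<Rightarrow> ('a \<Rightarrow> 'b) \<Rightarrow> 'b set set \<Rightarrow> bool" where
  "stratified_fibration X Y f \<S> \<longleftrightarrow>
     affine_variety X \<and> affine_variety Y \<and> variety_morphism X Y f \<and> stratification Y \<S> \<and>
     (\<forall>S\<in>\<S>. fibration_over (analytic X) (analytic Y) f (open_stratum \<S> S))"


section \<open>The moduli space of point configurations\<close>

definition quotient_topology :: "'a topology \<Rightarrow> ('a \<times> 'a) set \<Rightarrow> 'a set topology" where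
  "quotient_topology T r = topology (\<lambda>U. U \<subseteq> topspace T // r \<and> openin T {x \<in> topspace T. r `` {x} \<in> U})"

lemma openin_quotient_topology:
  "openin (quotient_topology T r) U \<longleftrightarrow>
     U \<subseteq> topspace T // r \<and> openin T {x \<in> topspace T. r `` {x} \<in> U}"
proof -
  have "istopology (\<lambda>U. U \<subseteq> topspace T // r \<and> openin T {x \<in> topspace T. r `` {x} \<in> U})"
    unfolding istopology_def
  proof (intro conjI allI impI)
    fix U V
    assume U: "U \<subseteq> topspace T // r \<and> openin T {x \<in> topspace T. r `` {x} \<in> U}"
      and V: "V \<subseteq> topspace T // r \<and> openin T {x \<in> topspace T. r `` {x} \<in> V}"
    show "U \<inter> V \<subseteq> topspace T // r" using U by blast
    have "{x \<in> topspace T. r `` {x} \<in> U \<inter> V} =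
        {x \<in> topspace T. r `` {x} \<in> U} \<inter> {x \<in> topspace T. r `` {x} \<in> V}" by blast
    then show "openin T {x \<in> topspace T. r `` {x} \<in> U \<inter> V}" using U V by auto
  next
    fix \<K>
    assume K: "\<forall>K\<in>\<K>. K \<subseteq> topspace T // r \<and> openin T {x \<in> topspace T. r `` {x} \<in> K}"
    show "\<Union>\<K> \<subseteq> topspace T // r" using K by blast
    have "{x \<in> topspace T. r `` {x} \<in> \<Union>\<K>} = (\<Union>K\<in>\<K>. {x \<in> topspace T. r `` {x} \<in> K})" by blast
    then show "openin T {x \<in> topspace T. r `` {x} \<in> \<Union>\<K>}" using K by auto
  qed
  then show ?thesis by (simp add: quotient_topology_def topology_inverse')
qed

definition entries :: "nat \<Rightarrow> nat \<Rightarrow> complex mat \<Rightarrow> nat \<times> nat \<Rightarrow> complex" where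
  "entries k m M = restrict (($$) M) ({..<k} \<times> {..<m})"

definition mat_topology :: "nat \<Rightarrow> nat \<Rightarrow> complex mat topology" where
  "mat_topology k m =
     pullback_topology (carrier_mat k m) (entries k m) (complex_space ({..<k} \<times> {..<m}))"

definition ksubsets :: "nat \<Rightarrow> nat \<Rightarrow> nat set set" where
  "ksubsets r m = {J. J \<subseteq> {..<m} \<and> card J = r}"

definition pluecker :: "complex mat \<Rightarrow> nat set \<Rightarrow> complex" where
  "pluecker M J = det (submatrix M UNIV J)"

text \<open>Homogeneous coordinates of \<open>m\<close> points in projective \<open>(k-1)\<close>-space, no \<open>k\<close> on a hyperplane.\<close>

definition config :: "nat \<Rightarrow> nat \<Rightarrow> complex mat set" where
  "config k m = {M \<in> carrier_mat k m. \<forall>J \<in> ksubsets k m. pluecker M J \<noteq> 0}"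

definition config_rel :: "nat \<Rightarrow> nat \<Rightarrow> (complex mat \<times> complex mat) set" where
  "config_rel k m = {(M, N). M \<in> config k m \<and> N \<in> config k m \<and>
     (\<exists>A \<in> carrier_mat k k. \<exists>t. invertible_mat A \<and> (\<forall>j<m. t j \<noteq> 0) \<and> N = A * M * mat_diag m t)}"

text \<open>\<open>config k m\<close> is a principal open subset of the space of matrices, and its geometric quotient by
  \<open>GL\<^sub>k \<times> (\<complex>\<^sup>*)\<^sup>m\<close> has as regular functions the invariant regular functions of \<open>config k m\<close>, which
  are fractions of a polynomial in the entries by a power of the product of all maximal minors.\<close>

definition moduli_space :: "nat \<Rightarrow> nat \<Rightarrow> complex mat set variety" where
  "moduli_space k m = \<lparr>
     analytic = quotient_topology (subtopology (mat_topology k m) (config k m)) (config_rel k m),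
     regular = {g. \<exists>p \<in> poly_funs ({..<k} \<times> {..<m}). \<exists>N::nat. \<forall>M \<in> config k m.
        g (config_rel k m `` {M}) = p (entries k m M) / (\<Prod>J \<in> ksubsets k m. pluecker M J) ^ N} \<rparr>"

definition delete_last_column :: "nat \<Rightarrow> nat \<Rightarrow> complex mat \<Rightarrow> complex mat" where
  "delete_last_column k m M = mat k m (\<lambda>ij. M $$ ij)"

definition deletion_map :: "nat \<Rightarrow> nat \<Rightarrow> complex mat set \<Rightarrow> complex mat set" where
  "deletion_map k m x = config_rel k m `` (delete_last_column k m ` x)"


section \<open>The discriminantal stratification\<close>

text \<open>The column of \<open>\<And>\<^sup>k\<^sup>-\<^sup>1 M\<close> indexed by the \<open>(k-1)\<close>-set \<open>J\<close> of columns of \<open>M\<close>.\<close>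

definition hyperplane_normal :: "nat \<Rightarrow> complex mat \<Rightarrow> nat set \<Rightarrow> complex vec" where
  "hyperplane_normal k M J = vec k (\<lambda>i. (-1) ^ i * det (submatrix M (- {i}) J))"

text \<open>The bases of the matroid on \<open>E\<close> represented by the vectors \<open>v e\<close> (\<open>e \<in> E\<close>) of dimension \<open>k\<close>,
  as sets of indices; a rank \<open>k\<close> representation is assumed.\<close>

definition matroid_bases :: "nat \<Rightarrow> 'e set \<Rightarrow> ('e \<Rightarrow> complex vec) \<Rightarrow> 'e set set" where
  "matroid_bases k E v =
     {set es | es. distinct es \<and> length es = k \<and> set es \<subseteq> E \<and> det (mat_of_cols k (map v es)) \<noteq> 0}"

definition discriminantal_bases :: "nat \<Rightarrow> nat \<Rightarrow> complex mat \<Rightarrow> nat set set set" where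
  "discriminantal_bases k m M = matroid_bases k (ksubsets (k - 1) m) (hyperplane_normal k M)"

text \<open>The closed stratum of a realized matroid \<open>\<B>\<close> is the locus where all Pluecker coordinates of
  \<open>\<And>\<^sup>k\<^sup>-\<^sup>1 M\<close> outside \<open>\<B>\<close> vanish, i.e. where the matroid is at most \<open>\<B>\<close> in the weak order. Its open
  stratum is then exactly the locus where the matroid (equivalently, the labelled intersection
  lattice) is \<open>\<B>\<close>. Closures of matroid strata would not do: they need not be unions of strata, so
  their open strata could mix several matroids.\<close>

definition discriminantal_stratum :: "nat \<Rightarrow> nat \<Rightarrow> nat set set set \<Rightarrow> complex mat set set" where
  "discriminantal_stratum k m \<B> =
     {x \<in> points (moduli_space k m). \<forall>M\<in>x. discriminantal_bases k m M \<subseteq> \<B>}"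

definition discriminantal_stratification :: "nat \<Rightarrow> nat \<Rightarrow> complex mat set set set" where
  "discriminantal_stratification k m =
     discriminantal_stratum k m ` discriminantal_bases k m ` config k m"

end

theory Submission
  imports Defs
begin

text \<open>Using a projective frame, a configuration has a unique normal form, whose first \<open>k\<close> columns are the
  unit vectors and in which column \<open>k\<close> and the rest of row \<open>0\<close> consist of ones. This identifies
  the moduli space with a principal open subset of an affine space, and the fibre of the deletion map
  with the complement, in an affine chart, of the arrangement of all hyperplanes spanned by the points.

  On an open stratum the matroid of this arrangement is constant, and it remains to see that the
  complements then form a locally trivial family. Let \<open>v e\<close> be the normal vectors over a point \<open>b\<close>
  near \<open>b0\<close>, with \<open>v0 e\<close> those over \<open>b0\<close>. A point \<open>p\<close> of the complement over \<open>b0\<close> is sent to the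
  point \<open>q\<close> that minimizes the weighted sum of squares of the residuals
  \<open>pairing (v e) q - pairing (v0 e) p\<close> with weights \<open>1 / cmod (pairing (v0 e) p)\<close>. Constancy of the
  matroid makes each residual small relative to \<open>pairing (v0 e) p\<close>, so \<open>q\<close> avoids the hyperplanes
  over \<open>b\<close>; with these weights, the difference of this map and the identity is moreover a contraction,
  so the map is a homeomorphism. It is homogeneous, hence descends to projective space.\<close>

section \<open>Weighted least squares for hyperplane arrangements\<close>

text \<open>A map that merely moves points by a distance of order \<open>\<epsilon>\<close> is
  useless here: the complement contains points arbitrarily close to the hyperplanes, and there such
  a motion may cross one. The error in each value \<open>pairing (v e) q\<close> has to be small
  relative to \<open>pairing (v0 e) p\<close>, uniformly on the complement, although the weights are
  unbounded there. Two facts make this possible. The matrix sending data to fitted values is bounded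
  in terms of the coefficients that express normals in bases chosen among them, independently of the
  weights. And constancy of the matroid keeps the coefficients that vanish over \<open>b0\<close>
  equal to zero over \<open>b\<close>; expansion in a basis that is minimal for the sizes of the
  values then perturbs every value only by a small multiple of itself. The same mechanism gives the
  contraction: the relative change of a weight between two points can be large only where the
  residual is correspondingly small.\<close>

lemma linear_system_solution:
  fixes a :: "nat \<Rightarrow> nat \<Rightarrow> complex"
  assumes "det (mat k k (\<lambda>(i, j). a i j)) \<noteq> 0" and "i < k"
  shows "(\<Sum>j<k. a i j * (det (mat k k (\<lambda>(r, c). if c = j then b r else a r c)) /
           det (mat k k (\<lambda>(i, j). a i j)))) = b i"
proof -
  define A where "A = mat k k (\<lambda>(i, j). a i j)"
  have A: "A \<in> carrier_mat k k" by (simp add: A_def)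
  have d: "det A \<noteq> 0" using assms by (simp add: A_def)
  define x where "x = (1 / det A) \<cdot>\<^sub>v (adj_mat A *\<^sub>v vec k b)"
  have adj: "adj_mat A \<in> carrier_mat k k" "A * adj_mat A = det A \<cdot>\<^sub>m 1\<^sub>m k"
    using adj_mat[OF A] by auto
  have x: "x \<in> carrier_vec k" using adj by (simp add: x_def)
  have "A *\<^sub>v x = (1 / det A) \<cdot>\<^sub>v (A *\<^sub>v (adj_mat A *\<^sub>v vec k b))"
    unfolding x_def by (rule mult_mat_vec[OF A]) (use adj in auto)
  also have "A *\<^sub>v (adj_mat A *\<^sub>v vec k b) = (det A \<cdot>\<^sub>m 1\<^sub>m k) *\<^sub>v vec k b"
    using adj A by (metis assoc_mult_mat_vec vec_carrier)
  also have "(1 / det A) \<cdot>\<^sub>v ((det A \<cdot>\<^sub>m 1\<^sub>m k) *\<^sub>v vec k b) = vec k b"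
  proof -
    have "(det A \<cdot>\<^sub>m 1\<^sub>m k) *\<^sub>v vec k b = det A \<cdot>\<^sub>v (1\<^sub>m k *\<^sub>v vec k b)" by auto
    then show ?thesis using d by (simp add: smult_smult_assoc)
  qed
  finally have Ax: "A *\<^sub>v x = vec k b" .
  have xj: "x $ j = det (mat k k (\<lambda>(r, c). if c = j then b r else a r c)) / det A" if "j < k" for j
  proof -
    have "det (replace_col A (vec k b) j) = x $ j * det A"
      using cramer_lemma_mat[OF A x that] Ax by simp
    moreover have "replace_col A (vec k b) j = mat k k (\<lambda>(r, c). if c = j then b r else a r c)"
      by (rule eq_matI) (auto simp: replace_col_def A_def)
    ultimately show ?thesis using d by simp
  qed
  have "(\<Sum>j<k. a i j * x $ j) = (A *\<^sub>v x) $ i"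
    using assms(2) x by (simp add: A_def scalar_prod_def atLeast0LessThan)
  also have "\<dots> = b i" using Ax assms(2) by simp
  finally show ?thesis using xj by (simp add: A_def)
qed

section \<open>Determinants and expansions of normals in bases\<close>

definition pairing :: "nat \<Rightarrow> (nat \<Rightarrow> complex) \<Rightarrow> (nat \<Rightarrow> complex) \<Rightarrow> complex" where
  "pairing k u p = (\<Sum>i<k. u i * p i)"

lemma pairing_diff: "pairing k u (\<lambda>i. p i - q i) = pairing k u p - pairing k u q"
  by (simp add: pairing_def algebra_simps sum_subtractf)

lemma pairing_scale: "pairing k u (\<lambda>i. c * p i) = c * pairing k u p"
  by (simp add: pairing_def sum_distrib_left algebra_simps)

lemma pairing_sum: "pairing k u (\<lambda>i. \<Sum>e\<in>A. p e i) = (\<Sum>e\<in>A. pairing k u (p e))"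
  unfolding pairing_def by (simp add: sum_distrib_left) (rule sum.swap)

lemma pairing_cong: "(\<And>i. i < k \<Longrightarrow> p i = q i) \<Longrightarrow> pairing k u p = pairing k u q"
  by (simp add: pairing_def)

lemma pairing_restrict [simp]: "pairing k u (restrict p {..<k}) = pairing k u p"
  by (simp add: pairing_def)

text \<open>Lists instead of sets of normals: the determinant has a definite sign, and Cramer's
  replacement of a column becomes an update of the list.\<close>

definition vdet :: "nat \<Rightarrow> ('e \<Rightarrow> nat \<Rightarrow> complex) \<Rightarrow> 'e list \<Rightarrow> complex" where
  "vdet k v es = det (mat k k (\<lambda>(i, j). v (es ! j) i))"

lemma vdet_interpolation:
  assumes "vdet k v es \<noteq> 0"
  shows "\<exists>d. \<forall>j<k. pairing k (v (es ! j)) d = y j"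
proof -
  have "det (transpose_mat (mat k k (\<lambda>(i, j). v (es ! j) i))) \<noteq> 0"
    using assms det_transpose[of "mat k k (\<lambda>(i, j). v (es ! j) i)" k] by (simp add: vdet_def)
  moreover have "transpose_mat (mat k k (\<lambda>(i, j). v (es ! j) i)) = mat k k (\<lambda>(i, j). v (es ! i) j)"
    by (rule eq_matI) auto
  ultimately have "det (mat k k (\<lambda>(i, j). v (es ! i) j)) \<noteq> 0" by simp
  from linear_system_solution[OF this, of _ y] show ?thesis
    unfolding pairing_def by (intro exI allI impI) assumption
qed

text \<open>Cramer's rule for the \<open>j\<close>-th coefficient of \<open>v f\<close> in the basis
  \<open>es\<close>. As a quotient of determinants it varies continuously with \<open>v\<close>, and
  whether it vanishes depends on the matroid alone.\<close>

definition coef :: "nat \<Rightarrow> ('e \<Rightarrow> nat \<Rightarrow> complex) \<Rightarrow> 'e list \<Rightarrow> 'e \<Rightarrow> nat \<Rightarrow> complex" where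
  "coef k v es f j = vdet k v (es[j := f]) / vdet k v es"

lemma vdet_expansion:
  assumes "vdet k v es \<noteq> 0" and "length es = k" and "i < k"
  shows "v f i = (\<Sum>j<k. coef k v es f j * v (es ! j) i)"
proof -
  have "mat k k (\<lambda>(r, c). if c = j then v f r else v (es ! c) r) =
      mat k k (\<lambda>(r, c). v (es[j := f] ! c) r)" if "j < k" for j
    using that assms(2) by (intro eq_matI) (auto simp: nth_list_update)
  then show ?thesis
    using linear_system_solution[of k "\<lambda>i j. v (es ! j) i" i "v f"] assms
    by (simp add: vdet_def coef_def mult.commute)
qed

lemma pairing_expansion:
  assumes "vdet k v es \<noteq> 0" and "length es = k"
  shows "pairing k (v f) p = (\<Sum>j<k. coef k v es f j * pairing k (v (es ! j)) p)"
proof -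
  have "pairing k (v f) p = (\<Sum>i<k. \<Sum>j<k. coef k v es f j * v (es ! j) i * p i)"
    unfolding pairing_def
  proof (rule sum.cong)
    fix i assume "i \<in> {..<k}"
    then have "v f i = (\<Sum>j<k. coef k v es f j * v (es ! j) i)"
      by (intro vdet_expansion assms) simp
    then show "v f i * p i = (\<Sum>j<k. coef k v es f j * v (es ! j) i * p i)"
      by (simp only: sum_distrib_right)
  qed simp
  also have "\<dots> = (\<Sum>j<k. coef k v es f j * pairing k (v (es ! j)) p)"
    unfolding pairing_def by (subst sum.swap) (simp add: sum_distrib_left mult.assoc)
  finally show ?thesis .
qed

definition basis_list :: "nat \<Rightarrow> 'e set \<Rightarrow> ('e \<Rightarrow> nat \<Rightarrow> complex) \<Rightarrow> 'e list \<Rightarrow> bool" where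
  "basis_list k E v es \<longleftrightarrow> length es = k \<and> set es \<subseteq> E \<and> vdet k v es \<noteq> 0"

lemma finite_basis_lists: "finite E \<Longrightarrow> finite {es. basis_list k E v es}"
  by (rule finite_subset[OF _ finite_lists_length_eq[of E k]]) (auto simp: basis_list_def)

lemma basis_list_exchange:
  assumes "basis_list k E v es" "f \<in> E" "j < k" "coef k v es f j \<noteq> 0"
  shows "basis_list k E v (es[j := f])"
proof -
  have "set (es[j := f]) \<subseteq> insert f (set es)" by (rule set_update_subset_insert)
  then show ?thesis using assms by (auto simp: basis_list_def coef_def)
qed

text \<open>A basis of least total weight exists because there are only finitely many. Exchanging
  its \<open>j\<close>-th member for \<open>f\<close> gives a basis whenever that member occurs in
  the expansion of \<open>f\<close>, so minimality makes the member no heavier than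
  \<open>f\<close>.\<close>

lemma greedy_basis:
  fixes y :: "'e \<Rightarrow> real"
  assumes "finite E" and "\<exists>es. basis_list k E v es"
  obtains es where "basis_list k E v es"
    and "\<And>f j. f \<in> E \<Longrightarrow> j < k \<Longrightarrow> coef k v es f j \<noteq> 0 \<Longrightarrow> y (es ! j) \<le> y f"
proof -
  define S where "S = {es. basis_list k E v es}"
  define w where "w es = (\<Sum>j<k. y (es ! j))" for es
  have "finite S" "S \<noteq> {}" using finite_basis_lists[OF assms(1)] assms(2) by (auto simp: S_def)
  then have "arg_min_on w S \<in> S" "\<not> (\<exists>x\<in>S. w x < w (arg_min_on w S))"
    by (rule arg_min_if_finite)+
  then obtain es where es: "es \<in> S" "\<And>es'. es' \<in> S \<Longrightarrow> w es \<le> w es'"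
    by (metis linorder_not_less)
  show ?thesis
  proof (rule that)
    show bas: "basis_list k E v es" using es by (simp add: S_def)
    fix f j assume f: "f \<in> E" "j < k" "coef k v es f j \<noteq> 0"
    then have "w es \<le> w (es[j := f])"
      using basis_list_exchange[OF bas f] es(2) by (simp add: S_def)
    moreover have "w (es[j := f]) = y f + (\<Sum>i\<in>{..<k} - {j}. y (es ! i))"
      using f bas unfolding w_def by (subst sum.remove[of _ j]) (auto simp: basis_list_def intro!: sum.cong)
    moreover have "w es = y (es ! j) + (\<Sum>i\<in>{..<k} - {j}. y (es ! i))"
      using f unfolding w_def by (subst sum.remove[of _ j]) auto
    ultimately show "y (es ! j) \<le> y f" by simp
  qed
qed

text \<open>Up to factors of modulus 1, the coordinate forms are among the normals. Hence the
  normals span, and the entries of a vector are controlled by its pairings.\<close>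

locale arrangement =
  fixes k :: nat and E :: "'e set" and v :: "'e \<Rightarrow> nat \<Rightarrow> complex"
  assumes finite_E: "finite E"
    and coordinate: "i < k \<Longrightarrow> \<exists>e\<in>E. \<forall>p. cmod (pairing k (v e) p) = cmod (p i)"
begin

lemma eq_zero_if_pairings_zero:
  assumes "\<And>e. e \<in> E \<Longrightarrow> pairing k (v e) s = 0" and "i < k"
  shows "s i = 0"
  using coordinate[OF assms(2)] assms(1) by (metis norm_eq_zero)

text \<open>The coordinate forms are a basis: a vector killed by all of them is zero.\<close>

lemma basis_exists: "\<exists>es. basis_list k E v es"
proof -
  obtain c where c: "\<And>i. i < k \<Longrightarrow> c i \<in> E" "\<And>i p. i < k \<Longrightarrow> cmod (pairing k (v (c i)) p) = cmod (p i)"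
  proof -
    have "\<forall>i\<in>{..<k}. \<exists>e. e \<in> E \<and> (\<forall>p. cmod (pairing k (v e) p) = cmod (p i))"
      using coordinate by blast
    from bchoice[OF this] show thesis using that by auto
  qed
  define es where "es = map c [0..<k]"
  let ?A = "mat k k (\<lambda>(i, j). v (es ! j) i)"
  have "vdet k v es \<noteq> 0"
  proof
    assume "vdet k v es = 0"
    then have "det (transpose_mat ?A) = 0" by (simp add: vdet_def det_transpose[of _ k])
    then obtain x where x: "x \<in> carrier_vec k" "x \<noteq> 0\<^sub>v k" "transpose_mat ?A *\<^sub>v x = 0\<^sub>v k"
      using det_0_iff_vec_prod_zero[of "transpose_mat ?A" k] by auto
    have "x $ j = 0" if "j < k" for j
    proof -
      have "pairing k (v (c j)) (\<lambda>i. x $ i) = (transpose_mat ?A *\<^sub>v x) $ j"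
        using that x(1) by (simp add: pairing_def scalar_prod_def es_def atLeast0LessThan)
      then show ?thesis using c(2)[OF that, of "\<lambda>i. x $ i"] x(3) that by simp
    qed
    then have "x = 0\<^sub>v k" using x(1) by (intro eq_vecI) auto
    then show False using x(2) by simp
  qed
  then show ?thesis using c(1) by (intro exI[of _ es]) (auto simp: basis_list_def es_def)
qed

text \<open>The normal equations of weighted least squares: the derivative of the sum of
  \<open>W f * (cmod (pairing k (v f) s - z f))\<^sup>2\<close> over \<open>f\<close> vanishes at
  \<open>s\<close>.\<close>

definition normal_eq :: "('e \<Rightarrow> real) \<Rightarrow> (nat \<Rightarrow> complex) \<Rightarrow> ('e \<Rightarrow> complex) \<Rightarrow> bool" where
  "normal_eq W s z \<longleftrightarrow>
     (\<forall>i<k. (\<Sum>f\<in>E. of_real (W f) * cnj (v f i) * (pairing k (v f) s - z f)) = 0)"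

text \<open>The equations are the cases of unit vectors, and the left-hand side is linear in the
  conjugate of \<open>u\<close>. Thus the residual is orthogonal, for the weighted Hermitian form,
  to all vectors of values of the normals.\<close>

lemma normal_eq_test:
  assumes "normal_eq W s z"
  shows "(\<Sum>f\<in>E. of_real (W f) * cnj (pairing k (v f) u) * (pairing k (v f) s - z f)) = 0"
proof -
  have "(\<Sum>f\<in>E. of_real (W f) * cnj (pairing k (v f) u) * (pairing k (v f) s - z f)) =
      (\<Sum>f\<in>E. \<Sum>i<k. cnj (u i) * (of_real (W f) * cnj (v f i) * (pairing k (v f) s - z f)))"
    unfolding pairing_def[of k _ u] cnj_sum sum_distrib_left sum_distrib_right
    by (intro sum.cong refl) (simp add: mult_ac)
  also have "\<dots> = (\<Sum>i<k. cnj (u i) * (\<Sum>f\<in>E. of_real (W f) * cnj (v f i) * (pairing k (v f) s - z f)))"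
    by (subst sum.swap) (simp add: sum_distrib_left)
  also have "\<dots> = 0" using assms by (simp add: normal_eq_def)
  finally show ?thesis .
qed

text \<open>Testing with \<open>s\<close> itself leaves a vanishing sum of the nonnegative terms
  \<open>W f * (cmod (pairing k (v f) s))\<^sup>2\<close>.\<close>

lemma normal_eq_zero_rhs:
  assumes W: "\<And>f. f \<in> E \<Longrightarrow> W f > 0" and "normal_eq W s (\<lambda>_. 0)" and "i < k"
  shows "s i = 0"
proof (rule eq_zero_if_pairings_zero[OF _ assms(3)])
  have "(\<Sum>f\<in>E. of_real (W f * (cmod (pairing k (v f) s))\<^sup>2) :: complex) = 0"
    using normal_eq_test[OF assms(2), of s]
    by (simp add: complex_norm_square mult_ac del: of_real_power)
  then have "(\<Sum>f\<in>E. W f * (cmod (pairing k (v f) s))\<^sup>2) = 0"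
    unfolding of_real_sum[symmetric] of_real_eq_0_iff by simp
  then have "\<forall>f\<in>E. W f * (cmod (pairing k (v f) s))\<^sup>2 = 0"
    using finite_E W by (subst (asm) sum_nonneg_eq_0_iff) (auto simp: less_imp_le)
  then show "pairing k (v e) s = 0" if "e \<in> E" for e
    using W[OF that] that by auto
qed

lemma normal_eq_unique:
  assumes "\<And>f. f \<in> E \<Longrightarrow> W f > 0" "normal_eq W s z" "normal_eq W s' z" "i < k"
  shows "s i = s' i"
proof -
  have "normal_eq W (\<lambda>i. s i - s' i) (\<lambda>_. 0)"
    using assms(2,3) unfolding normal_eq_def pairing_diff
    by (auto simp: algebra_simps sum_subtractf sum.distrib)
  from normal_eq_zero_rhs[OF assms(1) this assms(4)] show ?thesis by simp
qed

end

definition gram_entry :: "'e set \<Rightarrow> ('e \<Rightarrow> nat \<Rightarrow> complex) \<Rightarrow> ('e \<Rightarrow> real) \<Rightarrow> nat \<Rightarrow> nat \<Rightarrow> complex" where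
  "gram_entry E v W i j = (\<Sum>f\<in>E. of_real (W f) * cnj (v f i) * v f j)"

text \<open>The minimizer written out by Cramer's rule for the Gram matrix, so that its continuity
  in normals, weights and data reduces to that of determinants.\<close>

definition wls ::
    "nat \<Rightarrow> 'e set \<Rightarrow> ('e \<Rightarrow> nat \<Rightarrow> complex) \<Rightarrow> ('e \<Rightarrow> real) \<Rightarrow> ('e \<Rightarrow> complex) \<Rightarrow> nat \<Rightarrow> complex" where
  "wls k E v W z = (\<lambda>j\<in>{..<k}.
     det (mat k k (\<lambda>(r, c). if c = j then (\<Sum>f\<in>E. of_real (W f) * cnj (v f r) * z f)
                            else gram_entry E v W r c)) /
     det (mat k k (\<lambda>(i, j). gram_entry E v W i j)))"

section \<open>Solutions of the normal equations, with bounds independent of the weights\<close>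

context arrangement begin

lemma gram_pairing:
  "(\<Sum>j<k. gram_entry E v W i j * s j) = (\<Sum>f\<in>E. of_real (W f) * cnj (v f i) * pairing k (v f) s)"
  unfolding gram_entry_def pairing_def sum_distrib_left sum_distrib_right
  by (subst sum.swap) (simp add: mult.assoc)

lemma normal_eq_gram:
  "normal_eq W s z \<longleftrightarrow>
     (\<forall>i<k. (\<Sum>j<k. gram_entry E v W i j * s j) = (\<Sum>f\<in>E. of_real (W f) * cnj (v f i) * z f))"
  by (simp add: normal_eq_def gram_pairing right_diff_distrib sum_subtractf)

text \<open>A kernel vector of the Gram matrix solves the normal equations with data 0.\<close>

lemma gram_det_nonzero:
  assumes "\<And>f. f \<in> E \<Longrightarrow> W f > 0"
  shows "det (mat k k (\<lambda>(i, j). gram_entry E v W i j)) \<noteq> 0"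
proof
  let ?G = "mat k k (\<lambda>(i, j). gram_entry E v W i j)"
  assume "det ?G = 0"
  then obtain x where x: "x \<in> carrier_vec k" "x \<noteq> 0\<^sub>v k" "?G *\<^sub>v x = 0\<^sub>v k"
    using det_0_iff_vec_prod_zero[of ?G k] by auto
  have "normal_eq W (\<lambda>i. x $ i) (\<lambda>_. 0)"
    unfolding normal_eq_gram
  proof (intro allI impI)
    fix i assume "i < k"
    then have "(\<Sum>j<k. gram_entry E v W i j * x $ j) = (?G *\<^sub>v x) $ i"
      using x(1) by (simp add: scalar_prod_def atLeast0LessThan)
    then show "(\<Sum>j<k. gram_entry E v W i j * x $ j) = (\<Sum>f\<in>E. of_real (W f) * cnj (v f i) * 0)"
      using x(3) \<open>i < k\<close> by simp
  qed
  from normal_eq_zero_rhs[OF assms this] have "x $ i = 0" if "i < k" for i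
    using that by simp
  then have "x = 0\<^sub>v k" using x(1) by (intro eq_vecI) auto
  then show False using x(2) by simp
qed

lemma wls_normal_eq:
  assumes "\<And>f. f \<in> E \<Longrightarrow> W f > 0"
  shows "normal_eq W (wls k E v W z) z"
  unfolding normal_eq_gram
proof (intro allI impI)
  fix i assume "i < k"
  have "(\<Sum>j<k. gram_entry E v W i j * wls k E v W z j) =
      (\<Sum>j<k. gram_entry E v W i j *
        (det (mat k k (\<lambda>(r, c). if c = j then (\<Sum>f\<in>E. of_real (W f) * cnj (v f r) * z f)
                            else gram_entry E v W r c)) /
          det (mat k k (\<lambda>(i, j). gram_entry E v W i j))))"
    by (rule sum.cong) (auto simp: wls_def)
  also have "\<dots> = (\<Sum>f\<in>E. of_real (W f) * cnj (v f i) * z f)"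
    by (rule linear_system_solution[OF gram_det_nonzero[OF assms] \<open>i < k\<close>])
  finally show "(\<Sum>j<k. gram_entry E v W i j * wls k E v W z j) = \<dots>" .
qed

text \<open>If the values \<open>pairing k (v f) s\<close> had a large gap in size, subtracting from \<open>s\<close> a small vector
  that agrees with it on all small values would give a test vector violating the equation.\<close>

lemma no_scale_gap:
  assumes W: "\<And>f. f \<in> E \<Longrightarrow> W f > 0"
    and K: "\<And>es f j. basis_list k E v es \<Longrightarrow> f \<in> E \<Longrightarrow> j < k \<Longrightarrow> k * cmod (coef k v es f j) \<le> K"
    and K1: "K \<ge> 1"
    and eq: "\<And>i. i < k \<Longrightarrow> (\<Sum>f\<in>E. of_real (W f) * cnj (v f i) * pairing k (v f) s) = \<kappa> * cnj (v e i)"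
    and S: "S \<subseteq> E" "S \<noteq> E" "e \<in> S" and R: "\<And>f. f \<in> S \<Longrightarrow> cmod (pairing k (v f) s) \<le> R"
  shows "\<exists>f\<in>E - S. cmod (pairing k (v f) s) \<le> K * R"
proof (rule ccontr)
  assume "\<not> ?thesis"
  then have big: "cmod (pairing k (v f) s) > K * R" if "f \<in> E - S" for f using that by force
  have R0: "R \<ge> 0" using R[OF S(3)] norm_ge_zero order_trans by blast
  \<comment> \<open>Members of \<open>S\<close> get weight 0 and all others weight 1, so each member
    of \<open>S\<close> expands in those basis members that lie in \<open>S\<close>.\<close>
  obtain es where es: "basis_list k E v es"
    and greedy: "\<And>f j. f \<in> E \<Longrightarrow> j < k \<Longrightarrow> coef k v es f j \<noteq> 0 \<Longrightarrow>
      (if es ! j \<in> S then 0 else 1 :: real) \<le> (if f \<in> S then 0 else 1)"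
    using greedy_basis[OF finite_E basis_exists, of "\<lambda>f. if f \<in> S then 0 else 1"] by blast
  have len: "length es = k" and nz: "vdet k v es \<noteq> 0" using es by (auto simp: basis_list_def)
  \<comment> \<open>Prescribing the values of \<open>s\<close> on the basis members in
    \<open>S\<close> and 0 on the others makes \<open>d\<close> agree with \<open>s\<close> on all
    of \<open>S\<close>, while all its values stay below \<open>K * R\<close>.\<close>
  obtain d where d: "\<And>j. j < k \<Longrightarrow>
      pairing k (v (es ! j)) d = (if es ! j \<in> S then pairing k (v (es ! j)) s else 0)"
    using vdet_interpolation[OF nz, of "\<lambda>j. if es ! j \<in> S then pairing k (v (es ! j)) s else 0"] by blast
  have dS: "pairing k (v f) d = pairing k (v f) s" if "f \<in> S" for f
    unfolding pairing_expansion[OF nz len, of f d] pairing_expansion[OF nz len, of f s]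
  proof (rule sum.cong)
    fix j assume "j \<in> {..<k}"
    then have j: "j < k" by simp
    have "f \<in> E" using that S by blast
    have "coef k v es f j = 0" if "es ! j \<notin> S"
      using greedy[OF \<open>f \<in> E\<close> j] that \<open>f \<in> S\<close> by (cases "coef k v es f j = 0") auto
    then show "coef k v es f j * pairing k (v (es ! j)) d = coef k v es f j * pairing k (v (es ! j)) s"
      using d[OF j] by auto
  qed simp
  have dE: "cmod (pairing k (v f) d) \<le> K * R" if f: "f \<in> E" for f
  proof -
    have "cmod (pairing k (v f) d) \<le> (\<Sum>j<k. cmod (coef k v es f j * pairing k (v (es ! j)) d))"
      unfolding pairing_expansion[OF nz len, of f d] by (rule norm_sum)
    also have "\<dots> \<le> (\<Sum>j<k. K / k * R)"
    proof (rule sum_mono)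
      fix j assume "j \<in> {..<k}"
      then have j: "j < k" by simp
      have "cmod (coef k v es f j) \<le> K / k" using K[OF es f j] j by (simp add: field_simps)
      moreover have "cmod (pairing k (v (es ! j)) d) \<le> R" using d[OF j] R R0 by auto
      ultimately show "cmod (coef k v es f j * pairing k (v (es ! j)) d) \<le> K / k * R"
        unfolding norm_mult by (intro mult_mono') auto
    qed
    also have "\<dots> \<le> K * R" using R0 K1 by simp
    finally show ?thesis .
  qed
  define u where "u i = s i - d i" for i
  \<comment> \<open>The right-hand side is encoded as a datum concentrated at \<open>e\<close>. It
    disappears from the test with \<open>u\<close>, whatever \<open>\<kappa>\<close> is, because
    \<open>u\<close> pairs to 0 with \<open>v e\<close>.\<close>
  have "normal_eq W s (\<lambda>f. if f = e then \<kappa> / W e else 0)"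
    unfolding normal_eq_def
  proof (intro allI impI)
    fix i assume i: "i < k"
    have We: "W e \<noteq> 0" using W[of e] S by auto
    have "(\<Sum>f\<in>E. of_real (W f) * cnj (v f i) * (if f = e then \<kappa> / W e else 0)) =
        (\<Sum>f\<in>E. if f = e then \<kappa> * cnj (v e i) else 0)"
      using We by (intro sum.cong) auto
    also have "\<dots> = \<kappa> * cnj (v e i)" using S finite_E by auto
    finally show "(\<Sum>f\<in>E. of_real (W f) * cnj (v f i) *
        (pairing k (v f) s - (if f = e then \<kappa> / W e else 0))) = 0"
      using eq[OF i] by (simp add: right_diff_distrib sum_subtractf)
  qed
  from normal_eq_test[OF this, of u]
  have "(\<Sum>f\<in>E. Re (of_real (W f) * cnj (pairing k (v f) u) *
      (pairing k (v f) s - (if f = e then \<kappa> / W e else 0)))) = 0"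
    unfolding Re_sum[symmetric] by simp
  moreover have "(\<Sum>f\<in>E. Re (of_real (W f) * cnj (pairing k (v f) u) *
      (pairing k (v f) s - (if f = e then \<kappa> / W e else 0)))) > 0"
  proof -
    have uS: "pairing k (v f) u = 0" if "f \<in> S" for f
      using dS[OF that] by (simp add: u_def[abs_def] pairing_diff)
    \<comment> \<open>Outside \<open>S\<close> the value of \<open>d\<close> has smaller modulus
      than that of \<open>s\<close>, so the product of the conjugate of their difference with the
      value of \<open>s\<close> has positive real part.\<close>
    have pos: "Re (of_real (W f) * cnj (pairing k (v f) u) *
      (pairing k (v f) s - (if f = e then \<kappa> / W e else 0))) > 0" if f: "f \<in> E - S" for f
    proof -
      let ?t = "pairing k (v f) s" and ?d = "pairing k (v f) d"
      have fe: "f \<noteq> e" using f S by blast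
      have "cmod ?d < cmod ?t" using dE[of f] big[OF f] f by force
      moreover have "Re (cnj ?d * ?t) \<le> cmod ?d * cmod ?t"
        using complex_Re_le_cmod[of "cnj ?d * ?t"] by (simp add: norm_mult)
      ultimately have "Re (cnj ?d * ?t) < cmod ?t * cmod ?t"
        using mult_strict_right_mono[of "cmod ?d" "cmod ?t" "cmod ?t"] norm_ge_zero[of ?d] by linarith
      moreover have "Re (cnj ?t * ?t) = cmod ?t * cmod ?t"
        by (simp add: cmod_power2[unfolded power2_eq_square])
      ultimately have "Re (cnj (?t - ?d) * ?t) > 0" by (simp add: algebra_simps)
      then have "W f * Re (cnj (?t - ?d) * ?t) > 0" using W[of f] f by simp
      then show ?thesis using fe
        by (simp add: u_def[abs_def] pairing_diff mult.assoc algebra_simps)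
    qed
    define T where "T f = Re (of_real (W f) * cnj (pairing k (v f) u) *
      (pairing k (v f) s - (if f = e then \<kappa> / W e else 0)))" for f
    obtain g where g: "g \<in> E - S" using S by blast
    have "T f \<ge> 0" if "f \<in> E" for f
      using that pos[of f] uS[of f] by (cases "f \<in> S") (auto simp: T_def)
    moreover have "T g > 0" using pos[OF g] by (simp add: T_def)
    ultimately have "sum T E > 0" using g finite_E by (intro sum_pos2[of E g]) auto
    then show ?thesis by (simp add: T_def)
  qed
  ultimately show False by simp
qed

text \<open>The set \<open>S\<close> grows from \<open>{e}\<close> to \<open>E\<close> one normal at
  a time, each costing a factor \<open>K\<close> since no gap can occur. The constant does not
  involve the weights.\<close>

lemma pairing_propagation:
  assumes W: "\<And>f. f \<in> E \<Longrightarrow> W f > 0"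
    and K: "\<And>es f j. basis_list k E v es \<Longrightarrow> f \<in> E \<Longrightarrow> j < k \<Longrightarrow> k * cmod (coef k v es f j) \<le> K"
    and K1: "K \<ge> 1"
    and eq: "\<And>i. i < k \<Longrightarrow> (\<Sum>f\<in>E. of_real (W f) * cnj (v f i) * pairing k (v f) s) = \<kappa> * cnj (v e i)"
    and e: "e \<in> E" and f: "f \<in> E"
  shows "cmod (pairing k (v f) s) \<le> K ^ card E * cmod (pairing k (v e) s)"
proof -
  have gen: "\<forall>f\<in>E. cmod (pairing k (v f) s) \<le> K ^ n * R"
    if "S \<subseteq> E" "e \<in> S" "\<And>f. f \<in> S \<Longrightarrow> cmod (pairing k (v f) s) \<le> R" "card (E - S) = n" "R \<ge> 0" for S R n
    using that
  proof (induction n arbitrary: S R)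
    case 0
    then have "E = S" using finite_E by (metis Diff_eq_empty_iff card_0_eq finite_Diff subset_antisym)
    then show ?case using 0 by simp
  next
    case (Suc n)
    then have "S \<noteq> E" by auto
    from no_scale_gap[OF W K K1 eq Suc.prems(1) this Suc.prems(2,3)]
    obtain g where g: "g \<in> E - S" "cmod (pairing k (v g) s) \<le> K * R" by blast
    have "R \<le> K * R" using K1 Suc.prems(5) by (simp add: mult_le_cancel_right1)
    have "card (E - insert g S) = n"
    proof -
      have "E - insert g S = (E - S) - {g}" by blast
      then show ?thesis using g Suc.prems(4) finite_E by simp
    qed
    moreover have "cmod (pairing k (v h) s) \<le> K * R" if "h \<in> insert g S" for h
      using that g(2) Suc.prems(3)[of h] \<open>R \<le> K * R\<close> by auto
    ultimately have "\<forall>f\<in>E. cmod (pairing k (v f) s) \<le> K ^ n * (K * R)"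
      using Suc.prems g K1 by (intro Suc.IH[of "insert g S"]) auto
    then show ?case by (simp add: mult_ac)
  qed
  have "card (E - {e}) \<le> card E" using finite_E by (simp add: card_mono)
  then have "K ^ card (E - {e}) \<le> K ^ card E" using K1 by (simp add: power_increasing)
  moreover have "cmod (pairing k (v f) s) \<le> K ^ card (E - {e}) * cmod (pairing k (v e) s)"
    using gen[of "{e}" "cmod (pairing k (v e) s)"] e f by auto
  ultimately show ?thesis by (meson mult_right_mono norm_ge_zero order_trans)
qed

end

context arrangement begin

text \<open>The matrix \<open>H\<close> with entries \<open>pairing k (v f) (\<sigma> e)\<close> is Hermitian, its diagonal satisfies
  \<open>H e e \<le> 1 / W e\<close>, and by propagation all entries of a column are dominated by the diagonal one.\<close>

lemma wls_pairing_bound: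
  assumes W: "\<And>f. f \<in> E \<Longrightarrow> W f > 0"
    and K: "\<And>es f j. basis_list k E v es \<Longrightarrow> f \<in> E \<Longrightarrow> j < k \<Longrightarrow> k * cmod (coef k v es f j) \<le> K"
    and K1: "K \<ge> 1"
    and s: "normal_eq W s z" and f: "f \<in> E"
  shows "cmod (pairing k (v f) s) \<le> K ^ card E * (\<Sum>e\<in>E. min 1 (W e / W f) * cmod (z e))"
proof -
  \<comment> \<open>The Gram matrix \<open>G\<close> maps \<open>\<sigma> e\<close> to the conjugate
    of \<open>v e\<close>. So, if \<open>V\<close> has the normals as rows, \<open>H\<close> is the
    product of \<open>V\<close>, the inverse of \<open>G\<close> and the conjugate transpose of
    \<open>V\<close>.\<close>
  define \<sigma> where "\<sigma> e = wls k E v W (\<lambda>g. if g = e then 1 / of_real (W e) else 0)" for e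
  define H where "H f e = pairing k (v f) (\<sigma> e)" for f e
  have ind: "(\<Sum>g\<in>E. of_real (W g) * c g * (if g = e then 1 / of_real (W e) else 0)) = c e"
    if "e \<in> E" for e and c :: "'e \<Rightarrow> complex"
  proof -
    have "(\<Sum>g\<in>E. of_real (W g) * c g * (if g = e then 1 / of_real (W e) else 0)) =
        (\<Sum>g\<in>E. if g = e then c e else 0)"
      using W[OF that] by (intro sum.cong) auto
    then show ?thesis using finite_E that by simp
  qed
  have n\<sigma>: "normal_eq W (\<sigma> e) (\<lambda>g. if g = e then 1 / of_real (W e) else 0)" for e
    unfolding \<sigma>_def by (rule wls_normal_eq[OF W])
  have test: "(\<Sum>g\<in>E. of_real (W g) * cnj (pairing k (v g) u) * H g e) = cnj (pairing k (v e) u)"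
    if "e \<in> E" for e u
    using normal_eq_test[OF n\<sigma>[of e], of u] ind[OF that, of "\<lambda>g. cnj (pairing k (v g) u)"]
    by (simp add: H_def right_diff_distrib sum_subtractf)
  have herm: "H f e = cnj (H e f)" if "e \<in> E" "f \<in> E" for e f
  proof -
    have "cnj (H e f) = (\<Sum>g\<in>E. of_real (W g) * cnj (H g f) * H g e)"
      using test[OF that(1), of "\<sigma> f"] by (simp add: H_def)
    also have "\<dots> = cnj (\<Sum>g\<in>E. of_real (W g) * cnj (H g e) * H g f)"
      by (simp add: mult_ac)
    also have "\<dots> = H f e"
      using test[OF that(2), of "\<sigma> e"] by (simp add: H_def)
    finally show ?thesis by simp
  qed
  \<comment> \<open>Testing the equation of \<open>\<sigma> e\<close> with \<open>\<sigma> e\<close>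
    shows that the conjugate of \<open>H e e\<close> is the sum of all
    \<open>W g * (cmod (H g e))\<^sup>2\<close>, of which \<open>g = e\<close> is one term.\<close>
  have diag: "cmod (H e e) \<le> 1 / W e" if e: "e \<in> E" for e
  proof -
    have "cnj (H e e) = (\<Sum>g\<in>E. of_real (W g * (cmod (H g e))\<^sup>2))"
      using test[OF e, of "\<sigma> e"] by (simp add: H_def complex_norm_square mult_ac del: of_real_power)
    then have "cnj (H e e) = of_real (\<Sum>g\<in>E. W g * (cmod (H g e))\<^sup>2)"
      by simp
    then have "cmod (H e e) = \<bar>\<Sum>g\<in>E. W g * (cmod (H g e))\<^sup>2\<bar>"
      by (metis complex_mod_cnj norm_of_real)
    also have "\<dots> = (\<Sum>g\<in>E. W g * (cmod (H g e))\<^sup>2)"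
      using W by (intro abs_of_nonneg sum_nonneg) (simp add: less_imp_le)
    also have "\<dots> \<ge> W e * (cmod (H e e))\<^sup>2"
      using W finite_E by (intro member_le_sum[OF e]) (auto simp: less_imp_le)
    finally have "W e * cmod (H e e) * cmod (H e e) \<le> 1 * cmod (H e e)"
      by (simp add: power2_eq_square mult_ac)
    then have "W e * cmod (H e e) \<le> 1" 
      by (cases "cmod (H e e) = 0") (auto simp: mult_le_cancel_right)
    then show ?thesis using W[OF e] by (simp add: field_simps)
  qed
  have col: "cmod (H f e) \<le> K ^ card E * (1 / W e)" if e: "e \<in> E" and f: "f \<in> E" for e f
  proof -
    have eq: "(\<Sum>g\<in>E. of_real (W g) * cnj (v g i) * pairing k (v g) (\<sigma> e)) = 1 * cnj (v e i)" if "i < k" for i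
      using n\<sigma>[of e] ind[OF e, of "\<lambda>g. cnj (v g i)"] that
      by (simp add: normal_eq_def right_diff_distrib sum_subtractf)
    have "cmod (H f e) \<le> K ^ card E * cmod (H e e)"
      unfolding H_def by (rule pairing_propagation[OF W K K1 eq e f])
    also have "\<dots> \<le> K ^ card E * (1 / W e)" using diag[OF e] K1 by (intro mult_left_mono) auto
    finally show ?thesis .
  qed
  \<comment> \<open>Both arguments of the minimum come from the column bound: the first directly,
    the second after exchanging \<open>e\<close> and \<open>f\<close> by Hermitian symmetry.\<close>
  have Hb: "W e * cmod (H f e) \<le> K ^ card E * min 1 (W e / W f)" if e: "e \<in> E" and f: "f \<in> E" for e f
  proof -
    have "W e * cmod (H f e) \<le> K ^ card E"
      using mult_left_mono[OF col[OF e f], of "W e"] W[OF e] by simp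
    moreover have "cmod (H f e) = cmod (H e f)" using herm[OF e f] by simp
    then have "W e * cmod (H f e) \<le> K ^ card E * (W e / W f)"
      using mult_left_mono[OF col[OF f e], of "W e"] W[OF e] by (simp add: mult_ac)
    ultimately show ?thesis by (simp add: min_def)
  qed
  \<comment> \<open>Superposition of the solutions for the single data; uniqueness identifies it
    with \<open>s\<close>.\<close>
  define t where "t i = (\<Sum>e\<in>E. (of_real (W e) * z e) * \<sigma> e i)" for i
  have pt: "pairing k (v g) t = (\<Sum>e\<in>E. (of_real (W e) * z e) * H g e)" for g
    unfolding t_def[abs_def] pairing_sum pairing_scale H_def ..
  have "normal_eq W t z"
    unfolding normal_eq_def
  proof (intro allI impI)
    fix i assume i: "i < k"
    have "(\<Sum>g\<in>E. of_real (W g) * cnj (v g i) * pairing k (v g) t) =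
        (\<Sum>g\<in>E. \<Sum>e\<in>E. (of_real (W e) * z e) * (of_real (W g) * cnj (v g i) * H g e))"
      unfolding pt sum_distrib_left by (intro sum.cong refl) (simp add: mult_ac)
    also have "\<dots> = (\<Sum>e\<in>E. (of_real (W e) * z e) * (\<Sum>g\<in>E. of_real (W g) * cnj (v g i) * H g e))"
      by (subst sum.swap) (simp add: sum_distrib_left)
    also have "\<dots> = (\<Sum>e\<in>E. (of_real (W e) * z e) * cnj (v e i))"
    proof (rule sum.cong)
      fix e assume e: "e \<in> E"
      have "(\<Sum>g\<in>E. of_real (W g) * cnj (v g i) * H g e) = cnj (v e i)"
        using n\<sigma>[of e] ind[OF e, of "\<lambda>g. cnj (v g i)"] i
        by (simp add: normal_eq_def H_def right_diff_distrib sum_subtractf)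
      then show "(of_real (W e) * z e) * (\<Sum>g\<in>E. of_real (W g) * cnj (v g i) * H g e) =
        (of_real (W e) * z e) * cnj (v e i)" by simp
    qed simp
    finally show "(\<Sum>g\<in>E. of_real (W g) * cnj (v g i) * (pairing k (v g) t - z g)) = 0"
      by (simp add: right_diff_distrib sum_subtractf mult_ac)
  qed
  then have "s i = t i" if "i < k" for i using normal_eq_unique[OF W s _ that] by blast
  then have "pairing k (v f) s = (\<Sum>e\<in>E. (of_real (W e) * z e) * H f e)"
    unfolding pt[symmetric] by (rule pairing_cong)
  then have "cmod (pairing k (v f) s) \<le> (\<Sum>e\<in>E. cmod ((of_real (W e) * z e) * H f e))"
    using norm_sum by metis
  also have "\<dots> \<le> (\<Sum>e\<in>E. K ^ card E * (min 1 (W e / W f) * cmod (z e)))"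
  proof (rule sum_mono)
    fix e assume e: "e \<in> E"
    have "cmod ((of_real (W e) * z e) * H f e) = (W e * cmod (H f e)) * cmod (z e)"
      using W[OF e] by (simp add: norm_mult)
    also have "\<dots> \<le> (K ^ card E * min 1 (W e / W f)) * cmod (z e)"
      by (intro mult_right_mono Hb e f) simp
    finally show "cmod ((of_real (W e) * z e) * H f e) \<le> K ^ card E * (min 1 (W e / W f) * cmod (z e))"
      by (simp add: mult_ac)
  qed
  finally show ?thesis by (simp add: sum_distrib_left)
qed

end

section \<open>Transport to a nearby arrangement with the same matroid\<close>

definition cutoff :: "real \<Rightarrow> complex \<Rightarrow> real" where
  "cutoff \<eta> x = max (cmod x) \<eta>"

lemma cutoff_lipschitz: "\<bar>cutoff \<eta> x - cutoff \<eta> y\<bar> \<le> cmod (x - y)"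
  using norm_triangle_ineq3[of x y] by (auto simp: cutoff_def max_def)

definition sum_norm :: "nat \<Rightarrow> (nat \<Rightarrow> complex) \<Rightarrow> real" where
  "sum_norm k p = (\<Sum>i<k. cmod (p i))"

lemma sum_norm_nonneg: "sum_norm k p \<ge> 0"
  by (simp add: sum_norm_def sum_nonneg)

lemma pairing_le_sum_norm:
  assumes "\<And>i. i < k \<Longrightarrow> cmod (u i) \<le> c"
  shows "cmod (pairing k u p) \<le> c * sum_norm k p"
  unfolding pairing_def sum_norm_def sum_distrib_left
  by (rule sum_norm_le) (simp add: norm_mult mult_right_mono assms)

text \<open>\<open>v0\<close> is the arrangement over the base point and \<open>v\<close> the one to
  which points are moved. \<open>K\<close> bounds the expansions for \<open>v\<close>,
  \<open>A\<close> the entries of \<open>v0\<close>, and \<open>\<epsilon>\<close> the change of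
  both entries and expansion coefficients.\<close>

locale nearby_arrangement = arrangement +
  fixes v0 :: "'a \<Rightarrow> nat \<Rightarrow> complex" and K A \<epsilon> :: real
  assumes K: "basis_list k E v es \<Longrightarrow> f \<in> E \<Longrightarrow> j < k \<Longrightarrow> k * cmod (coef k v es f j) \<le> K"
    and K1: "K \<ge> 1"
    and same_matroid: "length es = k \<Longrightarrow> set es \<subseteq> E \<Longrightarrow> vdet k v es \<noteq> 0 \<longleftrightarrow> vdet k v0 es \<noteq> 0"
    and coef_close: "basis_list k E v es \<Longrightarrow> f \<in> E \<Longrightarrow> j < k \<Longrightarrow>
      cmod (coef k v0 es f j - coef k v es f j) \<le> \<epsilon>"
    and entry_close: "e \<in> E \<Longrightarrow> i < k \<Longrightarrow> cmod (v0 e i - v e i) \<le> \<epsilon>"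
    and entry_bound: "e \<in> E \<Longrightarrow> i < k \<Longrightarrow> cmod (v0 e i) \<le> A"
    and nonneg: "A \<ge> 0" "\<epsilon> \<ge> 0"
begin

definition wt :: "real \<Rightarrow> (nat \<Rightarrow> complex) \<Rightarrow> 'a \<Rightarrow> real" where
  "wt \<eta> p e = 1 / cutoff \<eta> (pairing k (v0 e) p)"

text \<open>What makes all weights positive: it holds everywhere if \<open>\<eta> > 0\<close>, and
  on the complement of the arrangement \<open>v0\<close> if \<open>\<eta> = 0\<close>.\<close>

definition admissible :: "real \<Rightarrow> (nat \<Rightarrow> complex) \<Rightarrow> bool" where
  "admissible \<eta> p \<longleftrightarrow> (\<forall>e\<in>E. cutoff \<eta> (pairing k (v0 e) p) > 0)"

definition transport :: "real \<Rightarrow> (nat \<Rightarrow> complex) \<Rightarrow> nat \<Rightarrow> complex" where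
  "transport \<eta> p = wls k E v (wt \<eta> p) (\<lambda>e. pairing k (v0 e) p)"

lemma transport_normal_eq:
  "admissible \<eta> p \<Longrightarrow> normal_eq (wt \<eta> p) (transport \<eta> p) (\<lambda>e. pairing k (v0 e) p)"
  unfolding transport_def by (rule wls_normal_eq) (auto simp: wt_def admissible_def)

text \<open>In \<open>residual_bound\<close>, each of \<open>card E\<close> data errors enters with
  the factor \<open>K ^ card E\<close>, and one more error comes from the interpolating vector; all
  of them have relative size at most \<open>k * \<epsilon>\<close>.\<close>

definition residual_const :: real where
  "residual_const = (K ^ card E * card E + 1) * k"

lemma residual_const_nonneg: "residual_const \<ge> 0"
  using K1 by (simp add: residual_const_def)

text \<open>Let \<open>d\<close> take, under \<open>v\<close>, the given values on a basis that is
  minimal for their moduli; then it misses every datum only by a small multiple of that datum. The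
  transported point differs from \<open>d\<close> by the solution for these errors, and the factor
  \<open>min 1 (W e / W f)\<close> of its bound turns an error relative to the value at
  \<open>e\<close> into one relative to the value at \<open>f\<close>.\<close>

lemma residual_bound:
  assumes adm: "admissible \<eta> p" and f: "f \<in> E"
  shows "cmod (pairing k (v f) (transport \<eta> p) - pairing k (v0 f) p)
    \<le> residual_const * \<epsilon> * cutoff \<eta> (pairing k (v0 f) p)"
proof -
  define x where "x e = pairing k (v0 e) p" for e
  define \<mu> where "\<mu> e = cutoff \<eta> (x e)" for e
  define q where "q = transport \<eta> p"
  have \<mu>: "\<mu> e > 0" "cmod (x e) \<le> \<mu> e" if "e \<in> E" for e
    using adm that by (auto simp: \<mu>_def x_def admissible_def cutoff_def)
  have bas_iff: "basis_list k E v es \<longleftrightarrow> basis_list k E v0 es" for es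
    using same_matroid by (auto simp: basis_list_def)
  obtain es where es0: "basis_list k E v0 es"
    and greedy: "\<And>f j. f \<in> E \<Longrightarrow> j < k \<Longrightarrow> coef k v0 es f j \<noteq> 0 \<Longrightarrow> cmod (x (es ! j)) \<le> cmod (x f)"
    using greedy_basis[of E k v0 "\<lambda>e. cmod (x e)"] finite_E basis_exists bas_iff by blast
  have es: "basis_list k E v es" using es0 bas_iff by blast
  have len: "length es = k" and nz: "vdet k v es \<noteq> 0" and nz0: "vdet k v0 es \<noteq> 0"
    using es es0 by (auto simp: basis_list_def)
  obtain d where d: "\<And>j. j < k \<Longrightarrow> pairing k (v (es ! j)) d = x (es ! j)"
    using vdet_interpolation[OF nz, of "\<lambda>j. x (es ! j)"] by blast
  have z: "cmod (x e - pairing k (v e) d) \<le> k * \<epsilon> * cmod (x e)" if e: "e \<in> E" for e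
  proof -
    have "x e - pairing k (v e) d = (\<Sum>j<k. (coef k v0 es e j - coef k v es e j) * x (es ! j))"
      unfolding pairing_expansion[OF nz len, of e d]
      using pairing_expansion[OF nz0 len, of e p] d
      by (simp add: x_def sum_subtractf left_diff_distrib)
    also have "cmod \<dots> \<le> (\<Sum>j<k. \<epsilon> * cmod (x e))"
    proof (rule sum_norm_le)
      fix j assume "j \<in> {..<k}"
      then have j: "j < k" by simp
      show "cmod ((coef k v0 es e j - coef k v es e j) * x (es ! j)) \<le> \<epsilon> * cmod (x e)"
      proof (cases "coef k v0 es e j = 0")
        \<comment> \<open>The constant matroid enters here: a coefficient that is zero for
          \<open>v0\<close> is zero for \<open>v\<close>. A nonzero one multiplies a value no larger
          than \<open>x e\<close>, by the choice of the basis.\<close>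
        case True
        have "set (es[j := e]) \<subseteq> E"
          using set_update_subset_insert[of es j e] es e by (auto simp: basis_list_def)
        then have "vdet k v (es[j := e]) = 0"
          using True nz0 same_matroid[of "es[j := e]"] len by (auto simp: coef_def)
        then have "coef k v es e j = 0" by (simp add: coef_def)
        then show ?thesis using True nonneg by simp
      next
        case False
        show ?thesis unfolding norm_mult
          by (intro mult_mono coef_close[OF es e j] greedy[OF e j False] nonneg) auto
      qed
    qed
    also have "\<dots> = k * \<epsilon> * cmod (x e)" by simp
    finally show ?thesis .
  qed
  have pos: "wt \<eta> p e > 0" if "e \<in> E" for e using \<mu>(1)[OF that] by (simp add: wt_def \<mu>_def x_def)
  have "normal_eq (wt \<eta> p) (\<lambda>i. q i - d i) (\<lambda>e. x e - pairing k (v e) d)"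
    using transport_normal_eq[OF adm] unfolding normal_eq_def pairing_diff
    by (simp add: q_def x_def)
  from wls_pairing_bound[OF pos K K1 this f]
  have "cmod (pairing k (v f) (\<lambda>i. q i - d i)) \<le> K ^ card E *
      (\<Sum>e\<in>E. min 1 (wt \<eta> p e / wt \<eta> p f) * cmod (x e - pairing k (v e) d))" by blast
  also have "\<dots> \<le> K ^ card E * (\<Sum>e\<in>E. k * \<epsilon> * \<mu> f)"
  proof (intro mult_left_mono sum_mono)
    fix e assume e: "e \<in> E"
    have "min 1 (wt \<eta> p e / wt \<eta> p f) * cmod (x e - pairing k (v e) d) \<le> (\<mu> f / \<mu> e) * (k * \<epsilon> * \<mu> e)"
    proof (rule mult_mono)
      show "min 1 (wt \<eta> p e / wt \<eta> p f) \<le> \<mu> f / \<mu> e"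
        by (simp add: wt_def \<mu>_def x_def)
      have "k * \<epsilon> * cmod (x e) \<le> k * \<epsilon> * \<mu> e"
        using \<mu>(2)[OF e] nonneg by (intro mult_left_mono) auto
      then show "cmod (x e - pairing k (v e) d) \<le> k * \<epsilon> * \<mu> e" using z[OF e] by linarith
    qed (use \<mu>(1)[OF e] \<mu>(1)[OF f] in auto)
    also have "\<dots> = k * \<epsilon> * \<mu> f" using \<mu>(1)[OF e] by simp
    finally show "min 1 (wt \<eta> p e / wt \<eta> p f) * cmod (x e - pairing k (v e) d) \<le> k * \<epsilon> * \<mu> f" .
  qed (use K1 in auto)
  finally have 1: "cmod (pairing k (v f) (\<lambda>i. q i - d i)) \<le> K ^ card E * card E * k * \<epsilon> * \<mu> f"
    by (simp add: mult_ac)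
  have "cmod (x f - pairing k (v f) d) \<le> k * \<epsilon> * \<mu> f"
    using z[OF f] mult_left_mono[OF \<mu>(2)[OF f], of "k * \<epsilon>"] nonneg by simp
  moreover have "pairing k (v f) q - x f = pairing k (v f) (\<lambda>i. q i - d i) - (x f - pairing k (v f) d)"
    by (simp add: pairing_diff)
  ultimately have "cmod (pairing k (v f) q - x f) \<le> K ^ card E * card E * k * \<epsilon> * \<mu> f + k * \<epsilon> * \<mu> f"
    using 1 norm_triangle_ineq4[of "pairing k (v f) (\<lambda>i. q i - d i)" "x f - pairing k (v f) d"]
    by (simp only:)
  then show ?thesis by (simp add: q_def x_def \<mu>_def residual_const_def algebra_simps)
qed

definition lipschitz_const :: real where
  "lipschitz_const = k * (K ^ card E * card E * (\<epsilon> + residual_const * \<epsilon> * A))"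

text \<open>The difference \<open>\<sigma>\<close> of the two displacements solves the normal
  equations with the weights of \<open>p'\<close>. One part of its data comes from the difference of
  the normals, the other from the change of weights; the latter carries the factor
  \<open>(\<mu>' - \<mu>) / \<mu>\<close>, whose denominator cancels against the residual bound. The
  coordinate forms turn bounds on pairings into bounds on entries, and summation over the entries
  gives the factor \<open>k\<close>.\<close>

lemma transport_lipschitz:
  assumes adm: "admissible \<eta> p" "admissible \<eta> p'"
  shows "sum_norm k (\<lambda>i. (transport \<eta> p' i - p' i) - (transport \<eta> p i - p i))
    \<le> lipschitz_const * sum_norm k (\<lambda>i. p' i - p i)"
proof -
  define x where "x e = pairing k (v0 e) p" for e
  define x' where "x' e = pairing k (v0 e) p'" for e
  define q where "q = transport \<eta> p"
  define q' where "q' = transport \<eta> p'"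
  define W where "W = wt \<eta> p"
  define W' where "W' = wt \<eta> p'"
  define r where "r e = pairing k (v e) q - x e" for e
  define D where "D = sum_norm k (\<lambda>i. p' i - p i)"
  define \<sigma> where "\<sigma> i = (q' i - p' i) - (q i - p i)" for i
  have D0: "D \<ge> 0" by (simp add: D_def sum_norm_nonneg)
  have pos: "W e > 0" "W' e > 0" if "e \<in> E" for e
    using adm that by (auto simp: W_def W'_def wt_def admissible_def)
  have n: "(\<Sum>f\<in>E. of_real (W f) * cnj (v f i) * (pairing k (v f) q - x f)) = 0"
    and n': "(\<Sum>f\<in>E. of_real (W' f) * cnj (v f i) * (pairing k (v f) q' - x' f)) = 0" if "i < k" for i
    using transport_normal_eq[OF adm(1)] transport_normal_eq[OF adm(2)] that
    by (auto simp: normal_eq_def W_def W'_def x_def x'_def q_def q'_def)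
  define z where "z e = (pairing k (\<lambda>i. v0 e i - v e i) (\<lambda>i. p' i - p i)) + (W e / W' e - 1) * r e" for e
  have n\<sigma>: "normal_eq W' \<sigma> z"
    unfolding normal_eq_def
  proof (intro allI impI)
    fix i assume i: "i < k"
    have "of_real (W' f) * cnj (v f i) * (pairing k (v f) \<sigma> - z f) =
        of_real (W' f) * cnj (v f i) * (pairing k (v f) q' - x' f) -
        of_real (W f) * cnj (v f i) * (pairing k (v f) q - x f)" if f: "f \<in> E" for f
    proof -
      have eq1: "pairing k (\<lambda>i. v0 f i - v f i) (\<lambda>i. p' i - p i) =
          (x' f - x f) - (pairing k (v f) p' - pairing k (v f) p)"
        by (simp add: pairing_def x_def x'_def algebra_simps sum_subtractf sum.distrib)
      have eq2: "pairing k (v f) \<sigma> = (pairing k (v f) q' - pairing k (v f) p') - (pairing k (v f) q - pairing k (v f) p)"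
        unfolding \<sigma>_def[abs_def] pairing_diff ..
      \<comment> \<open>Multiplication by \<open>W' f\<close> turns the factor
        \<open>W f / W' f\<close> into \<open>W f\<close>, so the equations for \<open>p'\<close>
        and for \<open>p\<close> can be subtracted although their weights differ.\<close>
      have eq3: "pairing k (v f) \<sigma> - z f = (pairing k (v f) q' - x' f) - (W f / W' f) * (pairing k (v f) q - x f)"
        unfolding z_def r_def eq1 eq2 by (simp add: algebra_simps)
      show ?thesis unfolding eq3 using pos(2)[OF f] by (simp add: right_diff_distrib)
    qed
    then have "(\<Sum>f\<in>E. of_real (W' f) * cnj (v f i) * (pairing k (v f) \<sigma> - z f)) =
        (\<Sum>f\<in>E. of_real (W' f) * cnj (v f i) * (pairing k (v f) q' - x' f) -
        of_real (W f) * cnj (v f i) * (pairing k (v f) q - x f))"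
      by (intro sum.cong) auto
    then show "(\<Sum>f\<in>E. of_real (W' f) * cnj (v f i) * (pairing k (v f) \<sigma> - z f)) = 0"
      using n[OF i] n'[OF i] by (simp add: sum_subtractf)
  qed
  have bound: "cmod (pairing k (v f) \<sigma>) \<le> K ^ card E * (\<Sum>e\<in>E. min 1 (W' e / W' f) * cmod (z e))"
    if "f \<in> E" for f
    by (rule wls_pairing_bound[OF pos(2) K K1 n\<sigma> that])
  have z: "cmod (z e) \<le> (\<epsilon> + residual_const * \<epsilon> * A) * D" if e: "e \<in> E" for e
  proof -
    have 1: "cmod (pairing k (\<lambda>i. v0 e i - v e i) (\<lambda>i. p' i - p i)) \<le> \<epsilon> * D"
      unfolding D_def by (rule pairing_le_sum_norm) (rule entry_close[OF e])
    define \<mu> where "\<mu> = cutoff \<eta> (x e)"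
    define \<mu>' where "\<mu>' = cutoff \<eta> (x' e)"
    have \<mu>: "\<mu> > 0" "\<mu>' > 0" using adm e by (auto simp: admissible_def \<mu>_def \<mu>'_def x_def x'_def)
    have WW: "W e / W' e = \<mu>' / \<mu>" by (simp add: W_def W'_def wt_def \<mu>_def \<mu>'_def x_def x'_def)
    have "cmod (of_real (W e / W' e - 1) * r e) = \<bar>W e / W' e - 1\<bar> * cmod (r e)"
      by (simp only: norm_mult norm_of_real)
    also have "\<dots> \<le> \<bar>W e / W' e - 1\<bar> * (residual_const * \<epsilon> * \<mu>)"
      using residual_bound[OF adm(1) e] by (intro mult_left_mono) (auto simp: r_def q_def x_def \<mu>_def)
    also have "\<bar>W e / W' e - 1\<bar> = \<bar>\<mu>' - \<mu>\<bar> / \<mu>"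
      using \<mu> unfolding WW by (simp add: diff_divide_distrib[symmetric] divide_simps abs_divide)
    also have "\<bar>\<mu>' - \<mu>\<bar> / \<mu> * (residual_const * \<epsilon> * \<mu>) = residual_const * \<epsilon> * \<bar>\<mu>' - \<mu>\<bar>"
      using \<mu> by simp
    also have "\<dots> \<le> residual_const * \<epsilon> * (A * D)"
    proof (intro mult_left_mono)
      have "\<bar>\<mu>' - \<mu>\<bar> \<le> cmod (x' e - x e)" unfolding \<mu>_def \<mu>'_def by (rule cutoff_lipschitz)
      also have "x' e - x e = pairing k (v0 e) (\<lambda>i. p' i - p i)" by (simp add: x_def x'_def pairing_diff)
      also have "cmod \<dots> \<le> A * D" unfolding D_def by (rule pairing_le_sum_norm) (rule entry_bound[OF e])
      finally show "\<bar>\<mu>' - \<mu>\<bar> \<le> A * D" .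
    qed (use residual_const_nonneg nonneg in auto)
    finally have 2: "cmod (of_real (W e / W' e - 1) * r e) \<le> residual_const * \<epsilon> * (A * D)" .
    have "cmod (z e) \<le> \<epsilon> * D + residual_const * \<epsilon> * (A * D)"
      using norm_triangle_ineq[of "pairing k (\<lambda>i. v0 e i - v e i) (\<lambda>i. p' i - p i)" "of_real (W e / W' e - 1) * r e"] 1 2
      by (simp add: z_def)
    then show ?thesis by (simp add: algebra_simps)
  qed
  have C0: "(\<epsilon> + residual_const * \<epsilon> * A) * D \<ge> 0"
    using residual_const_nonneg nonneg D0 by simp
  have "cmod (\<sigma> i) \<le> K ^ card E * card E * (\<epsilon> + residual_const * \<epsilon> * A) * D" if i: "i < k" for i
  proof -
    obtain e where e: "e \<in> E" "cmod (pairing k (v e) \<sigma>) = cmod (\<sigma> i)" using coordinate[OF i] by blast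
    have "cmod (\<sigma> i) \<le> K ^ card E * (\<Sum>g\<in>E. min 1 (W' g / W' e) * cmod (z g))"
      using bound[OF e(1)] e(2) by simp
    also have "\<dots> \<le> K ^ card E * (\<Sum>g\<in>E. 1 * ((\<epsilon> + residual_const * \<epsilon> * A) * D))"
      using K1 z by (intro mult_left_mono sum_mono mult_mono) auto
    finally show ?thesis by (simp add: mult_ac)
  qed
  then have "sum_norm k \<sigma> \<le> (\<Sum>i<k. K ^ card E * card E * (\<epsilon> + residual_const * \<epsilon> * A) * D)"
    unfolding sum_norm_def by (intro sum_mono) auto
  then show ?thesis
    by (simp add: \<sigma>_def[abs_def] q_def q'_def D_def lipschitz_const_def mult_ac)
qed

end

section \<open>Local triviality of arrangement complements\<close>

lemma continuous_map_tendsto: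
  "continuous_map T euclidean f \<longleftrightarrow> (\<forall>x\<in>topspace T. (f \<longlongrightarrow> f x) (atin T x))"
  by (simp add: continuous_map_atin)

lemma continuous_map_complex_mult:
  fixes f g :: "'a \<Rightarrow> complex"
  shows "continuous_map T euclidean f \<Longrightarrow> continuous_map T euclidean g \<Longrightarrow>
    continuous_map T euclidean (\<lambda>x. f x * g x)"
  by (simp add: continuous_map_tendsto tendsto_mult)

lemma continuous_map_complex_divide:
  fixes f g :: "'a \<Rightarrow> complex"
  shows "continuous_map T euclidean f \<Longrightarrow> continuous_map T euclidean g \<Longrightarrow>
    (\<And>x. x \<in> topspace T \<Longrightarrow> g x \<noteq> 0) \<Longrightarrow> continuous_map T euclidean (\<lambda>x. f x / g x)"
  by (simp add: continuous_map_tendsto tendsto_divide)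

lemma continuous_map_complex_prod:
  fixes f :: "'i \<Rightarrow> 'a \<Rightarrow> complex"
  shows "(\<And>i. i \<in> I \<Longrightarrow> continuous_map T euclidean (f i)) \<Longrightarrow>
    continuous_map T euclidean (\<lambda>x. \<Prod>i\<in>I. f i x)"
  by (simp add: continuous_map_tendsto tendsto_prod)

lemma continuous_map_complex_sum:
  fixes f :: "'i \<Rightarrow> 'a \<Rightarrow> complex"
  shows "(\<And>i. i \<in> I \<Longrightarrow> continuous_map T euclidean (f i)) \<Longrightarrow>
    continuous_map T euclidean (\<lambda>x. \<Sum>i\<in>I. f i x)"
  by (simp add: continuous_map_tendsto tendsto_sum)

lemma continuous_map_cnj:
  "continuous_map T euclidean f \<Longrightarrow> continuous_map T euclidean (\<lambda>x. cnj (f x))"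
  by (simp add: continuous_map_tendsto tendsto_cnj)

lemma continuous_map_det:
  fixes a :: "'a \<Rightarrow> nat \<Rightarrow> nat \<Rightarrow> complex"
  assumes "\<And>i j. i < k \<Longrightarrow> j < k \<Longrightarrow> continuous_map T euclidean (\<lambda>x. a x i j)"
  shows "continuous_map T euclidean (\<lambda>x. det (mat k k (\<lambda>(i, j). a x i j)))"
proof -
  have lt: "p i < k" if "p permutes {0..<k}" "i < k" for p i
    using permutes_in_image[OF that(1), of i] that(2) by simp
  have det: "det (mat k k (\<lambda>(i, j). a x i j)) =
      (\<Sum>p\<in>{p. p permutes {0..<k}}. signof p * (\<Prod>i = 0..<k. a x i (p i)))" for x
    by (subst det_def'[of _ k]) (simp_all add: lt)
  show ?thesis unfolding det
    by (intro continuous_map_complex_sum continuous_map_complex_mult continuous_map_complex_prod assms)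
       (simp_all add: lt)
qed

lemma continuous_map_into_complex_space:
  assumes "\<And>i. i \<in> I \<Longrightarrow> continuous_map T euclidean (\<lambda>x. f x i)"
    and "\<And>x. x \<in> topspace T \<Longrightarrow> f x \<in> extensional I"
  shows "continuous_map T (complex_space I) f"
  unfolding complex_space_def
  by (rule continuous_map_coordinatewise_then_product) (use assms in \<open>auto simp: extensional_def\<close>)

lemma topspace_complex_space: "topspace (complex_space I) = extensional I"
  by (simp add: complex_space_def PiE_def)

lemma continuous_map_complex_space_coordinate:
  "continuous_map T (complex_space I) f \<Longrightarrow> i \<in> I \<Longrightarrow> continuous_map T euclidean (\<lambda>x. f x i)"
  unfolding complex_space_def by (rule continuous_map_product_then_coordinatewise)

lemma continuous_map_wls:
  assumes W: "\<And>e. e \<in> E \<Longrightarrow> continuous_map T euclidean (\<lambda>x. complex_of_real (W x e))"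
    and v: "\<And>e i. e \<in> E \<Longrightarrow> i < k \<Longrightarrow> continuous_map T euclidean (\<lambda>x. v x e i)"
    and z: "\<And>e. e \<in> E \<Longrightarrow> continuous_map T euclidean (\<lambda>x. z x e)"
    and nz: "\<And>x. x \<in> topspace T \<Longrightarrow> det (mat k k (\<lambda>(i, j). gram_entry E (v x) (W x) i j)) \<noteq> 0"
  shows "continuous_map T (complex_space {..<k}) (\<lambda>x. wls k E (v x) (W x) (z x))"
proof (rule continuous_map_into_complex_space)
  fix j assume j: "j \<in> {..<k}"
  have gram: "continuous_map T euclidean (\<lambda>x. gram_entry E (v x) (W x) r c)" if "r < k" "c < k" for r c
    unfolding gram_entry_def
    by (intro continuous_map_complex_sum continuous_map_complex_mult continuous_map_cnj W v that)
  have rhs: "continuous_map T euclidean (\<lambda>x. \<Sum>f\<in>E. of_real (W x f) * cnj (v x f r) * z x f)" if "r < k" for r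
    by (intro continuous_map_complex_sum continuous_map_complex_mult continuous_map_cnj W v z that)
  have "continuous_map T euclidean (\<lambda>x.
     det (mat k k (\<lambda>(r, c). if c = j then (\<Sum>f\<in>E. of_real (W x f) * cnj (v x f r) * z x f)
                            else gram_entry E (v x) (W x) r c)) /
     det (mat k k (\<lambda>(i, j). gram_entry E (v x) (W x) i j)))"
  proof (intro continuous_map_complex_divide continuous_map_det nz)
    fix r c assume "r < k" "c < k"
    then show "continuous_map T euclidean (\<lambda>x. if c = j then
      (\<Sum>f\<in>E. of_real (W x f) * cnj (v x f r) * z x f) else gram_entry E (v x) (W x) r c)"
      using gram rhs by (cases "c = j") auto
  qed (use gram in auto)
  then show "continuous_map T euclidean (\<lambda>x. wls k E (v x) (W x) (z x) j)"
    using j by (simp add: wls_def)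
qed (simp add: wls_def)

lemma sum_norm_triangle: "sum_norm k (\<lambda>i. p i + q i) \<le> sum_norm k p + sum_norm k q"
  unfolding sum_norm_def sum.distrib[symmetric] by (intro sum_mono norm_triangle_ineq)

lemma sum_norm_eq_0: "sum_norm k p \<le> 0 \<Longrightarrow> i < k \<Longrightarrow> p i = 0"
proof -
  assume "sum_norm k p \<le> 0" "i < k"
  moreover have "cmod (p i) \<le> sum_norm k p"
    unfolding sum_norm_def using \<open>i < k\<close> by (intro member_le_sum) auto
  ultimately have "cmod (p i) \<le> 0" by linarith
  then show ?thesis by simp
qed

text \<open>Banach's theorem for a seminorm: \<open>sum_norm k\<close> sees only the entries below
  \<open>k\<close>, so the iterates converge in these entries, and \<open>F\<close> fixes the limit
  there. Continuity of \<open>F\<close> at the limit is the contraction estimate itself.\<close>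

lemma sum_norm_contraction_fixpoint:
  fixes F :: "(nat \<Rightarrow> complex) \<Rightarrow> nat \<Rightarrow> complex"
  assumes F: "\<And>p p'. sum_norm k (\<lambda>i. F p' i - F p i) \<le> 1 / 2 * sum_norm k (\<lambda>i. p' i - p i)"
  shows "\<exists>p. \<forall>i<k. F p i = p i"
proof -
  define P where "P n = (F ^^ n) (\<lambda>_. 0)" for n
  have PS: "P (Suc n) = F (P n)" for n by (simp add: P_def)
  define c where "c = sum_norm k (\<lambda>i. P 1 i - P 0 i)"
  have step: "sum_norm k (\<lambda>i. P (Suc n) i - P n i) \<le> c * (1 / 2) ^ n" for n
  proof (induction n)
    case (Suc n)
    have "sum_norm k (\<lambda>i. P (Suc (Suc n)) i - P (Suc n) i) \<le> 1 / 2 * sum_norm k (\<lambda>i. P (Suc n) i - P n i)"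
      using F[of "P (Suc n)" "P n"] by (simp add: PS)
    also have "\<dots> \<le> 1 / 2 * (c * (1 / 2) ^ n)" using Suc by simp
    finally show ?case by simp
  qed (simp add: c_def)
  have conv: "\<exists>l. (\<lambda>n. P n i) \<longlonglongrightarrow> l" if i: "i < k" for i
  proof -
    have bd: "norm (P (Suc n) i - P n i) \<le> c * (1 / 2) ^ n" for n
      using member_le_sum[of i "{..<k}" "\<lambda>i. cmod (P (Suc n) i - P n i)"] i step[of n]
      by (simp add: sum_norm_def)
    have "summable (\<lambda>n. c * (1 / 2) ^ n)" by (intro summable_mult summable_geometric) simp
    then have "summable (\<lambda>n. P (Suc n) i - P n i)"
      by (rule summable_comparison_test'[where N = 0]) (rule bd)
    then have "(\<lambda>n. \<Sum>j<n. P (Suc j) i - P j i) \<longlonglongrightarrow> (\<Sum>n. P (Suc n) i - P n i)"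
      by (rule summable_LIMSEQ)
    then have "(\<lambda>n. P n i - P 0 i) \<longlonglongrightarrow> (\<Sum>n. P (Suc n) i - P n i)"
      using sum_lessThan_telescope[of "\<lambda>n. P n i"] by simp
    from tendsto_add[OF this tendsto_const[of "P 0 i"]] show ?thesis
      by (intro exI) simp
  qed
  define L where "L i = lim (\<lambda>n. P n i)" for i
  have L: "(\<lambda>n. P n i) \<longlonglongrightarrow> L i" if "i < k" for i
    using conv[OF that] unfolding L_def convergent_def[symmetric] convergent_LIMSEQ_iff .
  have 1: "(\<lambda>n. 1 / 2 * sum_norm k (\<lambda>i. L i - P n i)) \<longlonglongrightarrow> 1 / 2 * sum_norm k (\<lambda>i. L i - L i)"
    unfolding sum_norm_def by (intro tendsto_mult tendsto_const tendsto_sum tendsto_norm tendsto_diff L) simp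
  have 2: "(\<lambda>n. sum_norm k (\<lambda>i. F L i - P (Suc n) i)) \<longlonglongrightarrow> sum_norm k (\<lambda>i. F L i - L i)"
    unfolding sum_norm_def by (intro tendsto_const tendsto_sum tendsto_norm tendsto_diff LIMSEQ_Suc[OF L]) simp
  have "sum_norm k (\<lambda>i. F L i - L i) \<le> 1 / 2 * sum_norm k (\<lambda>i. L i - L i)"
    by (rule LIMSEQ_le[OF 2 1]) (use F in \<open>simp only: PS, blast\<close>)
  then have "sum_norm k (\<lambda>i. F L i - L i) \<le> 0" by (simp add: sum_norm_def)
  from sum_norm_eq_0[OF this] have "F L i = L i" if "i < k" for i using that by simp
  then show ?thesis by blast
qed

section \<open>Transport as a homogeneous bijection of complements\<close>

definition arrangement_complement ::
    "nat \<Rightarrow> 'e set \<Rightarrow> ('e \<Rightarrow> nat \<Rightarrow> complex) \<Rightarrow> (nat \<Rightarrow> complex) set" where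
  "arrangement_complement k E v = {p \<in> extensional {..<k}. \<forall>e\<in>E. pairing k (v e) p \<noteq> 0}"

text \<open>The contraction factor 1/2 yields bijectivity; the bound 1/2 on relative residuals keeps
  images off the hyperplanes.\<close>

locale trivializing_arrangement = nearby_arrangement +
  assumes half: "lipschitz_const \<le> 1 / 2" "residual_const * \<epsilon> \<le> 1 / 2"
begin

lemma transport_nonexpansive:
  assumes "admissible \<eta> p" "admissible \<eta> p'"
  shows "sum_norm k (\<lambda>i. (transport \<eta> p' i - p' i) - (transport \<eta> p i - p i))
    \<le> 1 / 2 * sum_norm k (\<lambda>i. p' i - p i)"
  using transport_lipschitz[OF assms] mult_right_mono[OF half(1) sum_norm_nonneg]
  by (rule order_trans)

lemma residual_half:
  assumes "admissible \<eta> p" "f \<in> E"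
  shows "cmod (pairing k (v f) (transport \<eta> p) - pairing k (v0 f) p)
    \<le> 1 / 2 * cutoff \<eta> (pairing k (v0 f) p)"
proof -
  have "cutoff \<eta> (pairing k (v0 f) p) \<ge> 0" using assms by (auto simp: admissible_def less_imp_le)
  from mult_right_mono[OF half(2) this] show ?thesis
    using residual_bound[OF assms] by simp
qed

lemma transport_0:
  "transport 0 p = wls k E v (\<lambda>e. 1 / cmod (pairing k (v0 e) p)) (\<lambda>e. pairing k (v0 e) p)"
  by (simp add: transport_def wt_def[abs_def] cutoff_def)

lemma admissible_complement:
  "p \<in> arrangement_complement k E v0 \<Longrightarrow> admissible 0 p"
  by (auto simp: arrangement_complement_def admissible_def cutoff_def)

lemma transport_extensional: "transport \<eta> p \<in> extensional {..<k}"
  by (simp add: transport_def wls_def)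

lemma transport_complement:
  assumes "p \<in> arrangement_complement k E v0"
  shows "transport 0 p \<in> arrangement_complement k E v"
proof -
  have "pairing k (v f) (transport 0 p) \<noteq> 0" if f: "f \<in> E" for f
  proof
    assume "pairing k (v f) (transport 0 p) = 0"
    then have "cmod (pairing k (v0 f) p) \<le> 1 / 2 * cmod (pairing k (v0 f) p)"
      using residual_half[OF admissible_complement[OF assms] f] by (simp add: cutoff_def)
    moreover have "pairing k (v0 f) p \<noteq> 0" using assms f by (auto simp: arrangement_complement_def)
    ultimately show False by simp
  qed
  then show ?thesis using transport_extensional by (auto simp: arrangement_complement_def)
qed

text \<open>If two images agree, the displacements differ exactly by the difference of the points,
  which is then at most half of itself.\<close>

lemma transport_inj: "inj_on (transport 0) (arrangement_complement k E v0)"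
proof (rule inj_onI)
  fix p p' assume p: "p \<in> arrangement_complement k E v0" and p': "p' \<in> arrangement_complement k E v0"
    and eq: "transport 0 p = transport 0 p'"
  have "sum_norm k (\<lambda>i. p' i - p i) = sum_norm k (\<lambda>i. (transport 0 p' i - p' i) - (transport 0 p i - p i))"
    using eq by (simp add: sum_norm_def norm_minus_commute)
  also have "\<dots> \<le> 1 / 2 * sum_norm k (\<lambda>i. p' i - p i)"
    by (intro transport_nonexpansive admissible_complement p p')
  finally have "sum_norm k (\<lambda>i. p' i - p i) \<le> 0" by simp
  from sum_norm_eq_0[OF this] have eq: "p' i = p i" if "i < k" for i using that by simp
  show "p = p'"
    by (rule extensionalityI[of _ "{..<k}"]) (use p p' eq in \<open>simp_all add: arrangement_complement_def\<close>)
qed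

text \<open>Raising the cutoff below the given values \<open>pairing k (v f) q\<close> makes the weights bounded, so
  that Banach's theorem applies on the whole space, without changing the solution.\<close>

lemma transport_surj:
  assumes q: "q \<in> arrangement_complement k E v"
  shows "q \<in> transport 0 ` arrangement_complement k E v0"
proof -
  \<comment> \<open>The inserted 1 keeps the minimum defined for empty \<open>E\<close>; after
    halving, all values at \<open>q\<close> are at least \<open>2 * \<eta>\<close>.\<close>
  define \<eta> where "\<eta> = Min (insert 1 ((\<lambda>f. cmod (pairing k (v f) q)) ` E)) / 2"
  have fin: "finite (insert 1 ((\<lambda>f. cmod (pairing k (v f) q)) ` E))" using finite_E by simp
  have "Min (insert 1 ((\<lambda>f. cmod (pairing k (v f) q)) ` E)) > 0"
    using q by (subst Min_gr_iff[OF fin]) (auto simp: arrangement_complement_def)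
  then have \<eta>: "\<eta> > 0" by (simp add: \<eta>_def)
  have \<eta>f: "2 * \<eta> \<le> cmod (pairing k (v f) q)" if "f \<in> E" for f
    using Min_le[OF fin, of "cmod (pairing k (v f) q)"] that by (simp add: \<eta>_def)
  have adm: "admissible \<eta> p" for p using \<eta> by (auto simp: admissible_def cutoff_def max_def)
  \<comment> \<open>A fixed point of \<open>F\<close> is a preimage of \<open>q\<close> under
    \<open>transport \<eta>\<close>, and \<open>F\<close> contracts because the displacement
    does.\<close>
  define F where "F p = (\<lambda>i. q i - (transport \<eta> p i - p i))" for p
  have "\<exists>p. \<forall>i<k. F p i = p i"
  proof (rule sum_norm_contraction_fixpoint)
    fix p p'
    have "sum_norm k (\<lambda>i. F p' i - F p i) =
        sum_norm k (\<lambda>i. (transport \<eta> p' i - p' i) - (transport \<eta> p i - p i))"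
      unfolding sum_norm_def F_def
      by (intro sum.cong refl, subst norm_minus_cancel[symmetric]) (simp add: algebra_simps)
    then show "sum_norm k (\<lambda>i. F p' i - F p i) \<le> 1 / 2 * sum_norm k (\<lambda>i. p' i - p i)"
      using transport_nonexpansive[OF adm adm] by simp
  qed
  then obtain p0 where p0: "\<And>i. i < k \<Longrightarrow> F p0 i = p0 i" by blast
  define p where "p = restrict p0 {..<k}"
  have same: "transport \<eta> p = transport \<eta> p0"
    by (simp add: transport_def wt_def[abs_def] p_def)
  have Tq: "transport \<eta> p = q"
  proof (rule extensionalityI[OF transport_extensional])
    show "q \<in> extensional {..<k}" using q by (simp add: arrangement_complement_def)
    fix i assume "i \<in> {..<k}"
    then show "transport \<eta> p i = q i" using p0[of i] unfolding same by (simp add: F_def algebra_simps)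
  qed
  \<comment> \<open>If the value at \<open>p\<close> were below \<open>\<eta>\<close>, its cutoff
    would be \<open>\<eta>\<close> and the residual at most \<open>\<eta> / 2\<close>, so the value
    at \<open>q\<close> would be below \<open>3 * \<eta> / 2\<close>. Hence the cutoff is inactive
    at \<open>p\<close>.\<close>
  have big: "cmod (pairing k (v0 f) p) \<ge> \<eta>" if f: "f \<in> E" for f
  proof (rule ccontr)
    assume "\<not> ?thesis"
    then have less: "cmod (pairing k (v0 f) p) < \<eta>" by simp
    then have "cmod (pairing k (v f) q - pairing k (v0 f) p) \<le> 1 / 2 * \<eta>"
      using residual_half[OF adm f, of p] by (simp add: Tq cutoff_def max_def)
    moreover have "cmod (pairing k (v f) q) \<le> cmod (pairing k (v f) q - pairing k (v0 f) p) + cmod (pairing k (v0 f) p)"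
      using norm_triangle_sub[of "pairing k (v f) q" "pairing k (v0 f) p"] by simp
    ultimately show False using less \<eta>f[OF f] \<eta> by linarith
  qed
  have "pairing k (v0 f) p \<noteq> 0" if "f \<in> E" for f using big[OF that] \<eta> by auto
  then have "p \<in> arrangement_complement k E v0"
    by (simp add: arrangement_complement_def p_def)
  moreover have "transport 0 p = q"
  proof -
    have cut: "cutoff \<eta> (pairing k (v0 f) p) = cutoff 0 (pairing k (v0 f) p)" if "f \<in> E" for f
      using big[OF that] \<eta> by (simp add: cutoff_def max_def)
    have wt_eq: "wt \<eta> p f = wt 0 p f" if "f \<in> E" for f
      using cut[OF that] by (simp add: wt_def)
    have gram: "gram_entry E v (wt \<eta> p) i j = gram_entry E v (wt 0 p) i j" for i j
      unfolding gram_entry_def by (intro sum.cong refl) (simp add: wt_eq)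
    have rhs: "(\<Sum>f\<in>E. of_real (wt \<eta> p f) * cnj (v f r) * pairing k (v0 f) p) =
        (\<Sum>f\<in>E. of_real (wt 0 p f) * cnj (v f r) * pairing k (v0 f) p)" for r
      by (intro sum.cong refl) (simp add: wt_eq)
    have "transport \<eta> p = transport 0 p" unfolding transport_def wls_def gram rhs ..
    then show ?thesis using Tq by simp
  qed
  ultimately show ?thesis by blast
qed

lemma transport_bij:
  "bij_betw (transport 0) (arrangement_complement k E v0) (arrangement_complement k E v)"
  using transport_inj transport_surj transport_complement by (auto simp: bij_betw_def)

text \<open>Scaling \<open>p\<close> by \<open>c\<close> divides all weights by
  \<open>cmod c\<close> and multiplies all data by \<open>c\<close>; the normal equations are
  homogeneous in both, and their solution is unique.\<close>

lemma transport_scale: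
  assumes p: "p \<in> arrangement_complement k E v0" and c: "c \<noteq> 0"
  shows "transport 0 (\<lambda>i\<in>{..<k}. c * p i) = (\<lambda>i\<in>{..<k}. c * transport 0 p i)"
proof (rule extensionalityI[OF transport_extensional])
  let ?cp = "\<lambda>i\<in>{..<k}. c * p i"
  have cp: "?cp \<in> arrangement_complement k E v0"
    using p c by (auto simp: arrangement_complement_def pairing_scale)
  have W: "wt 0 ?cp e = wt 0 p e / cmod c" for e
    by (simp add: wt_def pairing_scale cutoff_def norm_mult)
  have "normal_eq (wt 0 ?cp) (\<lambda>i. c * transport 0 p i) (\<lambda>e. pairing k (v0 e) ?cp)"
    unfolding normal_eq_def
  proof (intro allI impI)
    fix i assume "i < k"
    have "(\<Sum>f\<in>E. of_real (wt 0 ?cp f) * cnj (v f i) *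
          (pairing k (v f) (\<lambda>i. c * transport 0 p i) - pairing k (v0 f) ?cp)) =
        (\<Sum>f\<in>E. (c / cmod c) * (of_real (wt 0 p f) * cnj (v f i) *
          (pairing k (v f) (transport 0 p) - pairing k (v0 f) p)))"
      by (intro sum.cong refl) (simp add: W pairing_scale algebra_simps)
    also have "\<dots> = 0"
      using transport_normal_eq[OF admissible_complement[OF p]] \<open>i < k\<close>
      unfolding sum_distrib_left[symmetric] by (simp add: normal_eq_def)
    finally show "(\<Sum>f\<in>E. of_real (wt 0 ?cp f) * cnj (v f i) *
          (pairing k (v f) (\<lambda>i. c * transport 0 p i) - pairing k (v0 f) ?cp)) = 0" .
  qed
  note eq = this
  fix i assume i: "i \<in> {..<k}"
  have "transport 0 ?cp i = c * transport 0 p i"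
    by (rule normal_eq_unique[OF _ transport_normal_eq[OF admissible_complement[OF cp]] eq])
       (use i cp in \<open>auto simp: wt_def cutoff_def arrangement_complement_def\<close>)
  then show "transport 0 ?cp i = (\<lambda>i\<in>{..<k}. c * transport 0 p i) i" using i by simp
qed simp

end

section \<open>Uniform constants near a base point\<close>

lemma openin_strict_sublevel:
  fixes g :: "'a \<Rightarrow> complex"
  assumes "continuous_map T euclidean g"
  shows "openin T {x \<in> topspace T. cmod (g x) < c}"
proof -
  have "open {z :: complex. cmod z < c}"
    by (intro open_Collect_less continuous_intros)
  then have "openin T {x \<in> topspace T. g x \<in> {z. cmod z < c}}"
    using assms by (intro openin_continuous_map_preimage) auto
  then show ?thesis by simp
qed

lemma openin_finite_Ball:
  assumes "finite I" and "\<And>i. i \<in> I \<Longrightarrow> openin T {x \<in> topspace T. P i x}"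
  shows "openin T {x \<in> topspace T. \<forall>i\<in>I. P i x}"
  using assms
proof (induction I)
  case (insert i I)
  have "{x \<in> topspace T. \<forall>j\<in>insert i I. P j x} =
      {x \<in> topspace T. P i x} \<inter> {x \<in> topspace T. \<forall>j\<in>I. P j x}" by blast
  then show ?case using insert by auto
qed simp

text \<open>The order of choices avoids a circle: \<open>K\<close> and \<open>A\<close>, and with
  them \<open>R\<close> and \<open>L\<close>, depend on \<open>b0\<close> only; then
  \<open>\<epsilon>\<close> is chosen, and last \<open>U\<close>. Since the bases are the same for
  all parameters, the denominators of the coefficients never vanish, and the coefficients are
  continuous.\<close>

lemma trivializing_neighbourhood:
  fixes T :: "'b topology" and v :: "'b \<Rightarrow> 'e \<Rightarrow> nat \<Rightarrow> complex"
  assumes finite_E: "finite E"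
    and cont: "\<And>e i. e \<in> E \<Longrightarrow> i < k \<Longrightarrow> continuous_map T euclidean (\<lambda>b. v b e i)"
    and coordinate: "\<And>b i. b \<in> topspace T \<Longrightarrow> i < k \<Longrightarrow>
      \<exists>e\<in>E. \<forall>p. cmod (pairing k (v b e) p) = cmod (p i)"
    and matroid: "\<And>b b' es. b \<in> topspace T \<Longrightarrow> b' \<in> topspace T \<Longrightarrow> length es = k \<Longrightarrow> set es \<subseteq> E \<Longrightarrow>
      vdet k (v b) es \<noteq> 0 \<longleftrightarrow> vdet k (v b') es \<noteq> 0"
    and b0: "b0 \<in> topspace T"
  obtains U K A \<epsilon> where "openin T U" "b0 \<in> U"
    "\<And>b. b \<in> U \<Longrightarrow> trivializing_arrangement k E (v b) (v b0) K A \<epsilon>"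
proof -
  define B where "B = {es. basis_list k E (v b0) es}"
  have finB: "finite B" unfolding B_def by (rule finite_basis_lists[OF finite_E])
  have bas: "basis_list k E (v b) es \<longleftrightarrow> es \<in> B" if "b \<in> topspace T" for b es
    using matroid[OF that b0, of es] by (auto simp: basis_list_def B_def)
  define S where "S = (\<Sum>es\<in>B. \<Sum>f\<in>E. \<Sum>j<k. cmod (coef k (v b0) es f j))"
  have S: "cmod (coef k (v b0) es f j) \<le> S" if "es \<in> B" "f \<in> E" "j < k" for es f j
  proof -
    have "cmod (coef k (v b0) es f j) \<le> (\<Sum>j<k. cmod (coef k (v b0) es f j))"
      using that by (intro member_le_sum) auto
    also have "\<dots> \<le> (\<Sum>f\<in>E. \<Sum>j<k. cmod (coef k (v b0) es f j))"
      using that finite_E by (intro member_le_sum) (auto intro: sum_nonneg)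
    also have "\<dots> \<le> S"
      unfolding S_def using that finB
      by (intro member_le_sum[where f = "\<lambda>es. \<Sum>f\<in>E. \<Sum>j<k. cmod (coef k (v b0) es f j)"])
         (auto intro!: sum_nonneg)
    finally show ?thesis .
  qed
  have S0: "S \<ge> 0" unfolding S_def by (intro sum_nonneg) auto
  \<comment> \<open>The 1 beside \<open>S\<close> allows for the change of a coefficient within
    \<open>U\<close>, which is less than \<open>\<epsilon> \<le> 1\<close>.\<close>
  define K where "K = 1 + k * (1 + S)"
  define A where "A = (\<Sum>e\<in>E. \<Sum>i<k. cmod (v b0 e i))"
  have A: "cmod (v b0 e i) \<le> A" if "e \<in> E" "i < k" for e i
  proof -
    have "cmod (v b0 e i) \<le> (\<Sum>i<k. cmod (v b0 e i))"
      using that by (intro member_le_sum) auto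
    also have "\<dots> \<le> A" unfolding A_def using that finite_E
      by (intro member_le_sum[where f = "\<lambda>e. \<Sum>i<k. cmod (v b0 e i)"]) (auto intro: sum_nonneg)
    finally show ?thesis .
  qed
  have A0: "A \<ge> 0" unfolding A_def by (intro sum_nonneg) auto
  have K1: "K \<ge> 1" using S0 by (simp add: K_def)
  \<comment> \<open>\<open>R\<close> and \<open>L * \<epsilon>\<close> will be the
    \<open>residual_const\<close> and the \<open>lipschitz_const\<close> of the arrangements over
    \<open>U\<close>; the choice of \<open>\<epsilon>\<close> makes \<open>R * \<epsilon>\<close>
    and \<open>L * \<epsilon>\<close> at most 1/2.\<close>
  define R where "R = (K ^ card E * card E + 1) * k"
  define L where "L = k * (K ^ card E * card E * (1 + R * A))"
  have R0: "R \<ge> 0" and L0: "L \<ge> 0" using K1 A0 by (simp_all add: R_def L_def)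
  define \<epsilon> where "\<epsilon> = 1 / (2 * (1 + L + R))"
  have \<epsilon>: "\<epsilon> > 0" "\<epsilon> \<le> 1" using R0 L0 by (simp_all add: \<epsilon>_def divide_simps)
  have \<epsilon>L: "L * \<epsilon> \<le> 1 / 2" and \<epsilon>R: "R * \<epsilon> \<le> 1 / 2"
    using R0 L0 by (simp_all add: \<epsilon>_def divide_simps)
  define U where "U = {b \<in> topspace T.
      (\<forall>x\<in>B \<times> E \<times> {..<k}. case x of (es, f, j) \<Rightarrow> cmod (coef k (v b0) es f j - coef k (v b) es f j) < \<epsilon>) \<and>
      (\<forall>x\<in>E \<times> {..<k}. case x of (e, i) \<Rightarrow> cmod (v b0 e i - v b e i) < \<epsilon>)}"
  have vdet_cont: "continuous_map T euclidean (\<lambda>b. vdet k (v b) es)" if "length es = k" "set es \<subseteq> E" for es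
    unfolding vdet_def by (intro continuous_map_det cont) (use that in \<open>auto intro: nth_mem\<close>)
  have "openin T ({b \<in> topspace T. \<forall>x\<in>B \<times> E \<times> {..<k}.
        case x of (es, f, j) \<Rightarrow> cmod (coef k (v b0) es f j - coef k (v b) es f j) < \<epsilon>} \<inter>
      {b \<in> topspace T. \<forall>x\<in>E \<times> {..<k}. case x of (e, i) \<Rightarrow> cmod (v b0 e i - v b e i) < \<epsilon>})"
  proof (intro openin_Int openin_finite_Ball)
    fix x assume "x \<in> B \<times> E \<times> {..<k}"
    then obtain es f j where x: "x = (es, f, j)" "es \<in> B" "f \<in> E" "j < k" by auto
    have es: "length es = k" "set es \<subseteq> E" using x(2) by (auto simp: B_def basis_list_def)
    have es': "length (es[j := f]) = k" "set (es[j := f]) \<subseteq> E"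
      using es x(3) set_update_subset_insert[of es j f] by auto
    have "continuous_map T euclidean (\<lambda>b. coef k (v b) es f j)"
      unfolding coef_def
      by (intro continuous_map_complex_divide vdet_cont es es')
         (use bas x(2) in \<open>auto simp: basis_list_def\<close>)
    then have "continuous_map T euclidean (\<lambda>b. coef k (v b0) es f j - coef k (v b) es f j)"
      by (intro continuous_map_diff) auto
    from openin_strict_sublevel[OF this]
    show "openin T {b \<in> topspace T. case x of (es, f, j) \<Rightarrow>
        cmod (coef k (v b0) es f j - coef k (v b) es f j) < \<epsilon>}" by (simp add: x(1))
  next
    fix x assume "x \<in> E \<times> {..<k}"
    then obtain e i where x: "x = (e, i)" "e \<in> E" "i < k" by auto
    have "continuous_map T euclidean (\<lambda>b. v b0 e i - v b e i)"
      using cont[OF x(2,3)] by (intro continuous_map_diff) auto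
    from openin_strict_sublevel[OF this]
    show "openin T {b \<in> topspace T. case x of (e, i) \<Rightarrow> cmod (v b0 e i - v b e i) < \<epsilon>}"
      by (simp add: x(1))
  qed (use finB finite_E in auto)
  then have "openin T U" by (rule back_subst[of "openin T"]) (auto simp: U_def)
  moreover have "b0 \<in> U" using b0 \<epsilon> by (auto simp: U_def)
  moreover have "trivializing_arrangement k E (v b) (v b0) K A \<epsilon>" if b: "b \<in> U" for b
  proof -
    have bT: "b \<in> topspace T" using b by (simp add: U_def)
    have close: "cmod (coef k (v b0) es f j - coef k (v b) es f j) < \<epsilon>" if "es \<in> B" "f \<in> E" "j < k" for es f j
      using b that by (auto simp: U_def)
    have close': "cmod (v b0 e i - v b e i) < \<epsilon>" if "e \<in> E" "i < k" for e i
      using b that by (auto simp: U_def)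
    interpret nearby_arrangement k E "v b" "v b0" K A \<epsilon>
    proof
      show "finite E" by fact
      show "\<exists>e\<in>E. \<forall>p. cmod (pairing k (v b e) p) = cmod (p i)" if "i < k" for i
        using coordinate[OF bT that] .
      fix es f j assume es: "basis_list k E (v b) es" and f: "f \<in> E" and j: "j < k"
      then have esB: "es \<in> B" using bas[OF bT] by simp
      show "cmod (coef k (v b0) es f j - coef k (v b) es f j) \<le> \<epsilon>"
        using close[OF esB f j] by simp
      have "cmod (coef k (v b) es f j) \<le> cmod (coef k (v b0) es f j) +
          cmod (coef k (v b0) es f j - coef k (v b) es f j)"
        by (metis add.commute norm_minus_commute norm_triangle_sub)
      then have "cmod (coef k (v b) es f j) \<le> 1 + S"
        using S[OF esB f j] close[OF esB f j] \<epsilon>(2) by linarith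
      then have "k * cmod (coef k (v b) es f j) \<le> k * (1 + S)" by (intro mult_left_mono) auto
      then show "k * cmod (coef k (v b) es f j) \<le> K" by (simp add: K_def)
    next
      fix es assume "length es = k" "set es \<subseteq> E"
      then show "vdet k (v b) es \<noteq> 0 \<longleftrightarrow> vdet k (v b0) es \<noteq> 0" by (rule matroid[OF bT b0])
    next
      fix e i assume "e \<in> E" "i < k"
      then show "cmod (v b0 e i - v b e i) \<le> \<epsilon>" "cmod (v b0 e i) \<le> A"
        using close' A by (auto intro: less_imp_le)
    qed (use K1 A0 \<epsilon> in auto)
    have rR: "residual_const = R" by (simp add: residual_const_def R_def)
    show ?thesis
    proof
      have "lipschitz_const = L * \<epsilon>" by (simp add: lipschitz_const_def rR L_def algebra_simps)
      then show "lipschitz_const \<le> 1 / 2" using \<epsilon>L by simp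
      show "residual_const * \<epsilon> \<le> 1 / 2" using \<epsilon>R rR by simp
    qed
  qed
  ultimately show thesis by (rule that)
qed

section \<open>Families of complements in an affine chart\<close>

lemma tendsto_by_majorant:
  fixes f :: "'a \<Rightarrow> complex" and g :: "'a \<Rightarrow> real"
  assumes "a \<in> topspace T" "(g \<longlongrightarrow> 0) (atin T a)"
    and "\<And>x. x \<in> topspace T \<Longrightarrow> cmod (f x - l) \<le> g x"
  shows "(f \<longlongrightarrow> l) (atin T a)"
proof -
  have "eventually (\<lambda>x. norm (f x - l) \<le> g x) (atin T a)"
    unfolding eventually_atin using assms(1,3) by (intro disjI2 exI[of _ "topspace T"]) auto
  then have "((\<lambda>x. norm (f x - l)) \<longlongrightarrow> 0) (atin T a)"
    by (intro tendsto_sandwich[OF _ _ tendsto_const assms(2)]) simp_all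
  then have "((\<lambda>x. f x - l) \<longlongrightarrow> 0) (atin T a)"
    by (rule tendsto_norm_zero_cancel)
  then show ?thesis by (simp add: LIM_zero_iff)
qed

text \<open>A chart of the projectivized complement. In the theorem below, the coordinate form 0 is
  among the normals up to a factor of modulus 1, so the chart contains every point of the projective
  complement.\<close>

definition affine_complement ::
    "nat \<Rightarrow> 'e set \<Rightarrow> ('e \<Rightarrow> nat \<Rightarrow> complex) \<Rightarrow> (nat \<Rightarrow> complex) set" where
  "affine_complement k E v = {p \<in> arrangement_complement k E v. p 0 = 1}"

definition normalize_point :: "nat \<Rightarrow> (nat \<Rightarrow> complex) \<Rightarrow> nat \<Rightarrow> complex" where
  "normalize_point k p = (\<lambda>i\<in>{..<k}. p i / p 0)"

lemma normalize_point_scale: "c \<noteq> 0 \<Longrightarrow> k > 0 \<Longrightarrow> normalize_point k (\<lambda>i\<in>{..<k}. c * p i) = normalize_point k p"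
  by (auto simp: normalize_point_def fun_eq_iff)

lemma normalize_point_id: "p \<in> extensional {..<k} \<Longrightarrow> p 0 = 1 \<Longrightarrow> normalize_point k p = p"
  by (auto simp: normalize_point_def fun_eq_iff extensional_def)

lemma normalize_point_affine:
  assumes "p \<in> arrangement_complement k E v" "p 0 \<noteq> 0" "k > 0"
  shows "normalize_point k p \<in> affine_complement k E v"
proof -
  have "pairing k (v e) (normalize_point k p) = (1 / p 0) * pairing k (v e) p" for e
    unfolding pairing_scale[symmetric] by (rule pairing_cong) (simp add: normalize_point_def)
  then show ?thesis
    using assms by (auto simp: affine_complement_def arrangement_complement_def normalize_point_def)
qed

text \<open>The trivialization keeps \<open>b\<close> and sends \<open>q\<close> to its normalized
  preimage under the transport from \<open>b0\<close> to \<open>b\<close>. For a family of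
  bijections, joint continuity of the inverses is not automatic; it comes from the contraction
  estimate, which is uniform in \<open>b\<close>.\<close>

theorem arrangement_locally_trivial:
  fixes T :: "'b topology" and v :: "'b \<Rightarrow> 'e \<Rightarrow> nat \<Rightarrow> complex"
  assumes finite_E: "finite E" and k0: "k > 0"
    and cont: "\<And>e i. e \<in> E \<Longrightarrow> i < k \<Longrightarrow> continuous_map T euclidean (\<lambda>b. v b e i)"
    and coordinate: "\<And>b i. b \<in> topspace T \<Longrightarrow> i < k \<Longrightarrow>
      \<exists>e\<in>E. \<forall>p. cmod (pairing k (v b e) p) = cmod (p i)"
    and matroid: "\<And>b b' es. b \<in> topspace T \<Longrightarrow> b' \<in> topspace T \<Longrightarrow> length es = k \<Longrightarrow> set es \<subseteq> E \<Longrightarrow>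
      vdet k (v b) es \<noteq> 0 \<longleftrightarrow> vdet k (v b') es \<noteq> 0"
    and b0: "b0 \<in> topspace T"
  obtains U h where "openin T U" "b0 \<in> U"
    "homeomorphic_map
       (subtopology (prod_topology T (complex_space {..<k})) {(b, q). b \<in> U \<and> q \<in> affine_complement k E (v b)})
       (prod_topology (subtopology T U) (subtopology (complex_space {..<k}) (affine_complement k E (v b0)))) h"
    "\<And>x. fst (h x) = fst x"
proof -
  obtain U K A \<epsilon> where U: "openin T U" "b0 \<in> U"
    and triv: "\<And>b. b \<in> U \<Longrightarrow> trivializing_arrangement k E (v b) (v b0) K A \<epsilon>"
    using trivializing_neighbourhood[OF finite_E cont coordinate matroid b0] by blast
  have UT: "b \<in> topspace T" if "b \<in> U" for b using openin_subset[OF U(1)] that by blast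
  define \<tau> where "\<tau> b p = wls k E (v b) (\<lambda>e. 1 / cmod (pairing k (v b0 e) p)) (\<lambda>e. pairing k (v b0 e) p)"
    for b p
  define C where "C b = arrangement_complement k E (v b)" for b
  define \<sigma> where "\<sigma> b = inv_into (C b0) (\<tau> b)" for b
  have bij: "bij_betw (\<tau> b) (C b0) (C b)"
    and scale: "\<And>p c. p \<in> C b0 \<Longrightarrow> c \<noteq> 0 \<Longrightarrow> \<tau> b (\<lambda>i\<in>{..<k}. c * p i) = (\<lambda>i\<in>{..<k}. c * \<tau> b p i)"
    and contr: "\<And>p p'. p \<in> C b0 \<Longrightarrow> p' \<in> C b0 \<Longrightarrow>
      sum_norm k (\<lambda>i. (\<tau> b p' i - p' i) - (\<tau> b p i - p i)) \<le> 1 / 2 * sum_norm k (\<lambda>i. p' i - p i)"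
    and gram: "\<And>p. p \<in> C b0 \<Longrightarrow>
      det (mat k k (\<lambda>(i, j). gram_entry E (v b) (\<lambda>e. 1 / cmod (pairing k (v b0 e) p)) i j)) \<noteq> 0"
    if "b \<in> U" for b
  proof -
    interpret trivializing_arrangement k E "v b" "v b0" K A \<epsilon> by (rule triv[OF that])
    have \<tau>: "\<tau> b = transport 0" by (simp add: fun_eq_iff \<tau>_def transport_0)
    show "bij_betw (\<tau> b) (C b0) (C b)" unfolding \<tau> C_def by (rule transport_bij)
    show "\<tau> b (\<lambda>i\<in>{..<k}. c * p i) = (\<lambda>i\<in>{..<k}. c * \<tau> b p i)" if "p \<in> C b0" "c \<noteq> 0" for p c
      using that unfolding \<tau> C_def by (rule transport_scale)
    show "sum_norm k (\<lambda>i. (\<tau> b p' i - p' i) - (\<tau> b p i - p i)) \<le> 1 / 2 * sum_norm k (\<lambda>i. p' i - p i)"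
      if "p \<in> C b0" "p' \<in> C b0" for p p'
      using that unfolding \<tau> C_def by (intro transport_nonexpansive admissible_complement)
    show "det (mat k k (\<lambda>(i, j). gram_entry E (v b) (\<lambda>e. 1 / cmod (pairing k (v b0 e) p)) i j)) \<noteq> 0"
      if "p \<in> C b0" for p
      using that by (intro gram_det_nonzero) (auto simp: C_def arrangement_complement_def)
  qed
  have \<tau>\<sigma>: "\<tau> b (\<sigma> b q) = q" and \<sigma>C: "\<sigma> b q \<in> C b0" if "b \<in> U" "q \<in> C b" for b q
    using bij_betw_inv_into_right[OF bij[OF that(1)] that(2)]
      bij_betwE[OF bij_betw_inv_into[OF bij[OF that(1)]]] that(2)
    unfolding \<sigma>_def by blast+
  have \<sigma>\<tau>: "\<sigma> b (\<tau> b p) = p" and \<tau>C: "\<tau> b p \<in> C b" if "b \<in> U" "p \<in> C b0" for b p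
    using bij[OF that(1)] that(2) unfolding \<sigma>_def
    by (auto simp: bij_betw_def intro: inv_into_f_f)
  have scaleC: "(\<lambda>i\<in>{..<k}. c * p i) \<in> C b" if "p \<in> C b" "c \<noteq> 0" for b p c
    using that by (auto simp: C_def arrangement_complement_def pairing_scale)
  have \<sigma>scale: "\<sigma> b (\<lambda>i\<in>{..<k}. c * q i) = (\<lambda>i\<in>{..<k}. c * \<sigma> b q i)"
    if b: "b \<in> U" and q: "q \<in> C b" and c: "c \<noteq> 0" for b q c
  proof -
    have "(\<lambda>i\<in>{..<k}. c * q i) = \<tau> b (\<lambda>i\<in>{..<k}. c * \<sigma> b q i)"
      using scale[OF b \<sigma>C[OF b q] c] \<tau>\<sigma>[OF b q] by simp
    then show ?thesis using \<sigma>\<tau>[OF b scaleC[OF \<sigma>C[OF b q] c]] by simp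
  qed
  have nz0: "p 0 \<noteq> 0" if b: "b \<in> topspace T" and p: "p \<in> C b" for b p
  proof -
    obtain e where e: "e \<in> E" "cmod (pairing k (v b e) p) = cmod (p 0)" using coordinate[OF b k0] by blast
    have "pairing k (v b e) p \<noteq> 0" using p e(1) by (simp add: C_def arrangement_complement_def)
    then show ?thesis using e(2) by auto
  qed
  let ?K = "complex_space {..<k}"
  let ?X = "subtopology (prod_topology T ?K) {(b, q). b \<in> U \<and> q \<in> affine_complement k E (v b)}"
  let ?Y = "prod_topology (subtopology T U) (subtopology ?K (affine_complement k E (v b0)))"
  have aff: "p \<in> affine_complement k E (v b) \<longleftrightarrow> p \<in> C b \<and> p 0 = 1" for b p
    by (simp add: affine_complement_def C_def)
  have Cext: "p \<in> extensional {..<k}" if "p \<in> C b" for b p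
    using that by (simp add: C_def arrangement_complement_def)
  have topX: "topspace ?X = {(b, q). b \<in> U \<and> q \<in> C b \<and> q 0 = 1}"
    using UT Cext by (auto simp: topspace_complex_space aff)
  have topY: "topspace ?Y = {(b, p). b \<in> U \<and> p \<in> C b0 \<and> p 0 = 1}"
    using UT Cext by (auto simp: topspace_complex_space aff)
  have normC: "normalize_point k p \<in> affine_complement k E (v b)" if "b \<in> topspace T" "p \<in> C b" for b p
    using normalize_point_affine[of p k E "v b"] nz0[OF that] that(2) k0 by (simp add: C_def)
  have norm_eq: "normalize_point k p = (\<lambda>i\<in>{..<k}. (1 / p 0) * p i)" for p
    by (auto simp: normalize_point_def fun_eq_iff)
  define h where "h x = (fst x, normalize_point k (\<sigma> (fst x) (snd x)))" for x
  define g where "g x = (fst x, normalize_point k (\<tau> (fst x) (snd x)))" for x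
  have coordX: "continuous_map ?X euclidean (\<lambda>x. snd x i)"
    and coordY: "continuous_map ?Y euclidean (\<lambda>x. snd x i)" if "i < k" for i
  proof -
    have "continuous_map ?K euclidean (\<lambda>p. p i)"
      using continuous_map_complex_space_coordinate[of ?K "{..<k}" id i] that by (simp add: id_def)
    then have *: "continuous_map Z euclidean (\<lambda>x. snd x i)" if "continuous_map Z ?K snd" for Z :: "('b \<times> (nat \<Rightarrow> complex)) topology"
      using continuous_map_compose[OF that] by (simp add: o_def)
    show "continuous_map ?X euclidean (\<lambda>x. snd x i)"
      by (intro * continuous_map_from_subtopology continuous_map_snd)
    have "continuous_map ?Y (subtopology ?K (affine_complement k E (v b0))) snd" by (rule continuous_map_snd)
    then show "continuous_map ?Y euclidean (\<lambda>x. snd x i)"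
      by (intro *) (simp add: continuous_map_in_subtopology)
  qed
  have fstX: "continuous_map ?X T fst" by (intro continuous_map_from_subtopology continuous_map_fst)
  have fstY: "continuous_map ?Y T fst"
    using continuous_map_fst[of "subtopology T U" "subtopology ?K (affine_complement k E (v b0))"]
    by (simp add: continuous_map_in_subtopology)
  have vX: "continuous_map ?X euclidean (\<lambda>x. v (fst x) e i)"
    and vY: "continuous_map ?Y euclidean (\<lambda>x. v (fst x) e i)" if "e \<in> E" "i < k" for e i
    using continuous_map_compose[OF fstX cont[OF that]] continuous_map_compose[OF fstY cont[OF that]]
    by (simp_all add: o_def)
  have \<tau>Y: "continuous_map ?Y ?K (\<lambda>x. \<tau> (fst x) (snd x))"
    unfolding \<tau>_def
  proof (rule continuous_map_wls)
    fix e assume e: "e \<in> E"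
    show z: "continuous_map ?Y euclidean (\<lambda>x. pairing k (v b0 e) (snd x))"
      unfolding pairing_def
      by (intro continuous_map_complex_sum continuous_map_complex_mult coordY) auto
    show "continuous_map ?Y euclidean (\<lambda>x. complex_of_real (1 / cmod (pairing k (v b0 e) (snd x))))"
      using z e unfolding topY continuous_map_tendsto
      by (auto simp: C_def arrangement_complement_def intro!: tendsto_of_real tendsto_divide tendsto_const tendsto_norm)
  next
    fix x assume "x \<in> topspace ?Y"
    then show "det (mat k k (\<lambda>(i, j). gram_entry E (v (fst x)) (\<lambda>e. 1 / cmod (pairing k (v b0 e) (snd x))) i j)) \<noteq> 0"
      unfolding topY by (intro gram) auto
  qed (use vY in auto)
  have \<tau>X: "continuous_map ?X ?K (\<lambda>x. \<tau> (fst x) p')" if p': "p' \<in> C b0" for p'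
    unfolding \<tau>_def
  proof (rule continuous_map_wls)
    fix x assume "x \<in> topspace ?X"
    then show "det (mat k k (\<lambda>(i, j). gram_entry E (v (fst x)) (\<lambda>e. 1 / cmod (pairing k (v b0 e) p')) i j)) \<noteq> 0"
      unfolding topX by (intro gram p') auto
  qed (use vX in auto)
  have norm_cont: "continuous_map Z ?K (\<lambda>x. normalize_point k (f x))"
    if "\<And>i. i < k \<Longrightarrow> continuous_map Z euclidean (\<lambda>x. f x i)" "\<And>x. x \<in> topspace Z \<Longrightarrow> f x 0 \<noteq> 0"
    for Z :: "('b \<times> (nat \<Rightarrow> complex)) topology" and f
  proof (rule continuous_map_into_complex_space)
    fix i assume "i \<in> {..<k}"
    then show "continuous_map Z euclidean (\<lambda>x. normalize_point k (f x) i)"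
      using continuous_map_complex_divide[OF that(1) that(1)[OF k0] that(2), of i]
      by (simp add: normalize_point_def)
  qed (simp add: normalize_point_def)
  have \<sigma>X: "continuous_map ?X euclidean (\<lambda>x. \<sigma> (fst x) (snd x) i)" if i: "i < k" for i
    unfolding continuous_map_tendsto
  proof
    fix x0 assume x0: "x0 \<in> topspace ?X"
    obtain b' q' where x0': "x0 = (b', q')" "b' \<in> U" "q' \<in> C b'" using x0 unfolding topX by auto
    define p' where "p' = \<sigma> b' q'"
    have p': "p' \<in> C b0" "\<tau> b' p' = q'" using \<sigma>C[OF x0'(2,3)] \<tau>\<sigma>[OF x0'(2,3)] by (auto simp: p'_def)
    \<comment> \<open>\<open>p - p'\<close> is the difference of the images plus a difference of
      displacements, which is at most half as large. Absorbing that half gives this majorant, where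
      \<open>\<tau>\<close> is applied only to the fixed point \<open>p'\<close>, so that continuity
      in \<open>b\<close> suffices.\<close>
    define G where "G x = 2 * (sum_norm k (\<lambda>i. snd x i - q' i) + sum_norm k (\<lambda>i. \<tau> (fst x) p' i - \<tau> b' p' i))" for x
    have "(G \<longlongrightarrow> 2 * ((\<Sum>i<k. cmod (snd x0 i - q' i)) + (\<Sum>i<k. cmod (\<tau> (fst x0) p' i - \<tau> b' p' i)))) (atin ?X x0)"
      unfolding G_def[abs_def] sum_norm_def
    proof (intro tendsto_mult tendsto_const tendsto_add tendsto_sum tendsto_norm tendsto_diff)
      fix j assume "j \<in> {..<k}"
      then have j: "j < k" by simp
      show "((\<lambda>x. snd x j) \<longlongrightarrow> snd x0 j) (atin ?X x0)"
        using coordX[OF j] x0 by (simp only: continuous_map_tendsto)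
      show "((\<lambda>x. \<tau> (fst x) p' j) \<longlongrightarrow> \<tau> (fst x0) p' j) (atin ?X x0)"
        using continuous_map_complex_space_coordinate[OF \<tau>X[OF p'(1)], of j] j x0
        by (simp only: continuous_map_tendsto lessThan_iff)
    qed
    then have G: "(G \<longlongrightarrow> 0) (atin ?X x0)" by (simp add: x0')
    have "((\<lambda>x. \<sigma> (fst x) (snd x) i) \<longlongrightarrow> p' i) (atin ?X x0)"
    proof (rule tendsto_by_majorant[OF x0 G])
      fix x assume "x \<in> topspace ?X"
      then obtain b q where x: "x = (b, q)" "b \<in> U" "q \<in> C b" unfolding topX by auto
      define p where "p = \<sigma> b q"
      have p: "p \<in> C b0" "\<tau> b p = q" using \<sigma>C[OF x(2,3)] \<tau>\<sigma>[OF x(2,3)] by (auto simp: p_def)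
      let ?D = "sum_norm k (\<lambda>i. p i - p' i)"
      have "?D = sum_norm k (\<lambda>i. ((q i - q' i) + (\<tau> b' p' i - \<tau> b p' i)) +
          ((\<tau> b p' i - p' i) - (\<tau> b p i - p i)))"
        by (simp add: p(2) p'(2))
      also have "\<dots> \<le> sum_norm k (\<lambda>i. (q i - q' i) + (\<tau> b' p' i - \<tau> b p' i)) +
          sum_norm k (\<lambda>i. (\<tau> b p' i - p' i) - (\<tau> b p i - p i))" by (rule sum_norm_triangle)
      also have "\<dots> \<le> (sum_norm k (\<lambda>i. q i - q' i) + sum_norm k (\<lambda>i. \<tau> b' p' i - \<tau> b p' i)) +
          1 / 2 * sum_norm k (\<lambda>i. p' i - p i)"
        by (intro add_mono sum_norm_triangle contr[OF x(2)] p p')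
      finally have "?D \<le> G x"
        by (simp add: G_def x(1) sum_norm_def norm_minus_commute field_simps)
      moreover have "cmod (p i - p' i) \<le> ?D"
        unfolding sum_norm_def using i by (intro member_le_sum) auto
      ultimately show "cmod (\<sigma> (fst x) (snd x) i - p' i) \<le> G x" by (simp add: x(1) p_def)
    qed
    then show "((\<lambda>x. \<sigma> (fst x) (snd x) i) \<longlongrightarrow> \<sigma> (fst x0) (snd x0) i) (atin ?X x0)"
      by (simp add: x0'(1) p'_def)
  qed
  have "homeomorphic_maps ?X ?Y h g"
    unfolding homeomorphic_maps_def
  proof (intro conjI ballI)
    have hK: "continuous_map ?X ?K (\<lambda>x. normalize_point k (\<sigma> (fst x) (snd x)))"
    proof (rule norm_cont[OF \<sigma>X])
      show "\<sigma> (fst x) (snd x) 0 \<noteq> 0" if "x \<in> topspace ?X" for x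
        using that nz0[OF b0 \<sigma>C] unfolding topX by auto
    qed
    have hC: "normalize_point k (\<sigma> (fst x) (snd x)) \<in> affine_complement k E (v b0)" if "x \<in> topspace ?X" for x
      using that unfolding topX by (auto intro!: normC[OF b0] \<sigma>C)
    show "continuous_map ?X ?Y h"
      unfolding continuous_map_pairwise continuous_map_in_subtopology o_def h_def fst_conv snd_conv
      using fstX hK hC by (auto simp: topX)
    have gK: "continuous_map ?Y ?K (\<lambda>x. normalize_point k (\<tau> (fst x) (snd x)))"
    proof (rule norm_cont)
      show "continuous_map ?Y euclidean (\<lambda>x. \<tau> (fst x) (snd x) i)" if "i < k" for i
        using continuous_map_complex_space_coordinate[OF \<tau>Y, of i] that by simp
      show "\<tau> (fst x) (snd x) 0 \<noteq> 0" if "x \<in> topspace ?Y" for x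
        using that nz0[OF UT \<tau>C] unfolding topY by auto
    qed
    have gC: "normalize_point k (\<tau> (fst x) (snd x)) \<in> affine_complement k E (v (fst x))" if "x \<in> topspace ?Y" for x
      using that normC[OF UT \<tau>C] unfolding topY by auto
    show "continuous_map ?Y ?X g"
      unfolding continuous_map_in_subtopology continuous_map_pairwise o_def g_def fst_conv snd_conv
      using fstY gK gC by (auto simp: topY)
  next
    fix x assume "x \<in> topspace ?X"
    then obtain b q where x: "x = (b, q)" "b \<in> U" "q \<in> C b" "q 0 = 1" unfolding topX by auto
    let ?p = "\<sigma> b q"
    have p: "?p \<in> C b0" "?p 0 \<noteq> 0" using \<sigma>C[OF x(2,3)] nz0[OF b0] by auto
    \<comment> \<open>Normalization is a scaling, so by homogeneity the image is a multiple of
      \<open>q\<close>; since \<open>q 0 = 1\<close>, normalizing it returns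
      \<open>q\<close>.\<close>
    have "\<tau> b (normalize_point k ?p) = (\<lambda>i\<in>{..<k}. (1 / ?p 0) * \<tau> b ?p i)"
      unfolding norm_eq[of ?p] by (rule scale[OF x(2) p(1)]) (use p in simp)
    then have "normalize_point k (\<tau> b (normalize_point k ?p)) = q"
      using normalize_point_scale[of "1 / ?p 0" k q] p(2) k0 \<tau>\<sigma>[OF x(2,3)]
        normalize_point_id[OF Cext[OF x(3)] x(4)] by simp
    then show "g (h x) = x" by (simp add: g_def h_def x(1))
  next
    fix y assume "y \<in> topspace ?Y"
    then obtain b p where y: "y = (b, p)" "b \<in> U" "p \<in> C b0" "p 0 = 1" unfolding topY by auto
    let ?q = "\<tau> b p"
    have q: "?q \<in> C b" "?q 0 \<noteq> 0" using \<tau>C[OF y(2,3)] nz0[OF UT[OF y(2)]] by auto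
    have "\<sigma> b (normalize_point k ?q) = (\<lambda>i\<in>{..<k}. (1 / ?q 0) * \<sigma> b ?q i)"
      unfolding norm_eq[of ?q] by (rule \<sigma>scale[OF y(2) q(1)]) (use q in simp)
    then have "normalize_point k (\<sigma> b (normalize_point k ?q)) = p"
      using normalize_point_scale[of "1 / ?q 0" k p] q(2) k0 \<sigma>\<tau>[OF y(2,3)]
        normalize_point_id[OF Cext[OF y(3)] y(4)] by simp
    then show "h (g y) = y" by (simp add: g_def h_def y(1))
  qed
  then have "homeomorphic_map ?X ?Y h" by (rule homeomorphic_maps_imp_map)
  then show thesis using that[OF U] by (simp add: h_def)
qed

section \<open>Fibrations and quotient topologies\<close>

text \<open>This makes the model fibres of different charts comparable, and lets an actual fibre of
  \<open>f\<close>, on the type of the total space, take the place of a model.\<close>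

lemma trivial_over_fibre:
  assumes "trivial_over X Y f U F" and "y \<in> U" "y \<in> topspace Y"
  shows "subtopology X (f -` {y}) homeomorphic_space F"
proof -
  let ?P = "subtopology X (f -` U)" and ?Q = "prod_topology (subtopology Y U) F"
  obtain h where h: "homeomorphic_map ?P ?Q h" and fst_h: "\<And>x. x \<in> topspace X \<inter> f -` U \<Longrightarrow> fst (h x) = f x"
    using assms(1) by (auto simp: trivial_over_def)
  obtain g where hg: "homeomorphic_maps ?P ?Q h g"
    using h by (auto simp: homeomorphic_map_maps)
  have ch: "continuous_map ?P ?Q h" and cg: "continuous_map ?Q ?P g"
    and gh: "\<And>x. x \<in> topspace ?P \<Longrightarrow> g (h x) = x" and hg': "\<And>z. z \<in> topspace ?Q \<Longrightarrow> h (g z) = z"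
    using hg by (auto simp: homeomorphic_maps_def)
  have yz: "(y, z) \<in> topspace ?Q" if "z \<in> topspace F" for z using that assms by simp
  have gP: "g (y, z) \<in> topspace X" "f (g (y, z)) = y" if "z \<in> topspace F" for z
  proof -
    have "g (y, z) \<in> topspace ?P" using cg yz[OF that] by (auto simp: continuous_map_def)
    then show "g (y, z) \<in> topspace X" "f (g (y, z)) = y"
      using fst_h[of "g (y, z)"] hg'[OF yz[OF that]] by auto
  qed
  have "homeomorphic_maps (subtopology X (f -` {y})) F (snd \<circ> h) (\<lambda>z. g (y, z))"
    unfolding homeomorphic_maps_def
  proof (intro conjI ballI)
    have "subtopology X (f -` {y}) = subtopology ?P (f -` {y})"
      using assms(2) by (simp add: subtopology_subtopology) (rule arg_cong[of _ _ "subtopology X"], blast)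
    then show "continuous_map (subtopology X (f -` {y})) F (snd \<circ> h)"
      using continuous_map_from_subtopology[OF continuous_map_snd_of[OF ch]] by simp
    have "continuous_map F ?Q (\<lambda>z. (y, z))"
      unfolding continuous_map_pairwise o_def using assms by simp
    then have "continuous_map F ?P (\<lambda>z. g (y, z))"
      using continuous_map_compose[OF _ cg] by (simp add: o_def)
    then show "continuous_map F (subtopology X (f -` {y})) (\<lambda>z. g (y, z))"
      using gP by (simp add: continuous_map_in_subtopology)
    show "g (y, (snd \<circ> h) x) = x" if "x \<in> topspace (subtopology X (f -` {y}))" for x
    proof -
      have "x \<in> topspace ?P" "fst (h x) = y" using that assms fst_h[of x] by auto
      then have "(y, snd (h x)) = h x" by (metis prod.collapse)
      then show ?thesis using gh[OF \<open>x \<in> topspace ?P\<close>] by simp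
    qed
    show "(snd \<circ> h) (g (y, z)) = z" if "z \<in> topspace F" for z
      using hg'[OF yz[OF that]] by simp
  qed
  then show ?thesis by (auto simp: homeomorphic_space_def)
qed

lemma trivial_over_homeomorphic_fibre:
  assumes "trivial_over X Y f U F" and "F homeomorphic_space F'"
  shows "trivial_over X Y f U F'"
proof -
  obtain h where h: "homeomorphic_map (subtopology X (f -` U)) (prod_topology (subtopology Y U) F) h"
    and fst_h: "\<forall>x\<in>topspace X \<inter> f -` U. fst (h x) = f x"
    using assms(1) by (auto simp: trivial_over_def)
  obtain k k' where k: "homeomorphic_maps F F' k k'"
    using assms(2) by (auto simp: homeomorphic_space_def)
  have "homeomorphic_maps (prod_topology (subtopology Y U) F) (prod_topology (subtopology Y U) F')
      (\<lambda>(x, y). (id x, k y)) (\<lambda>(x, y). (id x, k' y))"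
    unfolding homeomorphic_maps_prod using k by (simp add: homeomorphic_maps_def)
  then have "homeomorphic_map (prod_topology (subtopology Y U) F) (prod_topology (subtopology Y U) F')
      (\<lambda>(x, y). (id x, k y))"
    by (rule homeomorphic_maps_imp_map)
  from homeomorphic_map_compose[OF h this]
  show ?thesis unfolding trivial_over_def
    by (intro exI conjI) (use fst_h in \<open>auto simp: split_beta\<close>)
qed

text \<open>The homeomorphism type of the fibre is locally constant, hence constant on connected sets.\<close>

lemma fibration_over_if_locally_trivial:
  fixes X :: "'a topology" and Y :: "'b topology"
  assumes triv: "\<And>y. y \<in> topspace (subtopology Y B) \<Longrightarrow>
    \<exists>U (F :: 'f topology). openin (subtopology Y B) U \<and> y \<in> U \<and> trivial_over X Y f U F"
  shows "fibration_over X Y f B"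
  unfolding fibration_over_def
proof
  let ?Z = "subtopology Y B"
  define fib where "fib y = subtopology X (f -` {y})" for y
  fix C assume C: "C \<in> connected_components_of ?Z"
  then have conn: "connectedin ?Z C" by (rule connectedin_connected_components_of)
  then have sub: "C \<subseteq> topspace ?Z" by (simp add: connectedin_def)
  have loc: "\<exists>U. openin ?Z U \<and> y \<in> U \<and> (\<forall>y'\<in>U. fib y' homeomorphic_space fib y)"
    if y: "y \<in> topspace ?Z" for y
  proof -
    obtain U and F :: "'f topology" where U: "openin ?Z U" "y \<in> U" "trivial_over X Y f U F"
      using triv[OF y] by blast
    have "fib y' homeomorphic_space F" if "y' \<in> U" for y'
      using trivial_over_fibre[OF U(3) that] openin_subset[OF U(1)] that by (auto simp: fib_def)
    note hF = this
    have "fib y' homeomorphic_space fib y" if "y' \<in> U" for y'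
      using homeomorphic_space_trans[OF hF[OF that]] hF[OF U(2)]
      by (simp add: homeomorphic_space_sym[of F])
    then show ?thesis using U by blast
  qed
  show "\<exists>F :: 'a topology. \<forall>y\<in>C. \<exists>U. openin ?Z U \<and> y \<in> U \<and> trivial_over X Y f U F"
  proof (cases "C = {}")
    case False
    then obtain y0 where y0: "y0 \<in> C" by blast
    define A where "A = {y \<in> topspace ?Z. fib y homeomorphic_space fib y0}"
    define A' where "A' = {y \<in> topspace ?Z. \<not> fib y homeomorphic_space fib y0}"
    have opA: "openin ?Z A"
    proof (subst openin_subopen, intro ballI)
      fix y assume y: "y \<in> A"
      then obtain U where U: "openin ?Z U" "y \<in> U" "\<forall>y'\<in>U. fib y' homeomorphic_space fib y"
        using loc[of y] by (auto simp: A_def)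
      have "U \<subseteq> A" using U y openin_subset[OF U(1)] homeomorphic_space_trans[of _ "fib y" "fib y0"] by (auto simp: A_def)
      then show "\<exists>U. openin ?Z U \<and> y \<in> U \<and> U \<subseteq> A" using U by blast
    qed
    have opA': "openin ?Z A'"
    proof (subst openin_subopen, intro ballI)
      fix y assume y: "y \<in> A'"
      then obtain U where U: "openin ?Z U" "y \<in> U" "\<forall>y'\<in>U. fib y' homeomorphic_space fib y"
        using loc[of y] by (auto simp: A'_def)
      have "\<not> fib y' homeomorphic_space fib y0" if "y' \<in> U" for y'
        using U(3) that y homeomorphic_space_trans[of "fib y" "fib y'" "fib y0"]
        by (auto simp: A'_def homeomorphic_space_sym[of "fib y"])
      then have "U \<subseteq> A'" using openin_subset[OF U(1)] by (auto simp: A'_def)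
      then show "\<exists>U. openin ?Z U \<and> y \<in> U \<and> U \<subseteq> A'" using U by blast
    qed
    have "A' \<inter> C = {}"
    proof (rule ccontr)
      assume ne: "A' \<inter> C \<noteq> {}"
      have "\<exists>E1 E2. openin ?Z E1 \<and> openin ?Z E2 \<and> C \<subseteq> E1 \<union> E2 \<and> E1 \<inter> E2 \<inter> C = {} \<and>
          E1 \<inter> C \<noteq> {} \<and> E2 \<inter> C \<noteq> {}"
      proof (intro exI conjI)
        show "C \<subseteq> A \<union> A'" "A \<inter> A' \<inter> C = {}" using sub by (auto simp: A_def A'_def)
        show "A \<inter> C \<noteq> {}" using y0 sub by (auto simp: A_def homeomorphic_space_refl)
      qed (fact opA opA' ne)+
      then show False using conn unfolding connectedin by simp
    qed
    then have all: "fib y homeomorphic_space fib y0" if "y \<in> C" for y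
      using that sub by (auto simp: A'_def)
    show ?thesis
    proof (intro exI[of _ "fib y0"] ballI)
      fix y assume y: "y \<in> C"
      obtain U and F :: "'f topology" where U: "openin ?Z U" "y \<in> U" "trivial_over X Y f U F"
        using triv[OF subsetD[OF sub y]] by blast
      have "fib y homeomorphic_space F"
        using trivial_over_fibre[OF U(3,2)] y sub by (auto simp: fib_def)
      then have "F homeomorphic_space fib y0"
        using all[OF y] homeomorphic_space_trans[of F "fib y" "fib y0"]
        by (simp add: homeomorphic_space_sym[of F])
      then show "\<exists>U. openin ?Z U \<and> y \<in> U \<and> trivial_over X Y f U (fib y0)"
        using U(1,2) trivial_over_homeomorphic_fibre[OF U(3)] by blast
    qed
  qed auto
qed

section \<open>Continuous maps into and out of quotients\<close>

lemma topspace_quotient_topology: "topspace (quotient_topology T r) = topspace T // r"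
proof -
  have "{x \<in> topspace T. r `` {x} \<in> topspace T // r} = topspace T" by (auto simp: quotientI)
  then have "openin (quotient_topology T r) (topspace T // r)"
    unfolding openin_quotient_topology by simp
  then show ?thesis
    unfolding topspace_def[of "quotient_topology T r"] using openin_quotient_topology by blast
qed

lemma continuous_map_quotient_class:
  "continuous_map T (quotient_topology T r) (\<lambda>x. r `` {x})"
  unfolding continuous_map_def topspace_quotient_topology openin_quotient_topology
  by (auto simp: quotientI)

lemma continuous_map_from_quotient:
  assumes "continuous_map T Z (\<lambda>x. g (r `` {x}))"
  shows "continuous_map (quotient_topology T r) Z g"
  unfolding continuous_map_def topspace_quotient_topology
proof (intro conjI allI impI)
  show "g \<in> topspace T // r \<rightarrow> topspace Z"
    using assms by (auto simp: continuous_map_def elim!: quotientE)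
  fix V assume "openin Z V"
  then have "openin T {x \<in> topspace T. g (r `` {x}) \<in> V}" using assms by (auto simp: continuous_map_def)
  moreover have "{x \<in> topspace T. r `` {x} \<in> {x \<in> topspace T // r. g x \<in> V}} = {x \<in> topspace T. g (r `` {x}) \<in> V}"
    by (auto simp: quotientI)
  ultimately show "openin (quotient_topology T r) {x \<in> topspace T // r. g x \<in> V}"
    unfolding openin_quotient_topology by auto
qed

section \<open>Normal forms of configurations\<close>

lemma vdet_cong:
  assumes "\<And>j i. j < k \<Longrightarrow> i < k \<Longrightarrow> v (es ! j) i = v' (es' ! j) i"
  shows "vdet k v es = vdet k v' es'"
  unfolding vdet_def by (intro arg_cong[of _ _ det] cong_mat) (auto simp: assms)

lemma det_mat_diag: "det (mat_diag k t) = (\<Prod>j<k. t j :: complex)"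
proof -
  have "det (mat_diag k t) = prod_list (diag_mat (mat_diag k t))"
    by (rule det_upper_triangular[of _ k]) (auto simp: upper_triangular_def mat_diag_def)
  also have "diag_mat (mat_diag k t) = map t [0..<k]"
    by (auto simp: diag_mat_def mat_diag_def)
  finally show ?thesis by (simp add: prod.distinct_set_conv_list[symmetric] atLeast0LessThan)
qed

text \<open>One rule for three uses: the columns of a configuration, these columns with one more
  appended, and the normals, on which the transpose of \<open>A\<close> acts. The factors
  \<open>t\<close> belong to labels and not to positions in the list.\<close>

lemma vdet_linear_action:
  assumes A: "A \<in> carrier_mat k k"
    and w: "\<And>j i. j < k \<Longrightarrow> i < k \<Longrightarrow> w (es ! j) i = (\<Sum>l<k. A $$ (i, l) * v (es ! j) l) * t (es ! j)"
  shows "vdet k w es = det A * vdet k v es * (\<Prod>j<k. t (es ! j))"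
proof -
  let ?V = "mat k k (\<lambda>(i, j). v (es ! j) i)"
  have "mat k k (\<lambda>(i, j). w (es ! j) i) = A * ?V * mat_diag k (\<lambda>j. t (es ! j))"
    using A by (subst mat_diag_mult_right[of _ k])
      (auto intro!: eq_matI simp: w scalar_prod_def atLeast0LessThan)
  then show ?thesis
    using A by (simp add: vdet_def det_mult[of _ k] det_mat_diag)
qed

text \<open>The sign is that of the reordering and hence the same for all families \<open>v\<close>.
  This allows passing between index sets and lists.\<close>

lemma vdet_permute:
  assumes "distinct es" "distinct es'" "set es' = set es" "length es = k"
  shows "\<exists>s\<in>{1, -1}. \<forall>v. vdet k v es' = s * vdet k v es"
proof -
  have "mset es' = mset es" using assms set_eq_iff_mset_eq_distinct by blast
  then obtain p where p: "p permutes {..<length es}" "permute_list p es = es'"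
    by (rule mset_eq_permutation)
  have p': "p permutes {0..<k}" using p(1) assms(4) by (simp add: atLeast0LessThan)
  have lt: "p j < k" if "j < k" for j using permutes_in_image[OF p', of j] that by simp
  have nth: "es' ! j = es ! p j" if "j < k" for j
    using permute_list_nth[OF p(1), of j] p(2) that assms(4) by simp
  have tr: "vdet k v es = det (mat k k (\<lambda>(j, i). v (es ! j) i))" for v and es :: "'a list"
  proof -
    have "mat k k (\<lambda>(j, i). v (es ! j) i) = transpose_mat (mat k k (\<lambda>(i, j). v (es ! j) i))"
      by (rule eq_matI) auto
    then show ?thesis using det_transpose[of "mat k k (\<lambda>(i, j). v (es ! j) i)" k] by (simp add: vdet_def)
  qed
  have "vdet k v es' = of_int (sign p) * vdet k v es" for v
  proof -
    let ?A = "mat k k (\<lambda>(j, i). v (es ! j) i)"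
    have "mat k k (\<lambda>(j, i). v (es' ! j) i) = mat k k (\<lambda>(j, i). ?A $$ (p j, i))"
      by (rule eq_matI) (auto simp: nth lt)
    then show ?thesis using det_permute_rows[OF _ p', of ?A] by (simp add: tr)
  qed
  moreover have "(of_int (sign p) :: complex) \<in> {1, -1}" by (simp add: sign_def)
  ultimately show ?thesis by blast
qed

lemma vdet_nonzero_distinct:
  assumes "vdet k v es \<noteq> 0" "length es = k"
  shows "distinct es"
proof (rule ccontr)
  assume "\<not> distinct es"
  then obtain i j where ij: "i < k" "j < k" "i \<noteq> j" "es ! i = es ! j"
    using assms(2) by (auto simp: distinct_conv_nth)
  have "vdet k v es = 0"
    unfolding vdet_def
    by (rule det_identical_columns[OF _ ij(3,1,2)]) (use ij in \<open>auto intro!: eq_vecI simp: col_def\<close>)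
  then show False using assms by simp
qed

lemma inverse_matrix_exists:
  assumes A: "(A :: complex mat) \<in> carrier_mat k k" and "det A \<noteq> 0"
  obtains B where "B \<in> carrier_mat k k" "A * B = 1\<^sub>m k" "B * A = 1\<^sub>m k"
proof -
  define B where "B = (1 / det A) \<cdot>\<^sub>m adj_mat A"
  note adj = adj_mat[OF A]
  have "B \<in> carrier_mat k k" using adj by (simp add: B_def)
  moreover have "A * B = (1 / det A) \<cdot>\<^sub>m (A * adj_mat A)"
    unfolding B_def by (rule mult_smult_distrib[OF A]) (use adj in simp)
  then have "A * B = 1\<^sub>m k" using adj assms(2) by (auto intro!: eq_matI)
  moreover have "B * A = (1 / det A) \<cdot>\<^sub>m (adj_mat A * A)"
    unfolding B_def by (rule mult_smult_assoc_mat[of _ k k]) (use adj A in auto)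
  then have "B * A = 1\<^sub>m k" using adj assms(2) by (auto intro!: eq_matI)
  ultimately show thesis by (rule that)
qed

lemma invertible_mat_det:
  assumes A: "(A :: complex mat) \<in> carrier_mat k k"
  shows "invertible_mat A \<longleftrightarrow> det A \<noteq> 0"
proof
  assume "invertible_mat A"
  then obtain B where B: "A * B = 1\<^sub>m k" "B * A = 1\<^sub>m (dim_row B)"
    using A by (auto simp: invertible_mat_def inverts_mat_def)
  have "dim_col (A * B) = k" using B(1) by simp
  moreover have "dim_col (B * A) = k" using A by simp
  ultimately have "B \<in> carrier_mat k k" using B(2) by (auto intro: carrier_matI)
  then show "det A \<noteq> 0" using det_mult[OF A, of B] B(1) by auto
next
  assume "det A \<noteq> 0"
  from inverse_matrix_exists[OF A this] obtain B
    where "B \<in> carrier_mat k k" "A * B = 1\<^sub>m k" "B * A = 1\<^sub>m k" .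
  then show "invertible_mat A" using A by (auto simp: invertible_mat_def inverts_mat_def square_mat.simps)
qed

section \<open>Configurations and the group action\<close>

definition mat_cols :: "complex mat \<Rightarrow> nat \<Rightarrow> nat \<Rightarrow> complex" where
  "mat_cols M j i = M $$ (i, j)"

lemma pluecker_eq_vdet:
  assumes M: "M \<in> carrier_mat k m" and J: "J \<in> ksubsets k m"
  shows "pluecker M J = vdet k (mat_cols M) (map (pick J) [0..<k])"
proof -
  have "{j. j < dim_col M \<and> j \<in> J} = J" "{i. i < dim_row M \<and> i \<in> (UNIV :: nat set)} = {..<k}"
    using M J by (auto simp: ksubsets_def)
  then have "submatrix M UNIV J = mat k k (\<lambda>(i, j). M $$ (i, pick J j))"
    using J by (simp add: submatrix_def pick_UNIV ksubsets_def)
  then show ?thesis unfolding pluecker_def vdet_def mat_cols_def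
    by (auto intro!: arg_cong[of _ _ det] eq_matI)
qed

lemma pick_list:
  assumes "J \<in> ksubsets k m"
  shows "distinct (map (pick J) [0..<k])" "set (map (pick J) [0..<k]) = J"
proof -
  have card: "card J = k" "finite J" using assms by (auto simp: ksubsets_def intro: finite_subset)
  have inj: "inj_on (pick J) {0..<k}"
  proof (rule inj_onI)
    fix i j assume "i \<in> {0..<k}" "j \<in> {0..<k}" "pick J i = pick J j"
    then show "i = j" using pick_mono_le[of i J j] pick_mono_le[of j J i] card
      by (cases i j rule: linorder_cases) auto
  qed
  then show "distinct (map (pick J) [0..<k])" by (simp add: distinct_map)
  have "pick J ` {0..<k} \<subseteq> J" using pick_in_set_le card by auto
  moreover have "card (pick J ` {0..<k}) = card J" using card_image[OF inj] card by simp
  ultimately show "set (map (pick J) [0..<k]) = J" using card card_subset_eq[of J] by auto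
qed

lemma vdet_pluecker:
  assumes "distinct es" "length es = k" "set es \<subseteq> {..<m}"
  shows "\<exists>s\<in>{1, -1}. \<forall>M\<in>carrier_mat k m. vdet k (mat_cols M) es = s * pluecker M (set es)"
proof -
  have J: "set es \<in> ksubsets k m" using assms by (simp add: ksubsets_def distinct_card)
  have "\<exists>s\<in>{1, -1}. \<forall>v. vdet k v es = s * vdet k v (map (pick (set es)) [0..<k])"
    by (rule vdet_permute) (use pick_list[OF J] assms in simp_all)
  then obtain s where "s \<in> {1, -1}" "\<forall>v. vdet k v es = s * vdet k v (map (pick (set es)) [0..<k])"
    by blast
  then show ?thesis using pluecker_eq_vdet[OF _ J] by auto
qed

lemma config_vdet:
  assumes "M \<in> config k m" "distinct es" "length es = k" "set es \<subseteq> {..<m}"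
  shows "vdet k (mat_cols M) es \<noteq> 0"
proof -
  have J: "set es \<in> ksubsets k m" using assms by (simp add: ksubsets_def distinct_card)
  then show ?thesis using vdet_pluecker[OF assms(2-4)] assms(1) by (auto simp: config_def)
qed

lemma configI:
  assumes "M \<in> carrier_mat k m"
    and "\<And>es. distinct es \<Longrightarrow> length es = k \<Longrightarrow> set es \<subseteq> {..<m} \<Longrightarrow> vdet k (mat_cols M) es \<noteq> 0"
  shows "M \<in> config k m"
  unfolding config_def
proof (intro CollectI conjI ballI)
  fix J assume J: "J \<in> ksubsets k m"
  then have "J \<subseteq> {..<m}" by (simp add: ksubsets_def)
  then show "pluecker M J \<noteq> 0"
    unfolding pluecker_eq_vdet[OF assms(1) J] using pick_list[OF J] by (intro assms(2)) auto
qed (rule assms(1))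

lemma action_entry:
  assumes "A \<in> carrier_mat k k" "M \<in> carrier_mat k m" "i < k" "j < m"
  shows "(A * M * mat_diag m t) $$ (i, j) = (\<Sum>l<k. A $$ (i, l) * M $$ (l, j)) * t j"
  using assms by (subst mat_diag_mult_right[of _ k]) (auto simp: scalar_prod_def atLeast0LessThan)

lemma vdet_action:
  assumes "A \<in> carrier_mat k k" "M \<in> carrier_mat k m" "length es = k" "set es \<subseteq> {..<m}"
  shows "vdet k (mat_cols (A * M * mat_diag m t)) es = det A * vdet k (mat_cols M) es * (\<Prod>j<k. t (es ! j))"
proof (rule vdet_linear_action[OF assms(1)])
  fix j i assume "j < k" "i < k"
  then have "es ! j < m" using assms(3,4) by (metis lessThan_iff nth_mem subset_iff)
  then show "mat_cols (A * M * mat_diag m t) (es ! j) i =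
      (\<Sum>l<k. A $$ (i, l) * mat_cols M (es ! j) l) * t (es ! j)"
    unfolding mat_cols_def using \<open>i < k\<close> by (rule action_entry[OF assms(1,2), rotated])
qed

lemma config_action:
  assumes "A \<in> carrier_mat k k" "det A \<noteq> 0" "\<forall>j<m. t j \<noteq> 0" "M \<in> carrier_mat k m"
  shows "A * M * mat_diag m t \<in> config k m \<longleftrightarrow> M \<in> config k m"
proof -
  have *: "vdet k (mat_cols (A * M * mat_diag m t)) es \<noteq> 0 \<longleftrightarrow> vdet k (mat_cols M) es \<noteq> 0"
    if es: "length es = k" "set es \<subseteq> {..<m}" for es
  proof -
    have "t (es ! j) \<noteq> 0" if "j < k" for j
    proof -
      have "es ! j \<in> set es" using that es by simp
      then show ?thesis using es assms(3) by auto
    qed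
    then show ?thesis using vdet_action[OF assms(1,4) es] assms(2) by simp
  qed
  have c: "A * M * mat_diag m t \<in> carrier_mat k m"
    using mult_carrier_mat[OF mult_carrier_mat[OF assms(1,4)] mat_diag_dim] .
  show ?thesis using configI[OF c] configI[OF assms(4)] * config_vdet by blast
qed

lemma config_relI:
  assumes "A \<in> carrier_mat k k" "det A \<noteq> 0" "\<forall>j<m. t j \<noteq> 0" "M \<in> config k m"
  shows "(M, A * M * mat_diag m t) \<in> config_rel k m"
  using config_action[OF assms(1-3), of M] assms invertible_mat_det[OF assms(1)]
  unfolding config_rel_def by (auto simp: config_def)

lemma config_relE:
  assumes "(M, N) \<in> config_rel k m"
  obtains A t where "A \<in> carrier_mat k k" "det A \<noteq> 0" "\<forall>j<m. t j \<noteq> 0" "N = A * M * mat_diag m t"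
    "M \<in> config k m" "N \<in> config k m"
  using assms invertible_mat_det unfolding config_rel_def by auto

lemma mat_diag_inverse:
  assumes "\<forall>j<m. t j \<noteq> (0 :: complex)"
  shows "mat_diag m t * mat_diag m (\<lambda>j. 1 / t j) = 1\<^sub>m m"
  unfolding mat_diag_diag using assms by (auto simp: mat_diag_def intro!: eq_matI)

lemma action_compose:
  fixes A B M T S :: "complex mat"
  assumes "A \<in> carrier_mat k k" "B \<in> carrier_mat k k" "M \<in> carrier_mat k m"
    "T \<in> carrier_mat m m" "S \<in> carrier_mat m m"
  shows "B * (A * M * T) * S = (B * A) * M * (T * S)"
  using assms by (simp add: assoc_mult_mat[of _ k k _ k _ m] assoc_mult_mat[of _ k k _ m _ m]
    assoc_mult_mat[of _ k m _ m _ m])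

lemma equiv_config_rel: "equiv (config k m) (config_rel k m)"
proof (rule equivI)
  show "config_rel k m \<subseteq> config k m \<times> config k m" by (auto simp: config_rel_def)
  show "refl_on (config k m) (config_rel k m)"
  proof (rule refl_onI)
    fix M assume M: "M \<in> config k m"
    then have "1\<^sub>m k * M * mat_diag m (\<lambda>_. 1) = M" by (auto simp: config_def)
    then show "(M, M) \<in> config_rel k m" using config_relI[of "1\<^sub>m k" k m "\<lambda>_. 1" M] M by simp
  qed
  show "sym (config_rel k m)"
  proof (rule symI)
    fix M N assume "(M, N) \<in> config_rel k m"
    then obtain A t where A: "A \<in> carrier_mat k k" "det A \<noteq> 0" "\<forall>j<m. t j \<noteq> 0"
      and N: "N = A * M * mat_diag m t" and c: "M \<in> config k m" "N \<in> config k m" by (rule config_relE)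
    obtain B where B: "B \<in> carrier_mat k k" "A * B = 1\<^sub>m k" "B * A = 1\<^sub>m k"
      by (rule inverse_matrix_exists[OF A(1,2)])
    have "det A * det B = 1" using det_mult[OF A(1) B(1)] B(2) by simp
    then have dB: "det B \<noteq> 0" by auto
    have M: "M \<in> carrier_mat k m" using c by (simp add: config_def)
    let ?T = "mat_diag m t" and ?S = "mat_diag m (\<lambda>j. 1 / t j)"
    have "B * N * ?S = (B * A) * M * (?T * ?S)"
      unfolding N by (rule action_compose[OF A(1) B(1) M mat_diag_dim mat_diag_dim])
    also have "\<dots> = M" using mat_diag_inverse[OF A(3)] B(3) M by simp
    finally show "(N, M) \<in> config_rel k m"
      using config_relI[OF B(1) dB, of m "\<lambda>j. 1 / t j" N] A(3) c by simp
  qed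
  show "trans (config_rel k m)"
  proof (rule transI)
    fix L M N assume "(L, M) \<in> config_rel k m" "(M, N) \<in> config_rel k m"
    then obtain A t B s where A: "A \<in> carrier_mat k k" "det A \<noteq> 0" "\<forall>j<m. t j \<noteq> 0" "M = A * L * mat_diag m t"
      and B: "B \<in> carrier_mat k k" "det B \<noteq> 0" "\<forall>j<m. s j \<noteq> 0" "N = B * M * mat_diag m s"
      and L: "L \<in> config k m"
      by (metis config_relE)
    have Lc: "L \<in> carrier_mat k m" using L by (simp add: config_def)
    have "N = (B * A) * L * (mat_diag m t * mat_diag m s)"
      unfolding B(4) A(4) by (rule action_compose[OF A(1) B(1) Lc mat_diag_dim mat_diag_dim])
    then have "N = (B * A) * L * mat_diag m (\<lambda>j. t j * s j)" by simp
    then show "(L, N) \<in> config_rel k m"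
      using config_relI[of "B * A" k m "\<lambda>j. t j * s j" L] A B L by (simp add: det_mult)
  qed
qed

section \<open>Projective frames and the normal form\<close>

definition frame_coord :: "nat \<Rightarrow> complex mat \<Rightarrow> nat \<Rightarrow> nat \<Rightarrow> complex" where
  "frame_coord k M i j = coef k (mat_cols M) [0..<k] j i"

text \<open>The coordinates of the columns in the basis formed by the first \<open>k\<close> columns, with rows and columns
  rescaled so that column \<open>k\<close> and the rest of row \<open>0\<close> become 1.\<close>

definition normal_mat :: "nat \<Rightarrow> nat \<Rightarrow> complex mat \<Rightarrow> complex mat" where
  "normal_mat k m M = mat k m (\<lambda>(i, j). if j < k then (if i = j then 1 else 0)
     else frame_coord k M i j * frame_coord k M 0 k / (frame_coord k M i k * frame_coord k M 0 j))"

definition normal_form :: "nat \<Rightarrow> nat \<Rightarrow> complex mat \<Rightarrow> bool" where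
  "normal_form k m N \<longleftrightarrow> N \<in> config k m \<and> (\<forall>i<k. \<forall>j<k. N $$ (i, j) = (if i = j then 1 else 0)) \<and>
     (\<forall>i<k. N $$ (i, k) = 1) \<and> (\<forall>j\<in>{k..<m}. N $$ (0, j) = 1)"

lemma frame_expansion:
  assumes "vdet k (mat_cols M) [0..<k] \<noteq> 0" "i < k"
  shows "M $$ (i, j) = (\<Sum>l<k. M $$ (i, l) * frame_coord k M l j)"
proof -
  have "mat_cols M j i = (\<Sum>l<k. coef k (mat_cols M) [0..<k] j l * mat_cols M ([0..<k] ! l) i)"
    by (rule vdet_expansion) (use assms in auto)
  then show ?thesis by (simp add: mat_cols_def frame_coord_def mult.commute)
qed

lemma replaced_frame:
  assumes "i < k" "j \<ge> k"
  shows "distinct ([0..<k][i := j])" "set ([0..<k][i := j]) = insert j ({..<k} - {i})"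
  using assms by (auto simp: distinct_list_update set_update_distinct atLeast0LessThan)

lemma config_frame: "M \<in> config k m \<Longrightarrow> k \<le> m \<Longrightarrow> vdet k (mat_cols M) [0..<k] \<noteq> 0"
  by (rule config_vdet) auto

lemma frame_coord_nonzero:
  assumes "M \<in> config k m" "k \<le> m" "i < k" "k \<le> j" "j < m"
  shows "frame_coord k M i j \<noteq> 0"
proof -
  have "vdet k (mat_cols M) ([0..<k][i := j]) \<noteq> 0"
    using replaced_frame[OF assms(3,4)] assms by (intro config_vdet) auto
  then show ?thesis using config_frame[OF assms(1,2)] by (simp add: frame_coord_def coef_def)
qed

text \<open>The action is written from the normal form back to \<open>M\<close>: \<open>A\<close>
  consists of the first \<open>k\<close> columns of \<open>M\<close>, rescaled so that their sum is
  column \<open>k\<close>, and \<open>t\<close> restores the scales of the columns. The explicit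
  determinant is used later to invert Pluecker coordinates of the normal form.\<close>

lemma normal_mat_action:
  assumes M: "M \<in> config k m" and k: "0 < k" and m: "k < m"
  defines "A \<equiv> mat k k (\<lambda>(i, l). M $$ (i, l) * frame_coord k M l k)"
    and "t \<equiv> \<lambda>j. if j < k then 1 / frame_coord k M j k else frame_coord k M 0 j / frame_coord k M 0 k"
  shows "M = A * normal_mat k m M * mat_diag m t"
    and "det A = vdet k (mat_cols M) [0..<k] * (\<Prod>l<k. frame_coord k M l k)"
    and "det A \<noteq> 0" and "\<forall>j<m. t j \<noteq> 0"
proof -
  let ?B = "frame_coord k M"
  have nz: "?B i j \<noteq> 0" if "i < k" "k \<le> j" "j < m" for i j
    using frame_coord_nonzero[OF M _ that] m by simp
  have fr: "vdet k (mat_cols M) [0..<k] \<noteq> 0" using config_frame[OF M] m by simp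
  have A: "A \<in> carrier_mat k k" by (simp add: A_def)
  have N: "normal_mat k m M \<in> carrier_mat k m" by (simp add: normal_mat_def)
  have Mc: "M \<in> carrier_mat k m" using M by (simp add: config_def)
  show "M = A * normal_mat k m M * mat_diag m t"
  proof (rule eq_matI)
    fix i j assume "i < dim_row (A * normal_mat k m M * mat_diag m t)" "j < dim_col (A * normal_mat k m M * mat_diag m t)"
    then have i: "i < k" and j: "j < m" by (simp_all add: A_def mat_diag_def)
    have "(\<Sum>l<k. A $$ (i, l) * normal_mat k m M $$ (l, j)) * t j = M $$ (i, j)"
    proof (cases "j < k")
      case True
      have "(\<Sum>l<k. A $$ (i, l) * normal_mat k m M $$ (l, j)) = (\<Sum>l<k. if l = j then M $$ (i, j) * ?B j k else 0)"
        using i j True by (intro sum.cong) (auto simp: A_def normal_mat_def)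
      also have "\<dots> = M $$ (i, j) * ?B j k" using True by simp
      finally show ?thesis using True nz[OF True, of k] m by (simp add: t_def)
    next
      case False
      have "(\<Sum>l<k. A $$ (i, l) * normal_mat k m M $$ (l, j)) = (\<Sum>l<k. M $$ (i, l) * ?B l j) * (?B 0 k / ?B 0 j)"
        unfolding sum_distrib_right
      proof (rule sum.cong)
        fix l assume "l \<in> {..<k}"
        then show "A $$ (i, l) * normal_mat k m M $$ (l, j) = M $$ (i, l) * ?B l j * (?B 0 k / ?B 0 j)"
          using i j False nz[of l k] m by (simp add: A_def normal_mat_def)
      qed simp
      also have "(\<Sum>l<k. M $$ (i, l) * ?B l j) = M $$ (i, j)"
        by (rule frame_expansion[OF fr i, symmetric])
      finally show ?thesis using False nz[OF k, of k] nz[OF k, of j] m j by (simp add: t_def)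
    qed
    then show "M $$ (i, j) = (A * normal_mat k m M * mat_diag m t) $$ (i, j)"
      unfolding action_entry[OF A N i j] by simp
  qed (use Mc A in \<open>simp_all add: mat_diag_def\<close>)
  have "A = mat k k (\<lambda>(i, j). mat_cols M ([0..<k] ! j) i) * mat_diag k (\<lambda>l. ?B l k)"
    by (subst mat_diag_mult_right[of _ k]) (auto simp: A_def mat_cols_def intro!: eq_matI)
  then show dA: "det A = vdet k (mat_cols M) [0..<k] * (\<Prod>l<k. ?B l k)"
    by (simp add: det_mult[of _ k] det_mat_diag vdet_def)
  have "?B l k \<noteq> 0" if "l < k" for l using nz[OF that, of k] m by simp
  then show "det A \<noteq> 0" unfolding dA using fr by simp
  show "\<forall>j<m. t j \<noteq> 0"
  proof (intro allI impI)
    fix j assume "j < m"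
    then show "t j \<noteq> 0" using nz[of j k] nz[OF k, of k] nz[OF k, of j] m by (simp add: t_def)
  qed
qed

lemma normal_mat_rel:
  assumes M: "M \<in> config k m" and k: "0 < k" and m: "k < m"
  shows "normal_mat k m M \<in> config k m" "(M, normal_mat k m M) \<in> config_rel k m"
proof -
  note * = normal_mat_action[OF assms]
  have N: "normal_mat k m M \<in> carrier_mat k m" by (simp add: normal_mat_def)
  show c: "normal_mat k m M \<in> config k m"
    using config_action[OF mat_carrier *(3,4) N] *(1) M by simp
  have "(normal_mat k m M, M) \<in> config_rel k m"
    using config_relI[OF mat_carrier *(3,4) c] *(1) by simp
  moreover have "sym (config_rel k m)" using equiv_config_rel[of k m] by (simp add: equiv_def)
  ultimately show "(M, normal_mat k m M) \<in> config_rel k m" by (rule symD[rotated])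
qed

lemma normal_mat_normal_form:
  assumes M: "M \<in> config k m" and k: "0 < k" and m: "k < m"
  shows "normal_form k m (normal_mat k m M)"
proof -
  have nz: "frame_coord k M i j \<noteq> 0" if "i < k" "k \<le> j" "j < m" for i j
    using frame_coord_nonzero[OF M _ that] m by simp
  show ?thesis unfolding normal_form_def
    using normal_mat_rel(1)[OF assms] nz k m by (auto simp: normal_mat_def)
qed

text \<open>The frame of a normal form is the standard basis.\<close>

lemma normal_form_coord:
  assumes "normal_form k m N" "i < k" "k < m"
  shows "frame_coord k N i j = N $$ (i, j)"
proof -
  have "N $$ (i, j) = (\<Sum>l<k. N $$ (i, l) * frame_coord k N l j)"
    using assms by (intro frame_expansion config_frame[of _ _ m]) (auto simp: normal_form_def)
  also have "\<dots> = (\<Sum>l<k. if l = i then frame_coord k N i j else 0)"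
    using assms by (intro sum.cong) (auto simp: normal_form_def)
  finally show ?thesis using assms by simp
qed

lemma normal_mat_id:
  assumes N: "normal_form k m N" and k: "0 < k" and m: "k < m"
  shows "normal_mat k m N = N"
proof (rule eq_matI)
  have "N \<in> carrier_mat k m" using N by (simp add: normal_form_def config_def)
  then show "dim_row (normal_mat k m N) = dim_row N" "dim_col (normal_mat k m N) = dim_col N"
    by (auto simp: normal_mat_def)
  fix i j assume "i < dim_row N" "j < dim_col N"
  with \<open>N \<in> carrier_mat k m\<close> have "i < k" "j < m" by auto
  then show "normal_mat k m N $$ (i, j) = N $$ (i, j)"
    using N k m normal_form_coord[OF N _ m] by (auto simp: normal_mat_def normal_form_def)
qed

text \<open>The action multiplies \<open>frame_coord k M i j\<close> by \<open>t j / t i\<close>,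
  and the entries of the normal form are cross-ratios of these coordinates, in which the factors
  cancel.\<close>

lemma normal_mat_eq:
  assumes "(M, N) \<in> config_rel k m" and k: "0 < k" and m: "k < m"
  shows "normal_mat k m M = normal_mat k m N"
proof -
  obtain A t where A: "A \<in> carrier_mat k k" "det A \<noteq> 0" "\<forall>j<m. t j \<noteq> 0"
    and N: "N = A * M * mat_diag m t" and c: "M \<in> config k m" "N \<in> config k m"
    using assms(1) by (rule config_relE)
  have Mc: "M \<in> carrier_mat k m" using c by (simp add: config_def)
  have B: "frame_coord k N i j = frame_coord k M i j * t j / t i" if i: "i < k" and j: "k \<le> j" "j < m" for i j
  proof -
    have "vdet k (mat_cols N) ([0..<k][i := j]) =
        det A * vdet k (mat_cols M) ([0..<k][i := j]) * (\<Prod>l<k. t ([0..<k][i := j] ! l))"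
      unfolding N using replaced_frame[OF i j(1)] i j m by (intro vdet_action[OF A(1) Mc]) auto
    moreover have "vdet k (mat_cols N) [0..<k] = det A * vdet k (mat_cols M) [0..<k] * (\<Prod>l<k. t ([0..<k] ! l))"
      unfolding N using m by (intro vdet_action[OF A(1) Mc]) auto
    moreover have "(\<Prod>l<k. t ([0..<k][i := j] ! l)) = t j * (\<Prod>l\<in>{..<k} - {i}. t l)"
      using i by (subst prod.remove[of _ i]) (auto simp: nth_list_update intro!: prod.cong)
    moreover have "(\<Prod>l<k. t ([0..<k] ! l)) = t i * (\<Prod>l\<in>{..<k} - {i}. t l)"
      using i by (subst prod.remove[of _ i]) auto
    moreover have "(\<Prod>l\<in>{..<k} - {i}. t l) \<noteq> 0" "t i \<noteq> 0" using A(3) m i by auto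
    moreover have "vdet k (mat_cols M) [0..<k] \<noteq> 0" using config_frame[OF c(1)] m by simp
    ultimately show ?thesis using A(2) by (simp add: frame_coord_def coef_def)
  qed
  show ?thesis
  proof (rule eq_matI)
    fix i j assume "i < dim_row (normal_mat k m N)" "j < dim_col (normal_mat k m N)"
    then have i: "i < k" and j: "j < m" by (simp_all add: normal_mat_def)
    have nz: "t i \<noteq> 0" "t 0 \<noteq> 0" "t k \<noteq> 0" "t j \<noteq> 0" using A(3) i j k m by auto
    show "normal_mat k m M $$ (i, j) = normal_mat k m N $$ (i, j)"
      using i j k m B[of i j] B[of 0 k] B[of i k] B[of 0 j] nz by (auto simp: normal_mat_def)
  qed (simp_all add: normal_mat_def)
qed

section \<open>Normals of the spanned hyperplanes and their matroid\<close>

definition normals :: "nat \<Rightarrow> complex mat \<Rightarrow> nat set \<Rightarrow> nat \<Rightarrow> complex" where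
  "normals k M J i = hyperplane_normal k M J $ i"

lemma pick_compl: "pick (- {i}) i' = (if i' < i then i' else Suc i')"
proof -
  let ?x = "if i' < i then i' else Suc i'"
  have "{a \<in> - {i}. a < ?x} = (if i' < i then {..<i'} else {..i'} - {i})" by auto
  then have "card {a \<in> - {i}. a < ?x} = i'" by auto
  moreover have "?x \<in> - {i}" by auto
  ultimately show ?thesis using pick_card_in_set[of ?x "- {i}"] by metis
qed

definition face_list :: "nat \<Rightarrow> nat \<Rightarrow> nat set \<Rightarrow> nat list" where
  "face_list k m J = map (pick J) [0..<k - 1] @ [m]"

lemma face_list:
  assumes "J \<in> ksubsets (k - 1) m" "0 < k"
  shows "distinct (face_list k m J)" "set (face_list k m J) = insert m J" "length (face_list k m J) = k"
  using pick_list[OF assms(1)] assms by (auto simp: face_list_def ksubsets_def)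

lemma normals_eq_det:
  assumes M: "M \<in> carrier_mat k m" and J: "J \<in> ksubsets (k - 1) m" and i: "i < k"
  shows "normals k M J i = (-1) ^ i *
    det (mat (k - 1) (k - 1) (\<lambda>(i', j'). M $$ (if i' < i then i' else Suc i', pick J j')))"
proof -
  have J': "card J = k - 1" "J \<subseteq> {..<m}" using J by (auto simp: ksubsets_def)
  have "{r. r < dim_row M \<and> r \<in> - {i}} = {..<k} - {i}" "{c. c < dim_col M \<and> c \<in> J} = J"
    using M J' by auto
  moreover have "card ({..<k} - {i}) = k - 1" using i by simp
  ultimately have "submatrix M (- {i}) J =
      mat (k - 1) (k - 1) (\<lambda>(i', j'). M $$ (if i' < i then i' else Suc i', pick J j'))"
    using J' by (simp add: submatrix_def pick_compl)
  then show ?thesis using i by (simp add: normals_def hyperplane_normal_def)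
qed

text \<open>Laplace expansion along the last column, which holds the test point \<open>p\<close>
  under the new label \<open>m\<close>. The cofactors are the entries of the normal, up to the
  common sign \<open>(-1) ^ (k - 1)\<close>.\<close>

lemma normals_pairing:
  assumes M: "M \<in> carrier_mat k m" and J: "J \<in> ksubsets (k - 1) m" and k: "0 < k"
  shows "vdet k ((mat_cols M)(m := p)) (face_list k m J) = (-1) ^ (k - 1) * pairing k (normals k M J) p"
proof -
  let ?w = "(mat_cols M)(m := p)" and ?es = "face_list k m J"
  let ?X = "mat k k (\<lambda>(i, j). ?w (?es ! j) i)"
  have J': "card J = k - 1" "J \<subseteq> {..<m}" using J by (auto simp: ksubsets_def)
  have last: "?es ! (k - 1) = m" by (simp add: face_list_def nth_append)
  have init: "?es ! j = pick J j" "pick J j < m" if "j < k - 1" for j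
    using that J' pick_in_set_le[of j J] by (auto simp: face_list_def nth_append)
  have sub: "mat_delete ?X i (k - 1) =
      mat (k - 1) (k - 1) (\<lambda>(i', j'). M $$ (if i' < i then i' else Suc i', pick J j'))" if i: "i < k" for i
    proof (rule eq_matI)
      fix i' j' assume "i' < dim_row (mat (k - 1) (k - 1) (\<lambda>(i', j'). M $$ (if i' < i then i' else Suc i', pick J j')))"
        "j' < dim_col (mat (k - 1) (k - 1) (\<lambda>(i', j'). M $$ (if i' < i then i' else Suc i', pick J j')))"
      then have ij: "i' < k - 1" "j' < k - 1" by simp_all
      then have "?es ! j' = pick J j'" "pick J j' \<noteq> m" using init[of j'] by simp_all
      then show "mat_delete ?X i (k - 1) $$ (i', j') =
          mat (k - 1) (k - 1) (\<lambda>(i', j'). M $$ (if i' < i then i' else Suc i', pick J j')) $$ (i', j')"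
        using ij i by (simp add: mat_delete_def mat_cols_def)
    qed (simp_all add: mat_delete_def)
  have "vdet k ?w ?es = (\<Sum>i<k. ?X $$ (i, k - 1) * cofactor ?X i (k - 1))"
    unfolding vdet_def using k by (intro laplace_expansion_column) auto
  also have "\<dots> = (\<Sum>i<k. (-1) ^ (k - 1) * (normals k M J i * p i))"
  proof (rule sum.cong)
    fix i assume "i \<in> {..<k}"
    then have i: "i < k" by simp
    have "?X $$ (i, k - 1) = p i" using i k last by simp
    then show "?X $$ (i, k - 1) * cofactor ?X i (k - 1) = (-1) ^ (k - 1) * (normals k M J i * p i)"
      unfolding cofactor_def sub[OF i] normals_eq_det[OF M J i] power_add by simp
  qed simp
  finally show ?thesis by (simp add: pairing_def sum_distrib_left)
qed

text \<open>Normals transform by the inverse transpose, up to a scalar. To read off entry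
  \<open>l\<close>, the unit vector \<open>p\<close> is appended to \<open>M\<close> and its image
  \<open>q\<close>, which is column \<open>l\<close> of \<open>A\<close>, to the transformed matrix;
  the appended column is not rescaled, hence \<open>t(m := 1)\<close>.\<close>

lemma normals_action:
  assumes A: "A \<in> carrier_mat k k" and M: "M \<in> carrier_mat k m" and J: "J \<in> ksubsets (k - 1) m"
    and k: "0 < k" and l: "l < k"
  shows "(\<Sum>i<k. A $$ (i, l) * normals k (A * M * mat_diag m t) J i) = det A * (\<Prod>j\<in>J. t j) * normals k M J l"
proof -
  let ?N = "A * M * mat_diag m t"
  define p :: "nat \<Rightarrow> complex" where "p i = (if i = l then 1 else 0)" for i
  define q where "q i = (\<Sum>l<k. A $$ (i, l) * p l)" for i
  have q: "q i = A $$ (i, l)" for i using l by (simp add: q_def p_def if_distrib[of "\<lambda>x. _ * x"] cong: if_cong)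
  have N: "?N \<in> carrier_mat k m"
    using mult_carrier_mat[OF mult_carrier_mat[OF A M] mat_diag_dim] .
  have "vdet k ((mat_cols ?N)(m := q)) (face_list k m J) =
      det A * vdet k ((mat_cols M)(m := p)) (face_list k m J) * (\<Prod>j<k. (t(m := 1)) (face_list k m J ! j))"
  proof (rule vdet_linear_action[OF A])
    fix j i assume j: "j < k" and i: "i < k"
    then have "face_list k m J ! j \<in> insert m J" using face_list[OF J k] by (metis nth_mem)
    then consider "face_list k m J ! j = m" | "face_list k m J ! j \<noteq> m" "face_list k m J ! j < m"
      using J by (auto simp: ksubsets_def)
    then show "((mat_cols ?N)(m := q)) (face_list k m J ! j) i =
        (\<Sum>l<k. A $$ (i, l) * ((mat_cols M)(m := p)) (face_list k m J ! j) l) * (t(m := 1)) (face_list k m J ! j)"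
    proof cases
      case 1
      then show ?thesis by (simp add: q_def)
    next
      case 2
      then show ?thesis using action_entry[OF A M i 2(2)] by (simp add: mat_cols_def)
    qed
  qed
  moreover have "(\<Prod>j<k. (t(m := 1)) (face_list k m J ! j)) = (\<Prod>j\<in>J. t j)"
  proof -
    have J': "finite J" "m \<notin> J" using J by (auto simp: ksubsets_def intro: finite_subset)
    have "(\<Prod>j<k. (t(m := 1)) (face_list k m J ! j)) = prod_list (map (t(m := 1)) (face_list k m J))"
      using face_list[OF J k] by (simp add: prod.list_conv_set_nth atLeast0LessThan)
    also have "\<dots> = (\<Prod>j\<in>insert m J. (t(m := 1)) j)"
      unfolding face_list(2)[OF J k, symmetric]
      by (rule prod.distinct_set_conv_list[symmetric, OF face_list(1)[OF J k]])
    also have "\<dots> = (\<Prod>j\<in>J. t j)" using J' by (auto intro!: prod.cong)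
    finally show ?thesis .
  qed
  ultimately have "pairing k (normals k ?N J) q = det A * pairing k (normals k M J) p * (\<Prod>j\<in>J. t j)"
    unfolding normals_pairing[OF N J k] normals_pairing[OF M J k] by simp
  moreover have "pairing k (normals k M J) p = normals k M J l"
    using l by (simp add: pairing_def p_def if_distrib[of "\<lambda>x. _ * x"] cong: if_cong)
  ultimately show ?thesis by (simp add: pairing_def q mult_ac)
qed

lemma discriminantal_bases_eq:
  "discriminantal_bases k m M =
     {set es | es. length es = k \<and> set es \<subseteq> ksubsets (k - 1) m \<and> vdet k (normals k M) es \<noteq> 0}"
proof -
  have "det (mat_of_cols k (map (hyperplane_normal k M) es)) = vdet k (normals k M) es" if "length es = k" for es
    unfolding vdet_def normals_def mat_of_cols_def using that
    by (auto intro!: arg_cong[of _ _ det] eq_matI)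
  then have iff: "distinct es \<and> length es = k \<and> set es \<subseteq> ksubsets (k - 1) m \<and>
      det (mat_of_cols k (map (hyperplane_normal k M) es)) \<noteq> 0 \<longleftrightarrow>
      length es = k \<and> set es \<subseteq> ksubsets (k - 1) m \<and> vdet k (normals k M) es \<noteq> 0" for es
    using vdet_nonzero_distinct[of k "normals k M" es] by auto
  show ?thesis unfolding discriminantal_bases_def matroid_bases_def
    by (rule Collect_cong, rule ex_cong1, rule conj_cong[OF refl], rule iff)
qed

text \<open>Bases are sets, so the inclusion provides a list for \<open>N\<close> with the same
  members in some order; reordering changes its determinant by a sign only.\<close>

lemma discriminantal_bases_vdet:
  assumes sub: "discriminantal_bases k m M \<subseteq> discriminantal_bases k m N"
    and es: "length es = k" "set es \<subseteq> ksubsets (k - 1) m" "vdet k (normals k M) es \<noteq> 0"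
  shows "vdet k (normals k N) es \<noteq> 0"
proof -
  have "set es \<in> discriminantal_bases k m M" unfolding discriminantal_bases_eq using es by blast
  then have "set es \<in> discriminantal_bases k m N" using sub by blast
  then obtain es' where es': "set es = set es'" "length es' = k" "vdet k (normals k N) es' \<noteq> 0"
    unfolding discriminantal_bases_eq by blast
  have "\<exists>s\<in>{1, -1}. \<forall>v :: nat set \<Rightarrow> nat \<Rightarrow> complex. vdet k v es' = s * vdet k v es"
    by (rule vdet_permute[OF vdet_nonzero_distinct[OF es(3,1)] vdet_nonzero_distinct[OF es'(3,2)] es'(1)[symmetric] es(1)])
  then obtain s where "s \<in> {1, -1}" "vdet k (normals k N) es' = s * vdet k (normals k N) es" by blast
  then show ?thesis using es'(3) by auto
qed

text \<open>Within a class, the families of normals differ by an invertible matrix and nonzero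
  factors, so the matroid is a function of the class.\<close>

lemma normals_vdet_rel:
  assumes rel: "(M, N) \<in> config_rel k m" and k: "0 < k"
    and es: "length es = k" "set es \<subseteq> ksubsets (k - 1) m"
  shows "vdet k (normals k M) es \<noteq> 0 \<longleftrightarrow> vdet k (normals k N) es \<noteq> 0"
proof -
  obtain A t where A: "A \<in> carrier_mat k k" "det A \<noteq> 0" "\<forall>j<m. t j \<noteq> 0"
    and N: "N = A * M * mat_diag m t" and c: "M \<in> config k m"
    using rel by (rule config_relE)
  have Mc: "M \<in> carrier_mat k m" using c by (simp add: config_def)
  define c where "c J = det A * (\<Prod>j\<in>J. t j)" for J
  have c: "c J \<noteq> 0" if "J \<in> ksubsets (k - 1) m" for J
  proof -
    have "finite J" "J \<subseteq> {..<m}" using that by (auto simp: ksubsets_def intro: finite_subset)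
    then show ?thesis using A by (auto simp: c_def)
  qed
  have esJ: "es ! j \<in> ksubsets (k - 1) m" if "j < k" for j using es that by auto
  have "vdet k (normals k M) es =
      det (transpose_mat A) * vdet k (normals k N) es * (\<Prod>j<k. 1 / c (es ! j))"
  proof (rule vdet_linear_action)
    show "transpose_mat A \<in> carrier_mat k k" using A by simp
    fix j l assume j: "j < k" and l: "l < k"
    show "normals k M (es ! j) l = (\<Sum>i<k. transpose_mat A $$ (l, i) * normals k N (es ! j) i) * (1 / c (es ! j))"
      using normals_action[OF A(1) Mc esJ[OF j] k l, of t] c[OF esJ[OF j]] A(1) l
      by (simp add: N c_def)
  qed
  moreover have "(\<Prod>j<k. 1 / c (es ! j)) \<noteq> 0" using c[OF esJ] by simp
  ultimately show ?thesis using A(2) by (simp add: det_transpose[OF A(1)])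
qed

lemma discriminantal_bases_rel:
  assumes "(M, N) \<in> config_rel k m" "0 < k"
  shows "discriminantal_bases k m M = discriminantal_bases k m N"
  unfolding discriminantal_bases_eq 
proof (rule Collect_cong)
  fix S
  have "length es = k \<and> set es \<subseteq> ksubsets (k - 1) m \<and> vdet k (normals k M) es \<noteq> 0 \<longleftrightarrow>
      length es = k \<and> set es \<subseteq> ksubsets (k - 1) m \<and> vdet k (normals k N) es \<noteq> 0" for es
    using normals_vdet_rel[OF assms, of es] by blast
  then show "(\<exists>es. S = set es \<and> length es = k \<and> set es \<subseteq> ksubsets (k - 1) m \<and> vdet k (normals k M) es \<noteq> 0) =
      (\<exists>es. S = set es \<and> length es = k \<and> set es \<subseteq> ksubsets (k - 1) m \<and> vdet k (normals k N) es \<noteq> 0)"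
    by simp
qed

text \<open>The first \<open>k\<close> points of a normal form are the unit vectors, and the
  hyperplane through all of them but the \<open>i\<close>-th has the equation
  \<open>p i = 0\<close>; the modulus hides a sign. This supplies the coordinate forms that
  \<open>arrangement\<close> demands.\<close>

lemma coordinate_hyperplane:
  assumes N: "normal_form k m N" and i: "i < k" and m: "k < m"
  shows "\<exists>J\<in>ksubsets (k - 1) m. \<forall>p. cmod (pairing k (normals k N J) p) = cmod (p i)"
proof (intro bexI allI)
  let ?J = "{..<k} - {i}"
  have k: "0 < k" using i by simp
  have Nc: "N \<in> carrier_mat k m" using N by (simp add: normal_form_def config_def)
  show J: "?J \<in> ksubsets (k - 1) m" using i m by (auto simp: ksubsets_def)
  fix p
  define w where "w = (mat_cols N)(m := p)"
  have w: "w m = p" "w l = mat_cols N l" if "l < m" for l using that by (auto simp: w_def)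
  have "mat k k (\<lambda>(i, j). w ([0..<k] ! j) i) = 1\<^sub>m k"
    using N m by (auto intro!: eq_matI simp: normal_form_def mat_cols_def w)
  then have 1: "vdet k w [0..<k] = 1" by (simp add: vdet_def)
  have "w m i = (\<Sum>l<k. coef k w [0..<k] m l * w ([0..<k] ! l) i)"
    by (rule vdet_expansion) (use 1 i in auto)
  also have "\<dots> = (\<Sum>l<k. if l = i then coef k w [0..<k] m i else 0)"
    using i m N by (intro sum.cong) (auto simp: mat_cols_def normal_form_def w)
  finally have pi: "p i = vdet k w ([0..<k][i := m])"
    using i m 1 w(1)[of 0] by (simp add: coef_def)
  have "\<exists>s\<in>{1, -1}. \<forall>v. vdet k v (face_list k m ?J) = s * vdet k v ([0..<k][i := m])"
    using replaced_frame[OF i, of m] face_list[OF J k] m by (intro vdet_permute) auto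
  then obtain s where s: "s \<in> {1, -1}" "vdet k w (face_list k m ?J) = s * vdet k w ([0..<k][i := m])"
    by blast
  have "cmod ((-1) ^ (k - 1) * pairing k (normals k N ?J) p) = cmod (s * p i)"
    using s(2) normals_pairing[OF Nc J k, of p] by (simp add: w_def[symmetric] pi)
  then show "cmod (pairing k (normals k N ?J) p) = cmod (p i)"
    using s(1) by (auto simp: norm_mult norm_power)
qed

section \<open>Adding and deleting the last point\<close>

definition append_col :: "nat \<Rightarrow> nat \<Rightarrow> complex mat \<Rightarrow> (nat \<Rightarrow> complex) \<Rightarrow> complex mat" where
  "append_col k m N p = mat k (m + 1) (\<lambda>(i, j). if j < m then N $$ (i, j) else p i)"

lemma vdet_append_col:
  assumes "set es \<subseteq> {..<m + 1}" "length es = k"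
  shows "vdet k (mat_cols (append_col k m N p)) es = vdet k ((mat_cols N)(m := p)) es"
proof (rule vdet_cong)
  fix j i assume "j < k" "i < k"
  then have "es ! j \<in> set es" using assms by simp
  then have "es ! j < m + 1" using assms by auto
  then show "mat_cols (append_col k m N p) (es ! j) i = ((mat_cols N)(m := p)) (es ! j) i"
    using \<open>i < k\<close> by (auto simp: mat_cols_def append_col_def)
qed

text \<open>Minors without the new column are minors of \<open>N\<close>; a minor with it is, up to
  sign, the pairing of \<open>p\<close> with the normal of its other \<open>k - 1\<close>
  columns.\<close>

lemma append_col_config:
  assumes N: "N \<in> config k m" and k: "0 < k"
  shows "append_col k m N p \<in> config k (m + 1) \<longleftrightarrow>
    (\<forall>J\<in>ksubsets (k - 1) m. pairing k (normals k N J) p \<noteq> 0)"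
proof
  have Nc: "N \<in> carrier_mat k m" using N by (simp add: config_def)
  {
    assume c: "append_col k m N p \<in> config k (m + 1)"
    show "\<forall>J\<in>ksubsets (k - 1) m. pairing k (normals k N J) p \<noteq> 0"
    proof
      fix J assume J: "J \<in> ksubsets (k - 1) m"
      note fl = face_list[OF J k]
      have sub: "set (face_list k m J) \<subseteq> {..<m + 1}" using fl J by (auto simp: ksubsets_def)
      have "vdet k (mat_cols (append_col k m N p)) (face_list k m J) \<noteq> 0"
        by (rule config_vdet[OF c fl(1,3) sub])
      then show "pairing k (normals k N J) p \<noteq> 0"
        using vdet_append_col[OF sub fl(3)] normals_pairing[OF Nc J k] by simp
    qed
  }
  assume *: "\<forall>J\<in>ksubsets (k - 1) m. pairing k (normals k N J) p \<noteq> 0"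
  show "append_col k m N p \<in> config k (m + 1)"
  proof (rule configI)
    show "append_col k m N p \<in> carrier_mat k (m + 1)" by (simp add: append_col_def)
    fix es assume es: "distinct es" "length es = k" "set es \<subseteq> {..<m + 1}"
    show "vdet k (mat_cols (append_col k m N p)) es \<noteq> 0"
    proof (cases "m \<in> set es")
      case False
      then have sub: "set es \<subseteq> {..<m}" using es(3) by (auto simp: less_Suc_eq)
      have "vdet k ((mat_cols N)(m := p)) es = vdet k (mat_cols N) es"
      proof (rule vdet_cong)
        fix j i assume "j < k"
        then have "es ! j \<noteq> m" using False es(2) nth_mem[of j es] by auto
        then show "((mat_cols N)(m := p)) (es ! j) i = mat_cols N (es ! j) i" by simp
      qed
      then show ?thesis using vdet_append_col[OF es(3,2)] config_vdet[OF N es(1,2) sub] by simp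
    next
      case True
      define J where "J = set es - {m}"
      have J: "J \<in> ksubsets (k - 1) m"
        using es True distinct_card[OF es(1)] by (auto simp: J_def ksubsets_def less_Suc_eq)
      have "\<exists>s\<in>{1, -1}. \<forall>v. vdet k v es = s * vdet k v (face_list k m J)"
        using face_list[OF J k] es True by (intro vdet_permute) (auto simp: J_def)
      then obtain s where s: "s \<in> {1, -1}"
        "vdet k ((mat_cols N)(m := p)) es = s * vdet k ((mat_cols N)(m := p)) (face_list k m J)" by blast
      have "vdet k ((mat_cols N)(m := p)) es \<noteq> 0"
        unfolding s(2) normals_pairing[OF Nc J k] using s(1) * J by auto
      then show ?thesis using vdet_append_col[OF es(3,2)] by simp
    qed
  qed
qed

lemma append_delete_col:
  assumes "M \<in> carrier_mat k (m + 1)"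
  shows "append_col k m (delete_last_column k m M) (\<lambda>i. M $$ (i, m)) = M"
  using assms by (auto simp: append_col_def delete_last_column_def less_Suc_eq intro!: eq_matI)

lemma delete_append_col:
  assumes "N \<in> carrier_mat k m"
  shows "delete_last_column k m (append_col k m N p) = N"
  using assms by (auto simp: append_col_def delete_last_column_def intro!: eq_matI)

lemma pluecker_delete:
  assumes "M \<in> carrier_mat k (m + 1)" "J \<in> ksubsets k m"
  shows "pluecker (delete_last_column k m M) J = pluecker M J"
proof -
  have J: "J \<in> ksubsets k (m + 1)" using assms(2) by (auto simp: ksubsets_def)
  have D: "delete_last_column k m M \<in> carrier_mat k m" by (simp add: delete_last_column_def)
  have "pick J j < m" if "j < k" for j using assms(2) pick_in_set_le[of j J] that by (auto simp: ksubsets_def)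
  then show ?thesis unfolding pluecker_eq_vdet[OF assms(1) J] pluecker_eq_vdet[OF D assms(2)]
    by (intro vdet_cong) (simp add: mat_cols_def delete_last_column_def)
qed

lemma delete_config:
  assumes "M \<in> config k (m + 1)"
  shows "delete_last_column k m M \<in> config k m"
proof -
  have "ksubsets k m \<subseteq> ksubsets k (m + 1)" by (auto simp: ksubsets_def)
  then show ?thesis using assms pluecker_delete
    unfolding config_def by (auto simp: delete_last_column_def)
qed

lemma delete_rel:
  assumes "(M, N) \<in> config_rel k (m + 1)"
  shows "(delete_last_column k m M, delete_last_column k m N) \<in> config_rel k m"
proof -
  obtain A t where A: "A \<in> carrier_mat k k" "det A \<noteq> 0" "\<forall>j<m + 1. t j \<noteq> 0"
    and N: "N = A * M * mat_diag (m + 1) t" and c: "M \<in> config k (m + 1)"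
    using assms by (rule config_relE)
  have M: "M \<in> carrier_mat k (m + 1)" using c by (simp add: config_def)
  have D: "delete_last_column k m M \<in> carrier_mat k m" by (simp add: delete_last_column_def)
  have "delete_last_column k m N = A * delete_last_column k m M * mat_diag m t"
  proof (rule eq_matI)
    fix i j assume "i < dim_row (A * delete_last_column k m M * mat_diag m t)"
      "j < dim_col (A * delete_last_column k m M * mat_diag m t)"
    then have i: "i < k" and j: "j < m" using A by (simp_all add: mat_diag_def)
    then have j': "j < m + 1" by simp
    show "delete_last_column k m N $$ (i, j) = (A * delete_last_column k m M * mat_diag m t) $$ (i, j)"
      unfolding action_entry[OF A(1) D i j]
      using i j action_entry[OF A(1) M i j', of t] by (simp add: N delete_last_column_def)
  qed (use A in \<open>simp_all add: delete_last_column_def mat_diag_def\<close>)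
  then show ?thesis using config_relI[OF A(1,2) _ delete_config[OF c], of t] A(3) by simp
qed

text \<open>The frame occupies columns 0 to \<open>k\<close>, and \<open>k < m\<close> makes the
  deletion spare it.\<close>

lemma delete_normal_form:
  assumes "normal_form k (m + 1) N" "0 < k" "k < m"
  shows "normal_form k m (delete_last_column k m N)"
  using assms delete_config[of N k m] by (auto simp: normal_form_def delete_last_column_def)

lemma append_col_normal_form:
  assumes N: "normal_form k m N" and k: "0 < k" "k < m" and p: "p 0 = 1"
    and J: "\<forall>J\<in>ksubsets (k - 1) m. pairing k (normals k N J) p \<noteq> 0"
  shows "normal_form k (m + 1) (append_col k m N p)"
  using assms append_col_config[of N k m p] by (auto simp: normal_form_def append_col_def)

section \<open>Affine and very affine varieties\<close>

lemma poly_funs_sum: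
  "finite A \<Longrightarrow> (\<And>a. a \<in> A \<Longrightarrow> p a \<in> poly_funs I) \<Longrightarrow> (\<lambda>z. \<Sum>a\<in>A. p a z) \<in> poly_funs I"
  by (induction A rule: finite_induct) (auto intro: poly_funs.intros)

lemma poly_funs_prod:
  "finite A \<Longrightarrow> (\<And>a. a \<in> A \<Longrightarrow> p a \<in> poly_funs I) \<Longrightarrow> (\<lambda>z. \<Prod>a\<in>A. p a z) \<in> poly_funs I"
  by (induction A rule: finite_induct) (auto intro: poly_funs.intros)

lemma poly_funs_power: "p \<in> poly_funs I \<Longrightarrow> (\<lambda>z. p z ^ n) \<in> poly_funs I"
  by (induction n) (auto intro: poly_funs.intros)

lemma poly_funs_diff:
  assumes "p \<in> poly_funs I" "q \<in> poly_funs I"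
  shows "(\<lambda>z. p z - q z) \<in> poly_funs I"
proof -
  have "(\<lambda>z. p z + (\<lambda>_. -1) z * q z) \<in> poly_funs I" by (intro poly_funs.intros assms)
  then show ?thesis by simp
qed

lemma poly_funs_det:
  assumes "\<And>i j. i < k \<Longrightarrow> j < k \<Longrightarrow> a i j \<in> poly_funs I"
  shows "(\<lambda>z. det (mat k k (\<lambda>(i, j). a i j z))) \<in> poly_funs I"
proof -
  have lt: "p i < k" if "p permutes {0..<k}" "i < k" for p i
    using permutes_in_image[OF that(1), of i] that(2) by simp
  have det: "det (mat k k (\<lambda>(i, j). a i j z)) =
      (\<Sum>p\<in>{p. p permutes {0..<k}}. signof p * (\<Prod>i = 0..<k. a i (p i) z))" for z
    by (subst det_def'[of _ k]) (simp_all add: lt)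
  show ?thesis unfolding det
    by (intro poly_funs_sum finite_permutations poly_funs.mult poly_funs.const poly_funs_prod assms)
       (simp_all add: lt)
qed

lemma poly_funs_compose:
  assumes "p \<in> poly_funs I" and "\<And>i. i \<in> I \<Longrightarrow> q i \<in> poly_funs J"
  shows "(\<lambda>z. p (\<lambda>i. q i z)) \<in> poly_funs J"
  using assms(1) by induction (auto intro: poly_funs.intros assms(2))

lemma poly_funs_cong:
  assumes "p \<in> poly_funs I" and "\<And>i. i \<in> I \<Longrightarrow> z i = z' i"
  shows "p z = p z'"
  using assms(1) by induction (auto simp: assms(2))

lemma poly_funs_mono:
  assumes "p \<in> poly_funs I" "I \<subseteq> J"
  shows "p \<in> poly_funs J"
  using assms(1) by induction (use assms(2) in \<open>auto intro: poly_funs.intros\<close>)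

text \<open>Both kinds of regular functions have this form: \<open>Q\<close> is the product of the
  coordinates for subvarieties of a torus, and the product of all maximal minors for
  configurations.\<close>

definition frac_funs ::
    "'x set \<Rightarrow> 'i set \<Rightarrow> ('x \<Rightarrow> 'i \<Rightarrow> complex) \<Rightarrow> ('x \<Rightarrow> complex) \<Rightarrow> ('x \<Rightarrow> complex) set" where
  "frac_funs X I \<phi> Q = {u. \<exists>p\<in>poly_funs I. \<exists>N::nat. \<forall>x\<in>X. u x = p (\<phi> x) / Q x ^ N}"

text \<open>As the denominator is itself a polynomial \<open>P\<close> in the coordinates, fractions
  can be brought to a common denominator, and their sums are again fractions.\<close>

locale localization =
  fixes X :: "'x set" and I :: "'i set" and \<phi> :: "'x \<Rightarrow> 'i \<Rightarrow> complex" and Q P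
  assumes P: "P \<in> poly_funs I" and Q: "x \<in> X \<Longrightarrow> Q x = P (\<phi> x)" and nonzero: "x \<in> X \<Longrightarrow> Q x \<noteq> 0"
begin

abbreviation "R \<equiv> frac_funs X I \<phi> Q"

lemma frac_poly_coord: "p \<in> poly_funs I \<Longrightarrow> (\<lambda>x. p (\<phi> x)) \<in> R"
  unfolding frac_funs_def by (auto intro!: bexI[of _ p] exI[of _ 0])

lemma frac_const: "(\<lambda>_. c) \<in> R"
  using frac_poly_coord[OF poly_funs.const] .

lemma frac_coord: "i \<in> I \<Longrightarrow> (\<lambda>x. \<phi> x i) \<in> R"
  using frac_poly_coord[OF poly_funs.coord] .

lemma frac_cong: "u \<in> R \<Longrightarrow> (\<And>x. x \<in> X \<Longrightarrow> u x = w x) \<Longrightarrow> w \<in> R"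
  unfolding frac_funs_def by simp

lemma frac_inverse: "(\<lambda>x. 1 / Q x) \<in> R"
  unfolding frac_funs_def by (auto intro!: bexI[of _ "\<lambda>_. 1"] exI[of _ 1] poly_funs.const)

lemma frac_mult:
  assumes "u \<in> R" "w \<in> R"
  shows "(\<lambda>x. u x * w x) \<in> R"
proof -
  obtain p N q N' where p: "p \<in> poly_funs I" "\<And>x. x \<in> X \<Longrightarrow> u x = p (\<phi> x) / Q x ^ N"
    and q: "q \<in> poly_funs I" "\<And>x. x \<in> X \<Longrightarrow> w x = q (\<phi> x) / Q x ^ N'"
    using assms unfolding frac_funs_def by blast
  have "\<forall>x\<in>X. u x * w x = (\<lambda>z. p z * q z) (\<phi> x) / Q x ^ (N + N')"
    using p q by (simp add: power_add)
  then show ?thesis unfolding frac_funs_def using poly_funs.mult[OF p(1) q(1)]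
    by (intro CollectI bexI[of _ "\<lambda>z. p z * q z"] exI[of _ "N + N'"])
qed

lemma frac_add:
  assumes "u \<in> R" "w \<in> R"
  shows "(\<lambda>x. u x + w x) \<in> R"
proof -
  obtain p N q N' where p: "p \<in> poly_funs I" "\<And>x. x \<in> X \<Longrightarrow> u x = p (\<phi> x) / Q x ^ N"
    and q: "q \<in> poly_funs I" "\<And>x. x \<in> X \<Longrightarrow> w x = q (\<phi> x) / Q x ^ N'"
    using assms unfolding frac_funs_def by blast
  have "\<forall>x\<in>X. u x + w x = (\<lambda>z. p z * P z ^ N' + q z * P z ^ N) (\<phi> x) / Q x ^ (N + N')"
  proof
    fix x assume x: "x \<in> X"
    show "u x + w x = (\<lambda>z. p z * P z ^ N' + q z * P z ^ N) (\<phi> x) / Q x ^ (N + N')"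
      using nonzero[OF x] p(2)[OF x] q(2)[OF x] by (simp add: Q[OF x, symmetric] add_frac_eq power_add)
  qed
  moreover have "(\<lambda>z. p z * P z ^ N' + q z * P z ^ N) \<in> poly_funs I"
    by (intro poly_funs.intros poly_funs_power p q P)
  ultimately show ?thesis unfolding frac_funs_def
    by (intro CollectI bexI[of _ "\<lambda>z. p z * P z ^ N' + q z * P z ^ N"] exI[of _ "N + N'"])
qed

lemma frac_prod:
  "finite A \<Longrightarrow> (\<And>a. a \<in> A \<Longrightarrow> u a \<in> R) \<Longrightarrow> (\<lambda>x. \<Prod>a\<in>A. u a x) \<in> R"
  by (induction A rule: finite_induct) (auto intro: frac_const frac_mult)

lemma frac_power: "u \<in> R \<Longrightarrow> (\<lambda>x. u x ^ n) \<in> R"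
  by (induction n) (auto intro: frac_const frac_mult)

lemma frac_poly:
  assumes "p \<in> poly_funs J" and "\<And>j. j \<in> J \<Longrightarrow> (\<lambda>x. \<psi> x j) \<in> R"
  shows "(\<lambda>x. p (\<psi> x)) \<in> R"
  using assms(1) by induction (auto intro: assms(2) frac_const frac_add frac_mult)

lemma frac_det:
  assumes "\<And>i j. i < k \<Longrightarrow> j < k \<Longrightarrow> (\<lambda>x. a x i j) \<in> R"
  shows "(\<lambda>x. det (mat k k (\<lambda>(i, j). a x i j))) \<in> R"
proof -
  have "(\<lambda>z. det (mat k k (\<lambda>(i, j). z (i, j)))) \<in> poly_funs ({..<k} \<times> {..<k})"
    by (intro poly_funs_det poly_funs.coord) auto
  from frac_poly[OF this, of "\<lambda>x (i, j). a x i j"] show ?thesis using assms by auto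
qed

end

lemma continuous_map_projection:
  assumes "i \<in> I"
  shows "continuous_map (subtopology (complex_space I) S) euclidean (\<lambda>z. z i)"
  using continuous_map_complex_space_coordinate[of "complex_space I" I id i] assms
  by (intro continuous_map_from_subtopology) (simp add: id_def)

text \<open>Reindexing along a numbering of \<open>I\<close>; it permits torus coordinates labelled
  by matrix positions and by index sets of minors.\<close>

lemma very_affine_varietyI:
  fixes V :: "'v variety" and I :: "'i set"
  assumes fin: "finite I" and G: "G \<subseteq> poly_funs I"
    and hom: "homeomorphic_map (analytic V) (subtopology (complex_space I) {z \<in> torus I. \<forall>p\<in>G. p z = 0}) \<phi>"
    and reg: "regular V = frac_funs (points V) I \<phi> (\<lambda>x. \<Prod>i\<in>I. \<phi> x i)"
  shows "very_affine_variety V"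
proof -
  define n where "n = card I"
  obtain e where e: "bij_betw e {..<n} I"
    using ex_bij_betw_nat_finite[OF fin] by (auto simp: n_def atLeast0LessThan)
  define e' where "e' = inv_into {..<n} e"
  have e': "e' i < n" "e (e' i) = i" if "i \<in> I" for i
    using bij_betw_inv_into_right[OF e that] bij_betwE[OF bij_betw_inv_into[OF e]] that by (auto simp: e'_def)
  have eI: "e a \<in> I" "e' (e a) = a" if "a < n" for a
    using bij_betw_inv_into_left[OF e, of a] bij_betwE[OF e] that by (auto simp: e'_def)
  define \<rho> where "\<rho> z = (\<lambda>a\<in>{..<n}. z (e a))" for z :: "'i \<Rightarrow> complex"
  define \<rho>' where "\<rho>' w = (\<lambda>i\<in>I. w (e' i))" for w :: "nat \<Rightarrow> complex"
  define G' where "G' = (\<lambda>p w. p (\<lambda>i. w (e' i))) ` G"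
  let ?A = "{z \<in> torus I. \<forall>p\<in>G. p z = 0}" and ?B = "{w \<in> torus {..<n}. \<forall>p\<in>G'. p w = 0}"
  have G': "G' \<subseteq> poly_funs {..<n}"
  proof -
    have "(\<lambda>w. p (\<lambda>i. w (e' i))) \<in> poly_funs {..<n}" if "p \<in> G" for p
      using that G e' by (intro poly_funs_compose[of p I "\<lambda>i w. w (e' i)"] poly_funs.coord) auto
    then show ?thesis by (auto simp: G'_def)
  qed
  have \<rho>\<rho>': "\<rho> (\<rho>' w) = w" if "w \<in> extensional {..<n}" for w
    using that eI by (auto simp: \<rho>_def \<rho>'_def fun_eq_iff extensional_def)
  have \<rho>'\<rho>: "\<rho>' (\<rho> z) = z" if "z \<in> extensional I" for z
    using that e' by (auto simp: \<rho>_def \<rho>'_def fun_eq_iff extensional_def)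
  have p\<rho>': "p (\<lambda>i. w (e' i)) = p (\<rho>' w)" if "p \<in> poly_funs I" for p w
    by (rule poly_funs_cong[OF that]) (simp add: \<rho>'_def)
  have \<rho>AB: "\<rho> z \<in> ?B" if "z \<in> ?A" for z
  proof -
    have z: "z \<in> extensional I" "\<And>i. i \<in> I \<Longrightarrow> z i \<noteq> 0" "\<And>p. p \<in> G \<Longrightarrow> p z = 0"
      using that by (auto simp: torus_def topspace_complex_space)
    have "p (\<lambda>i. \<rho> z (e' i)) = 0" if "p \<in> G" for p
      using p\<rho>'[of p "\<rho> z"] \<rho>'\<rho>[OF z(1)] z(3)[OF that] that G by auto
    then show ?thesis using z eI by (auto simp: torus_def topspace_complex_space \<rho>_def G'_def)
  qed
  have \<rho>'BA: "\<rho>' w \<in> ?A" if "w \<in> ?B" for w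
  proof -
    have w: "\<And>i. i < n \<Longrightarrow> w i \<noteq> 0" "\<And>p. p \<in> G \<Longrightarrow> p (\<lambda>i. w (e' i)) = 0"
      using that by (auto simp: torus_def G'_def)
    have "p (\<rho>' w) = 0" if "p \<in> G" for p
      using p\<rho>'[of p w] w(2)[OF that] that G by auto
    then show ?thesis using w(1) e' by (auto simp: torus_def topspace_complex_space \<rho>'_def)
  qed
  have "homeomorphic_maps (subtopology (complex_space I) ?A) (subtopology (complex_space {..<n}) ?B) \<rho> \<rho>'"
    unfolding homeomorphic_maps_def
  proof (intro conjI ballI)
    have "continuous_map (subtopology (complex_space I) ?A) (complex_space {..<n}) \<rho>"
      by (rule continuous_map_into_complex_space) (use eI in \<open>auto simp: \<rho>_def intro!: continuous_map_projection\<close>)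
    then show "continuous_map (subtopology (complex_space I) ?A) (subtopology (complex_space {..<n}) ?B) \<rho>"
      using \<rho>AB by (simp add: continuous_map_in_subtopology)
    have "continuous_map (subtopology (complex_space {..<n}) ?B) (complex_space I) \<rho>'"
      by (rule continuous_map_into_complex_space) (use e' in \<open>auto simp: \<rho>'_def intro!: continuous_map_projection\<close>)
    then show "continuous_map (subtopology (complex_space {..<n}) ?B) (subtopology (complex_space I) ?A) \<rho>'"
      using \<rho>'BA by (simp add: continuous_map_in_subtopology)
    show "\<rho>' (\<rho> z) = z" if "z \<in> topspace (subtopology (complex_space I) ?A)" for z
      using that by (intro \<rho>'\<rho>) (simp add: topspace_complex_space)
    show "\<rho> (\<rho>' w) = w" if "w \<in> topspace (subtopology (complex_space {..<n}) ?B)" for w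
      using that by (intro \<rho>\<rho>') (simp add: topspace_complex_space)
  qed
  from homeomorphic_map_compose[OF hom homeomorphic_maps_imp_map[OF this]]
  have hom': "homeomorphic_map (analytic V) (subtopology (complex_space {..<n}) ?B) (\<rho> \<circ> \<phi>)" .
  have prod: "(\<Prod>a<n. (\<rho> \<circ> \<phi>) x a) = (\<Prod>i\<in>I. \<phi> x i)" for x
    using prod.reindex_bij_betw[OF e, of "\<phi> x"] by (simp add: \<rho>_def)
  have \<phi>ext: "\<phi> x \<in> extensional I" if "x \<in> points V" for x
  proof -
    have "\<phi> x \<in> topspace (subtopology (complex_space I) ?A)"
      using homeomorphic_imp_surjective_map[OF hom] that by blast
    then show ?thesis by (simp add: topspace_complex_space)
  qed
  have "regular V = {g. \<exists>p\<in>poly_funs {..<n}. \<exists>N::nat. \<forall>x\<in>points V.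
      g x = p ((\<rho> \<circ> \<phi>) x) / (\<Prod>i<n. (\<rho> \<circ> \<phi>) x i) ^ N}"
    unfolding reg frac_funs_def prod
  proof (intro Collect_cong iffI)
    fix g assume "\<exists>p\<in>poly_funs I. \<exists>N. \<forall>x\<in>points V. g x = p (\<phi> x) / (\<Prod>i\<in>I. \<phi> x i) ^ N"
    then obtain p N where p: "p \<in> poly_funs I" "\<forall>x\<in>points V. g x = p (\<phi> x) / (\<Prod>i\<in>I. \<phi> x i) ^ N" by blast
    have "(\<lambda>w. p (\<lambda>i. w (e' i))) \<in> poly_funs {..<n}"
      using p(1) e' by (intro poly_funs_compose[of p I "\<lambda>i w. w (e' i)"] poly_funs.coord) auto
    moreover have "(\<lambda>w. p (\<lambda>i. w (e' i))) ((\<rho> \<circ> \<phi>) x) = p (\<phi> x)" if "x \<in> points V" for x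
      using p\<rho>'[OF p(1), of "(\<rho> \<circ> \<phi>) x"] \<rho>'\<rho>[OF \<phi>ext[OF that]] by simp
    ultimately show "\<exists>p\<in>poly_funs {..<n}. \<exists>N. \<forall>x\<in>points V. g x = p ((\<rho> \<circ> \<phi>) x) / (\<Prod>i\<in>I. \<phi> x i) ^ N"
      using p(2) by (intro bexI[of _ "\<lambda>w. p (\<lambda>i. w (e' i))"] exI[of _ N]) auto
  next
    fix g assume "\<exists>p\<in>poly_funs {..<n}. \<exists>N. \<forall>x\<in>points V. g x = p ((\<rho> \<circ> \<phi>) x) / (\<Prod>i\<in>I. \<phi> x i) ^ N"
    then obtain p N where p: "p \<in> poly_funs {..<n}"
      "\<forall>x\<in>points V. g x = p ((\<rho> \<circ> \<phi>) x) / (\<Prod>i\<in>I. \<phi> x i) ^ N" by blast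
    have "(\<lambda>z. p (\<lambda>a. z (e a))) \<in> poly_funs I"
      using p(1) eI by (intro poly_funs_compose[of p "{..<n}" "\<lambda>a z. z (e a)"] poly_funs.coord) auto
    moreover have "(\<lambda>z. p (\<lambda>a. z (e a))) (\<phi> x) = p ((\<rho> \<circ> \<phi>) x)" for x
      by (rule poly_funs_cong[OF p(1)]) (simp add: \<rho>_def)
    ultimately show "\<exists>p\<in>poly_funs I. \<exists>N. \<forall>x\<in>points V. g x = p (\<phi> x) / (\<Prod>i\<in>I. \<phi> x i) ^ N"
      using p(2) by (intro bexI[of _ "\<lambda>z. p (\<lambda>a. z (e a))"] exI[of _ N]) auto
  qed
  then show ?thesis unfolding very_affine_variety_def using G' hom' by blast
qed

text \<open>The inverse of the product of the coordinates embeds the torus as a closed subset of affine space.\<close>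

lemma very_affine_imp_affine:
  assumes "very_affine_variety V"
  shows "affine_variety V"
proof -
  obtain n :: nat and G \<phi> where G: "G \<subseteq> poly_funs {..<n}"
    and hom: "homeomorphic_map (analytic V) (subtopology (complex_space {..<n}) {z \<in> torus {..<n}. \<forall>p\<in>G. p z = 0}) \<phi>"
    and reg: "regular V = frac_funs (points V) {..<n} \<phi> (\<lambda>x. \<Prod>i<n. \<phi> x i)"
    using assms unfolding very_affine_variety_def frac_funs_def by blast
  define ext where "ext z = (\<lambda>i\<in>{..<n + 1}. if i < n then z i else 1 / (\<Prod>i<n. z i))" for z :: "nat \<Rightarrow> complex"
  \<comment> \<open>Coordinate \<open>n\<close> is the inverse of the product of the others; this
    one equation forces all of them to be nonzero.\<close>
  define q where "q = (\<lambda>z :: nat \<Rightarrow> complex. z n * (\<Prod>i<n. z i) - 1)"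
  have q: "q \<in> poly_funs {..<n + 1}"
    unfolding q_def by (intro poly_funs_diff poly_funs.intros poly_funs_prod) auto
  have G1: "G \<subseteq> poly_funs {..<n + 1}"
    using G poly_funs_mono[of _ "{..<n}" "{..<n + 1}"] by auto
  let ?A = "{z \<in> torus {..<n}. \<forall>p\<in>G. p z = 0}" and ?B = "{z. \<forall>p\<in>insert q G. p z = 0}"
  have q0: "q z = 0 \<longleftrightarrow> (\<Prod>i<n. z i) \<noteq> 0 \<and> z n = 1 / (\<Prod>i<n. z i)" for z
    by (cases "(\<Prod>i<n. z i) = 0") (simp_all only: q_def, simp_all add: field_simps)
  have pext: "p (ext z) = p z" if "p \<in> poly_funs {..<n}" for p z
    by (rule poly_funs_cong[OF that]) (simp add: ext_def)
  have pres: "p (restrict z {..<n}) = p z" if "p \<in> poly_funs {..<n}" for p z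
    by (rule poly_funs_cong[OF that]) simp
  have A: "z \<in> ?A \<longleftrightarrow> z \<in> extensional {..<n} \<and> (\<forall>i<n. z i \<noteq> 0) \<and> (\<forall>p\<in>G. p z = 0)" for z
    by (auto simp: torus_def topspace_complex_space)
  have extB: "ext z \<in> ?B" if "z \<in> ?A" for z
  proof -
    have "q (ext z) = 0" unfolding q0 using that unfolding A by (simp add: ext_def)
    moreover have "p (ext z) = 0" if "p \<in> G" for p
      using pext[of p z] that \<open>z \<in> ?A\<close> G unfolding A by auto
    ultimately show ?thesis by simp
  qed
  have resA: "restrict z {..<n} \<in> ?A" if "z \<in> ?B" for z
  proof -
    have "\<forall>i<n. z i \<noteq> 0" using that q0[of z] by simp
    moreover have "p (restrict z {..<n}) = 0" if "p \<in> G" for p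
      using pres[of p z] that \<open>z \<in> ?B\<close> G by auto
    ultimately show ?thesis unfolding A by simp
  qed
  have "homeomorphic_maps (subtopology (complex_space {..<n}) ?A) (subtopology (complex_space {..<n + 1}) ?B)
      ext (\<lambda>z. restrict z {..<n})"
    unfolding homeomorphic_maps_def
  proof (intro conjI ballI)
    have "continuous_map (subtopology (complex_space {..<n}) ?A) (complex_space {..<n + 1}) ext"
    proof (rule continuous_map_into_complex_space)
      fix i assume "i \<in> {..<n + 1}"
      then consider "i < n" | "i = n" by fastforce
      then show "continuous_map (subtopology (complex_space {..<n}) ?A) euclidean (\<lambda>z. ext z i)"
      proof cases
        case 1
        then show ?thesis using continuous_map_projection[of i "{..<n}"] by (simp add: ext_def)
      next
        case 2
        have "continuous_map (subtopology (complex_space {..<n}) ?A) euclidean (\<lambda>z. 1 / (\<Prod>i<n. z i))"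
          by (intro continuous_map_complex_divide continuous_map_complex_prod continuous_map_projection)
             (auto simp: torus_def)
        then show ?thesis using 2 by (simp add: ext_def)
      qed
    qed (simp add: ext_def)
    then show "continuous_map (subtopology (complex_space {..<n}) ?A) (subtopology (complex_space {..<n + 1}) ?B) ext"
      unfolding continuous_map_in_subtopology using extB by auto
    have "continuous_map (subtopology (complex_space {..<n + 1}) ?B) (complex_space {..<n}) (\<lambda>z. restrict z {..<n})"
      by (rule continuous_map_into_complex_space) (simp_all add: continuous_map_projection)
    then show "continuous_map (subtopology (complex_space {..<n + 1}) ?B) (subtopology (complex_space {..<n}) ?A)
        (\<lambda>z. restrict z {..<n})"
      unfolding continuous_map_in_subtopology using resA by auto
    show "restrict (ext z) {..<n} = z" if "z \<in> topspace (subtopology (complex_space {..<n}) ?A)" for z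
      by (rule extensionalityI[of _ "{..<n}"]) (use that in \<open>auto simp: ext_def topspace_complex_space\<close>)
    show "ext (restrict z {..<n}) = z" if z: "z \<in> topspace (subtopology (complex_space {..<n + 1}) ?B)" for z
    proof (rule extensionalityI[of _ "{..<n + 1}"])
      show "z \<in> extensional {..<n + 1}" using z by (simp add: topspace_complex_space)
      have "q z = 0" using z by simp
      then show "ext (restrict z {..<n}) i = z i" if "i \<in> {..<n + 1}" for i
        using that unfolding q0 by (cases "i = n") (auto simp: ext_def)
    qed (simp add: ext_def)
  qed
  from homeomorphic_map_compose[OF hom homeomorphic_maps_imp_map[OF this]]
  have hom': "homeomorphic_map (analytic V) (subtopology (complex_space {..<n + 1}) ?B) (ext \<circ> \<phi>)" .
  have \<phi>A: "\<phi> x \<in> ?A" if "x \<in> points V" for x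
    using homeomorphic_imp_surjective_map[OF hom] that by auto
  interpret localization "points V" "{..<n}" \<phi> "\<lambda>x. \<Prod>i<n. \<phi> x i" "\<lambda>z. \<Prod>i<n. z i"
  proof
    show "(\<lambda>z. \<Prod>i<n. z i) \<in> poly_funs {..<n}" by (intro poly_funs_prod poly_funs.coord) auto
    show "(\<Prod>i<n. \<phi> x i) \<noteq> 0" if "x \<in> points V" for x using \<phi>A[OF that] unfolding A by simp
  qed simp
  have "regular V = {g. \<exists>p\<in>poly_funs {..<n + 1}. \<forall>x\<in>points V. g x = p ((ext \<circ> \<phi>) x)}"
  proof (intro equalityI subsetI)
    fix g assume "g \<in> regular V"
    then obtain p N where p: "p \<in> poly_funs {..<n}" "\<forall>x\<in>points V. g x = p (\<phi> x) / (\<Prod>i<n. \<phi> x i) ^ N"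
      unfolding reg frac_funs_def by blast
    have "(\<lambda>z. p z * z n ^ N) \<in> poly_funs {..<n + 1}"
      by (intro poly_funs.intros poly_funs_power poly_funs_mono[OF p(1)]) auto
    moreover have "\<forall>x\<in>points V. g x = p ((ext \<circ> \<phi>) x) * (ext \<circ> \<phi>) x n ^ N"
      using p(2) pext[OF p(1)] by (simp add: ext_def power_divide)
    ultimately show "g \<in> {g. \<exists>p\<in>poly_funs {..<n + 1}. \<forall>x\<in>points V. g x = p ((ext \<circ> \<phi>) x)}"
      by (intro CollectI bexI[of _ "\<lambda>z. p z * z n ^ N"])
  next
    fix g assume "g \<in> {g. \<exists>p\<in>poly_funs {..<n + 1}. \<forall>x\<in>points V. g x = p ((ext \<circ> \<phi>) x)}"
    then obtain p where p: "p \<in> poly_funs {..<n + 1}" "\<forall>x\<in>points V. g x = p ((ext \<circ> \<phi>) x)" by blast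
    have "(\<lambda>x. (ext \<circ> \<phi>) x i) \<in> R" if "i \<in> {..<n + 1}" for i
      using that frac_coord[of i] frac_inverse by (cases "i < n") (auto simp: ext_def)
    from frac_poly[OF p(1) this] have "(\<lambda>x. p ((ext \<circ> \<phi>) x)) \<in> R" .
    then show "g \<in> regular V" unfolding reg by (rule frac_cong) (simp add: p(2))
  qed
  moreover have "insert q G \<subseteq> poly_funs {..<n + 1}" using G1 q by simp
  ultimately show ?thesis unfolding affine_variety_def using hom' by blast
qed

section \<open>The moduli space as a very affine variety\<close>

definition representative :: "nat \<Rightarrow> nat \<Rightarrow> complex mat set \<Rightarrow> complex mat" where
  "representative k m x = normal_mat k m (SOME M. M \<in> x)"

lemma topspace_mat_topology: "topspace (mat_topology k m) = carrier_mat k m"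
  by (auto simp: mat_topology_def topspace_pullback_topology topspace_complex_space entries_def)

lemma topspace_config: "topspace (subtopology (mat_topology k m) (config k m)) = config k m"
  by (auto simp: topspace_mat_topology config_def)

lemma points_moduli_space: "points (moduli_space k m) = config k m // config_rel k m"
  by (simp add: moduli_space_def topspace_quotient_topology topspace_mat_topology Int_absorb1 config_def Collect_conj_eq)

lemma config_class_eq:
  "(M, N) \<in> config_rel k m \<Longrightarrow> config_rel k m `` {M} = config_rel k m `` {N}"
  by (rule equiv_class_eq[OF equiv_config_rel])

lemma config_class_self: "M \<in> config k m \<Longrightarrow> M \<in> config_rel k m `` {M}"
  by (rule equiv_class_self[OF equiv_config_rel])

text \<open>The normal form is constant on classes, so the arbitrary choice in
  \<open>representative\<close> does no harm.\<close>

lemma representative_class: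
  assumes M: "M \<in> config k m" and k: "0 < k" "k < m"
  shows "representative k m (config_rel k m `` {M}) = normal_mat k m M"
proof -
  have "(SOME N. N \<in> config_rel k m `` {M}) \<in> config_rel k m `` {M}"
    by (rule someI[of "\<lambda>N. N \<in> config_rel k m `` {M}"]) (rule config_class_self[OF M])
  then show ?thesis unfolding representative_def using normal_mat_eq[OF _ k] by simp
qed

lemma representative_point:
  assumes x: "x \<in> points (moduli_space k m)" and k: "0 < k" "k < m"
  shows "normal_form k m (representative k m x)" "config_rel k m `` {representative k m x} = x"
    "representative k m x \<in> x" "representative k m x \<in> config k m"
proof -
  obtain M where M: "M \<in> config k m" "x = config_rel k m `` {M}"
    using x unfolding points_moduli_space by (rule quotientE)
  have rep: "representative k m x = normal_mat k m M" using representative_class[OF M(1) k] M(2) by simp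
  show "normal_form k m (representative k m x)" unfolding rep by (rule normal_mat_normal_form[OF M(1) k])
  show c: "representative k m x \<in> config k m" unfolding rep by (rule normal_mat_rel[OF M(1) k])
  show *: "config_rel k m `` {representative k m x} = x"
    using rep config_class_eq[OF normal_mat_rel(2)[OF M(1) k]] M(2) by simp
  show "representative k m x \<in> x" using config_class_self[OF c] * by simp
qed

lemma representative_normal_form:
  assumes "normal_form k m N" "0 < k" "k < m"
  shows "representative k m (config_rel k m `` {N}) = N"
  using representative_class[of N k m] normal_mat_id[OF assms] assms by (simp add: normal_form_def)

lemma class_point: "M \<in> config k m \<Longrightarrow> config_rel k m `` {M} \<in> points (moduli_space k m)"
  unfolding points_moduli_space by (rule quotientI)

lemma continuous_map_config_entry:
  assumes "i < k" "j < m"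
  shows "continuous_map (subtopology (mat_topology k m) (config k m)) euclidean (\<lambda>M. M $$ (i, j))"
proof -
  have "continuous_map (complex_space ({..<k} \<times> {..<m})) euclidean (\<lambda>z. z (i, j))"
    using continuous_map_complex_space_coordinate[of _ "{..<k} \<times> {..<m}" id "(i, j)"] assms by (simp add: id_def)
  from continuous_map_pullback[OF this, of "carrier_mat k m" "entries k m"]
  have "continuous_map (mat_topology k m) euclidean ((\<lambda>z. z (i, j)) \<circ> entries k m)"
    by (simp add: mat_topology_def)
  moreover have "(\<lambda>z. z (i, j)) \<circ> entries k m = (\<lambda>M. M $$ (i, j))" using assms by (simp add: entries_def fun_eq_iff)
  ultimately show ?thesis by (simp add: continuous_map_from_subtopology)
qed

lemma continuous_map_into_config:
  assumes "\<And>i j. i < k \<Longrightarrow> j < m \<Longrightarrow> continuous_map Z euclidean (\<lambda>z. F z $$ (i, j))"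
    and F: "\<And>z. z \<in> topspace Z \<Longrightarrow> F z \<in> config k m"
  shows "continuous_map Z (subtopology (mat_topology k m) (config k m)) F"
proof -
  have "continuous_map Z (complex_space ({..<k} \<times> {..<m})) (\<lambda>z. entries k m (F z))"
    by (rule continuous_map_into_complex_space) (use assms(1) in \<open>auto simp: entries_def\<close>)
  then have "continuous_map Z (mat_topology k m) F"
    unfolding mat_topology_def
    by (intro continuous_map_pullback') (use F in \<open>auto simp: o_def config_def\<close>)
  then show ?thesis using F by (auto simp: continuous_map_in_subtopology)
qed

lemma continuous_map_into_moduli_space:
  assumes "\<And>i j. i < k \<Longrightarrow> j < m \<Longrightarrow> continuous_map Z euclidean (\<lambda>z. F z $$ (i, j))"
    and "\<And>z. z \<in> topspace Z \<Longrightarrow> F z \<in> config k m"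
  shows "continuous_map Z (analytic (moduli_space k m)) (\<lambda>z. config_rel k m `` {F z})"
  using continuous_map_compose[OF continuous_map_into_config[OF assms] continuous_map_quotient_class]
  by (simp add: moduli_space_def o_def)

lemma continuous_map_vdet:
  assumes "length es = k" "\<And>e i. e \<in> set es \<Longrightarrow> i < k \<Longrightarrow> continuous_map Z euclidean (\<lambda>z. v z e i)"
  shows "continuous_map Z euclidean (\<lambda>z. vdet k (v z) es)"
  unfolding vdet_def by (intro continuous_map_det assms(2)) (use assms(1) in auto)

text \<open>Continuity on the quotient is tested on configurations. There the representative is the
  normal matrix, whose entries are fractions of determinants with nonvanishing denominators.\<close>

lemma continuous_map_representative:
  assumes k: "0 < k" "k < m" and ij: "i < k" "j < m"
  shows "continuous_map (analytic (moduli_space k m)) euclidean (\<lambda>x. representative k m x $$ (i, j))"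
proof -
  let ?T = "subtopology (mat_topology k m) (config k m)"
  have B: "continuous_map ?T euclidean (\<lambda>M. frame_coord k M i j)" if "i < k" "k \<le> j" "j < m" for i j
    unfolding frame_coord_def coef_def
  proof (rule continuous_map_complex_divide)
    show "continuous_map ?T euclidean (\<lambda>M. vdet k (mat_cols M) ([0..<k][i := j]))"
      using replaced_frame[OF that(1,2)] that k unfolding mat_cols_def
      by (intro continuous_map_vdet continuous_map_config_entry) auto
    show "continuous_map ?T euclidean (\<lambda>M. vdet k (mat_cols M) [0..<k])"
      using k unfolding mat_cols_def by (intro continuous_map_vdet continuous_map_config_entry) auto
    show "vdet k (mat_cols M) [0..<k] \<noteq> 0" if "M \<in> topspace ?T" for M
      using that config_frame[of M k m] k unfolding topspace_config by simp
  qed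
  have nz: "frame_coord k M i j \<noteq> 0" if "M \<in> topspace ?T" "i < k" "k \<le> j" "j < m" for M i j
    using that frame_coord_nonzero[of M k m i j] k unfolding topspace_config by simp
  have "continuous_map ?T euclidean (\<lambda>M. normal_mat k m M $$ (i, j))"
  proof (cases "j < k")
    case True
    then show ?thesis using ij k by (simp add: normal_mat_def)
  next
    case False
    have "continuous_map ?T euclidean (\<lambda>M. frame_coord k M i j * frame_coord k M 0 k /
        (frame_coord k M i k * frame_coord k M 0 j))"
      using False ij k by (intro continuous_map_complex_divide continuous_map_complex_mult B) (simp_all add: nz)
    then show ?thesis using False ij by (simp add: normal_mat_def)
  qed
  then have "continuous_map ?T euclidean (\<lambda>M. representative k m (config_rel k m `` {M}) $$ (i, j))"
    by (rule continuous_map_eq) (simp add: topspace_config representative_class[OF _ k])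
  from continuous_map_from_quotient[OF this] show ?thesis by (simp add: moduli_space_def)
qed

section \<open>Regular functions on configurations\<close>

lemma pluecker_entries_poly:
  assumes J: "J \<in> ksubsets k m"
  obtains p where "p \<in> poly_funs ({..<k} \<times> {..<m})" "\<And>M. M \<in> carrier_mat k m \<Longrightarrow> pluecker M J = p (entries k m M)"
proof
  have lt: "pick J j < m" if "j < k" for j using J pick_in_set_le[of j J] that by (auto simp: ksubsets_def)
  show "(\<lambda>z. det (mat k k (\<lambda>(i, j). z (i, pick J j)))) \<in> poly_funs ({..<k} \<times> {..<m})"
    by (intro poly_funs_det poly_funs.coord) (simp add: lt)
  show "pluecker M J = det (mat k k (\<lambda>(i, j). entries k m M (i, pick J j)))" if "M \<in> carrier_mat k m" for M
    unfolding pluecker_eq_vdet[OF that J] vdet_def mat_cols_def entries_def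
    by (intro arg_cong[of _ _ det] eq_matI) (auto simp: lt)
qed

lemma finite_ksubsets: "finite (ksubsets k m)"
  by (rule finite_subset[of _ "Pow {..<m}"]) (auto simp: ksubsets_def)

abbreviation pluecker_product :: "nat \<Rightarrow> nat \<Rightarrow> complex mat \<Rightarrow> complex" where
  "pluecker_product k m M \<equiv> \<Prod>J\<in>ksubsets k m. pluecker M J"

definition config_funs :: "nat \<Rightarrow> nat \<Rightarrow> (complex mat \<Rightarrow> complex) set" where
  "config_funs k m = frac_funs (config k m) ({..<k} \<times> {..<m}) (entries k m) (pluecker_product k m)"

lemma regular_moduli_space:
  "g \<in> regular (moduli_space k m) \<longleftrightarrow> (\<lambda>M. g (config_rel k m `` {M})) \<in> config_funs k m"
  by (simp add: moduli_space_def config_funs_def frac_funs_def)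

lemma localization_config:
  obtains P where "localization (config k m) ({..<k} \<times> {..<m}) (entries k m) (pluecker_product k m) P"
proof -
  have "\<forall>J\<in>ksubsets k m. \<exists>p\<in>poly_funs ({..<k} \<times> {..<m}). \<forall>M\<in>carrier_mat k m. pluecker M J = p (entries k m M)"
    using pluecker_entries_poly by metis
  from bchoice[OF this[unfolded Bex_def]] obtain p where
    p: "\<And>J. J \<in> ksubsets k m \<Longrightarrow> p J \<in> poly_funs ({..<k} \<times> {..<m})"
    "\<And>J M. J \<in> ksubsets k m \<Longrightarrow> M \<in> carrier_mat k m \<Longrightarrow> pluecker M J = p J (entries k m M)" by blast
  have "localization (config k m) ({..<k} \<times> {..<m}) (entries k m) (pluecker_product k m) (\<lambda>z. \<Prod>J\<in>ksubsets k m. p J z)"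
  proof
    show "(\<lambda>z. \<Prod>J\<in>ksubsets k m. p J z) \<in> poly_funs ({..<k} \<times> {..<m})"
      by (intro poly_funs_prod finite_ksubsets p)
    fix M assume M: "M \<in> config k m"
    then show "pluecker_product k m M = (\<Prod>J\<in>ksubsets k m. p J (entries k m M))"
      by (intro prod.cong) (auto simp: p config_def)
    show "pluecker_product k m M \<noteq> 0" using M finite_ksubsets by (simp add: config_def)
  qed
  then show thesis by (rule that)
qed

text \<open>Denominators are powers of the product of all maximal minors, so the fraction is
  extended by the other minors.\<close>

lemma config_funs_pluecker_inverse:
  assumes J: "J \<in> ksubsets k m"
  shows "(\<lambda>M. 1 / pluecker M J) \<in> config_funs k m"
proof -
  obtain P where "localization (config k m) ({..<k} \<times> {..<m}) (entries k m) (pluecker_product k m) P"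
    by (rule localization_config)
  then interpret localization "config k m" "{..<k} \<times> {..<m}" "entries k m" "pluecker_product k m" P .
  have pl: "(\<lambda>M. pluecker M L) \<in> R" if L: "L \<in> ksubsets k m" for L
  proof -
    obtain p where p: "p \<in> poly_funs ({..<k} \<times> {..<m})" "\<And>M. M \<in> carrier_mat k m \<Longrightarrow> pluecker M L = p (entries k m M)"
      using pluecker_entries_poly[OF L] by blast
    show ?thesis by (rule frac_cong[OF frac_poly_coord[OF p(1)]]) (simp add: p(2) config_def)
  qed
  have "(\<lambda>M. (\<Prod>L\<in>ksubsets k m - {J}. pluecker M L) * (1 / pluecker_product k m M)) \<in> R"
    by (intro frac_mult frac_prod frac_inverse pl) (auto intro: finite_subset[OF _ finite_ksubsets])
  then show ?thesis unfolding config_funs_def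
  proof (rule frac_cong)
    fix M assume M: "M \<in> config k m"
    then have nz: "(\<Prod>L\<in>ksubsets k m - {J}. pluecker M L) \<noteq> 0" "pluecker M J \<noteq> 0"
      using J finite_ksubsets by (auto simp: config_def)
    have "pluecker_product k m M = pluecker M J * (\<Prod>L\<in>ksubsets k m - {J}. pluecker M L)"
      using J finite_ksubsets by (simp add: prod.remove)
    then show "(\<Prod>L\<in>ksubsets k m - {J}. pluecker M L) * (1 / pluecker_product k m M) = 1 / pluecker M J"
      using nz by simp
  qed
qed

locale config_ring =
  fixes k m :: nat
  assumes k: "0 < k" and m: "k < m"
begin

lemma config_funs_closed:
  shows config_funs_const: "(\<lambda>_. c) \<in> config_funs k m"
    and config_funs_entry: "i < k \<Longrightarrow> j < m \<Longrightarrow> (\<lambda>M. M $$ (i, j)) \<in> config_funs k m"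
    and config_funs_mult: "u \<in> config_funs k m \<Longrightarrow> w \<in> config_funs k m \<Longrightarrow> (\<lambda>M. u M * w M) \<in> config_funs k m"
    and config_funs_prod: "finite A \<Longrightarrow> (\<And>a. a \<in> A \<Longrightarrow> f a \<in> config_funs k m) \<Longrightarrow>
      (\<lambda>M. \<Prod>a\<in>A. f a M) \<in> config_funs k m"
    and config_funs_poly: "p \<in> poly_funs I \<Longrightarrow> (\<And>i. i \<in> I \<Longrightarrow> (\<lambda>M. \<psi> M i) \<in> config_funs k m) \<Longrightarrow>
      (\<lambda>M. p (\<psi> M)) \<in> config_funs k m"
    and config_funs_power: "u \<in> config_funs k m \<Longrightarrow> (\<lambda>M. u M ^ n) \<in> config_funs k m"
    and config_funs_det: "(\<And>i j. i < l \<Longrightarrow> j < l \<Longrightarrow> (\<lambda>M. a M i j) \<in> config_funs k m) \<Longrightarrow>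
      (\<lambda>M. det (mat l l (\<lambda>(i, j). a M i j))) \<in> config_funs k m"
    and config_funs_cong: "u \<in> config_funs k m \<Longrightarrow> (\<And>M. M \<in> config k m \<Longrightarrow> u M = w M) \<Longrightarrow> w \<in> config_funs k m"
proof -
  obtain P where "localization (config k m) ({..<k} \<times> {..<m}) (entries k m) (pluecker_product k m) P"
    by (rule localization_config)
  then interpret localization "config k m" "{..<k} \<times> {..<m}" "entries k m" "pluecker_product k m" P .
  note eq = config_funs_def
  show "(\<lambda>_. c) \<in> config_funs k m" unfolding eq by (rule frac_const)
  show "(\<lambda>M. M $$ (i, j)) \<in> config_funs k m" if "i < k" "j < m"
    unfolding eq using frac_coord[of "(i, j)"] that by (simp add: entries_def)
  show "(\<lambda>M. u M * w M) \<in> config_funs k m" if "u \<in> config_funs k m" "w \<in> config_funs k m"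
    using that unfolding eq by (rule frac_mult)
  show "(\<lambda>M. \<Prod>a\<in>A. f a M) \<in> config_funs k m" if "finite A" "\<And>a. a \<in> A \<Longrightarrow> f a \<in> config_funs k m"
    using that unfolding eq by (rule frac_prod)
  show "(\<lambda>M. p (\<psi> M)) \<in> config_funs k m" if "p \<in> poly_funs I" "\<And>i. i \<in> I \<Longrightarrow> (\<lambda>M. \<psi> M i) \<in> config_funs k m"
    using that unfolding eq by (rule frac_poly)
  show "(\<lambda>M. u M ^ n) \<in> config_funs k m" if "u \<in> config_funs k m"
    using that unfolding eq by (rule frac_power)
  show "(\<lambda>M. det (mat l l (\<lambda>(i, j). a M i j))) \<in> config_funs k m"
    if "\<And>i j. i < l \<Longrightarrow> j < l \<Longrightarrow> (\<lambda>M. a M i j) \<in> config_funs k m"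
    using that unfolding eq by (rule frac_det)
  show "w \<in> config_funs k m" if "u \<in> config_funs k m" "\<And>M. M \<in> config k m \<Longrightarrow> u M = w M"
    using that unfolding eq by (rule frac_cong)
qed

lemma config_funs_vdet:
  assumes "length es = k" "\<And>e i. e \<in> set es \<Longrightarrow> i < k \<Longrightarrow> (\<lambda>M. v M e i) \<in> config_funs k m"
  shows "(\<lambda>M. vdet k (v M) es) \<in> config_funs k m"
  unfolding vdet_def by (rule config_funs_det) (use assms in auto)

lemma config_funs_vdet_inverse:
  assumes "distinct es" "length es = k" "set es \<subseteq> {..<m}"
  shows "(\<lambda>M. 1 / vdet k (mat_cols M) es) \<in> config_funs k m"
proof -
  have J: "set es \<in> ksubsets k m" using assms by (simp add: ksubsets_def distinct_card)
  obtain s where s: "s \<in> {1, -1}" "\<And>M. M \<in> carrier_mat k m \<Longrightarrow> vdet k (mat_cols M) es = s * pluecker M (set es)"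
    using vdet_pluecker[OF assms] by blast
  have "(\<lambda>M. s * (1 / pluecker M (set es))) \<in> config_funs k m"
    by (intro config_funs_mult config_funs_const config_funs_pluecker_inverse J)
  then show ?thesis by (rule config_funs_cong) (use s in \<open>auto simp: config_def\<close>)
qed

lemma config_funs_frame_coord:
  assumes "i < k" "k \<le> j" "j < m"
  shows "(\<lambda>M. frame_coord k M i j) \<in> config_funs k m" "(\<lambda>M. 1 / frame_coord k M i j) \<in> config_funs k m"
proof -
  have fr: "distinct [0..<k]" "length [0..<k] = k" "set [0..<k] \<subseteq> {..<m}" using m by auto
  have re: "distinct ([0..<k][i := j])" "length ([0..<k][i := j]) = k" "set ([0..<k][i := j]) \<subseteq> {..<m}"
    using replaced_frame[OF assms(1,2)] assms m by auto
  have v: "(\<lambda>M. vdet k (mat_cols M) es) \<in> config_funs k m" if "length es = k" "set es \<subseteq> {..<m}" for es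
  proof (rule config_funs_vdet[OF that(1)])
    fix e i assume "e \<in> set es" "i < k"
    then show "(\<lambda>M. mat_cols M e i) \<in> config_funs k m"
      using that(2) unfolding mat_cols_def by (intro config_funs_entry) auto
  qed
  show "(\<lambda>M. frame_coord k M i j) \<in> config_funs k m"
    using config_funs_mult[OF v[OF re(2,3)] config_funs_vdet_inverse[OF fr]]
    by (simp add: frame_coord_def coef_def)
  show "(\<lambda>M. 1 / frame_coord k M i j) \<in> config_funs k m"
    using config_funs_mult[OF v[OF fr(2,3)] config_funs_vdet_inverse[OF re]]
    by (simp add: frame_coord_def coef_def)
qed

lemma config_funs_normal_entry:
  assumes i: "i < k" and j: "j < m"
  shows "(\<lambda>M. normal_mat k m M $$ (i, j)) \<in> config_funs k m"
    and "k \<le> j \<Longrightarrow> (\<lambda>M. 1 / normal_mat k m M $$ (i, j)) \<in> config_funs k m"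
proof -
  note fc = config_funs_frame_coord
  have "(\<lambda>M. (frame_coord k M i j * frame_coord k M 0 k) *
      ((1 / frame_coord k M i k) * (1 / frame_coord k M 0 j))) \<in> config_funs k m" if "k \<le> j"
    using that i j k m by (intro config_funs_mult fc) auto
  then show "(\<lambda>M. normal_mat k m M $$ (i, j)) \<in> config_funs k m"
    using i j by (cases "j < k") (simp_all add: normal_mat_def config_funs_const)
  show "(\<lambda>M. 1 / normal_mat k m M $$ (i, j)) \<in> config_funs k m" if "k \<le> j"
  proof -
    have "(\<lambda>M. ((1 / frame_coord k M i j) * (1 / frame_coord k M 0 k)) *
      (frame_coord k M i k * frame_coord k M 0 j)) \<in> config_funs k m"
      using that i j k m by (intro config_funs_mult fc) auto
    then show ?thesis using i j that by (simp add: normal_mat_def)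
  qed
qed

text \<open>For the inverse: the action leading from the normal form to \<open>M\<close> makes
  \<open>pluecker M J\<close> the product of \<open>det A\<close>, the minor of the normal form and
  some of the \<open>t\<close>. Here \<open>det A\<close> and \<open>t\<close> lie in the ring, and
  \<open>pluecker M J\<close> is a unit.\<close>

lemma config_funs_normal_pluecker:
  assumes J: "J \<in> ksubsets k m"
  shows "(\<lambda>M. pluecker (normal_mat k m M) J) \<in> config_funs k m"
    and "(\<lambda>M. 1 / pluecker (normal_mat k m M) J) \<in> config_funs k m"
proof -
  let ?es = "map (pick J) [0..<k]"
  have es: "length ?es = k" "set ?es \<subseteq> {..<m}" using pick_list[OF J] J by (auto simp: ksubsets_def)
  have N: "normal_mat k m M \<in> carrier_mat k m" for M by (simp add: normal_mat_def)
  have pl: "pluecker (normal_mat k m M) J = vdet k (mat_cols (normal_mat k m M)) ?es" for M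
    by (rule pluecker_eq_vdet[OF N J])
  show "(\<lambda>M. pluecker (normal_mat k m M) J) \<in> config_funs k m"
    unfolding pl
  proof (rule config_funs_vdet[OF es(1)])
    fix e i assume "e \<in> set ?es" "i < k"
    then show "(\<lambda>M. mat_cols (normal_mat k m M) e i) \<in> config_funs k m"
      using es(2) unfolding mat_cols_def by (intro config_funs_normal_entry) auto
  qed
  define t where "t M j = (if j < k then 1 / frame_coord k M j k else frame_coord k M 0 j / frame_coord k M 0 k)"
    for M j
  have t: "(\<lambda>M. t M j) \<in> config_funs k m" if "j < m" for j
  proof (cases "j < k")
    case True
    then show ?thesis using config_funs_frame_coord(2)[of j k] m by (simp add: t_def)
  next
    case False
    then have "(\<lambda>M. frame_coord k M 0 j * (1 / frame_coord k M 0 k)) \<in> config_funs k m"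
      using that k m by (intro config_funs_mult config_funs_frame_coord) auto
    then show ?thesis using False by (simp add: t_def)
  qed
  have "(\<lambda>M. (vdet k (mat_cols M) [0..<k] * (\<Prod>l<k. frame_coord k M l k)) *
      ((\<Prod>j<k. t M (?es ! j)) * (1 / pluecker M J))) \<in> config_funs k m"
  proof (intro config_funs_mult config_funs_prod config_funs_vdet config_funs_pluecker_inverse J)
    show "(\<lambda>M. frame_coord k M l k) \<in> config_funs k m" if "l \<in> {..<k}" for l
      using config_funs_frame_coord(1)[of l k] that m by simp
    show "(\<lambda>M. mat_cols M e i) \<in> config_funs k m" if "e \<in> set [0..<k]" "i < k" for e i
      using that m unfolding mat_cols_def by (intro config_funs_entry) auto
    show "(\<lambda>M. t M (?es ! j)) \<in> config_funs k m" if "j \<in> {..<k}" for j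
    proof (rule t)
      have "?es ! j \<in> set ?es" using that es(1) by (intro nth_mem) simp
      then show "?es ! j < m" using es(2) by blast
    qed
  qed auto
  then show "(\<lambda>M. 1 / pluecker (normal_mat k m M) J) \<in> config_funs k m"
  proof (rule config_funs_cong)
    fix M assume M: "M \<in> config k m"
    note act = normal_mat_action[OF M k m]
    have "vdet k (mat_cols M) ?es = det (mat k k (\<lambda>(i, l). M $$ (i, l) * frame_coord k M l k)) *
        vdet k (mat_cols (normal_mat k m M)) ?es * (\<Prod>j<k. t M (?es ! j))"
      unfolding t_def by (subst act(1), rule vdet_action[OF mat_carrier N es])
    then have "pluecker M J = (vdet k (mat_cols M) [0..<k] * (\<Prod>l<k. frame_coord k M l k)) *
        pluecker (normal_mat k m M) J * (\<Prod>j<k. t M (?es ! j))"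
      unfolding act(2) pl using M pluecker_eq_vdet[OF _ J, of M] by (simp add: config_def)
    moreover have "pluecker M J \<noteq> 0" using M J by (simp add: config_def)
    ultimately show "(vdet k (mat_cols M) [0..<k] * (\<Prod>l<k. frame_coord k M l k)) *
      ((\<Prod>j<k. t M (?es ! j)) * (1 / pluecker M J)) = 1 / pluecker (normal_mat k m M) J"
      by (simp add: field_simps)
  qed
qed

lemma config_funs_normals:
  assumes "J \<in> ksubsets (k - 1) m" "i < k"
  shows "(\<lambda>M. normals k (normal_mat k m M) J i) \<in> config_funs k m"
proof -
  have N: "normal_mat k m M \<in> carrier_mat k m" for M by (simp add: normal_mat_def)
  have lt: "pick J j < m" if "j < k - 1" for j using assms pick_in_set_le[of j J] that by (auto simp: ksubsets_def)
  show ?thesis unfolding normals_eq_det[OF N assms]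
    by (intro config_funs_mult config_funs_const config_funs_det config_funs_normal_entry) (use lt in auto)
qed

end

context config_ring begin

text \<open>A point is embedded by the nontrivial entries and the Pluecker coordinates of its normal form;
  all of them are nonzero.\<close>

lemma very_affine_moduli_space: "very_affine_variety (moduli_space k m)"
proof -
  let ?V = "moduli_space k m" and ?rep = "representative k m"
  define I :: "(nat \<times> nat + nat set) set" where "I = Inl ` ({..<k} \<times> {k..<m}) \<union> Inr ` ksubsets k m"
  have finI: "finite I" by (simp add: I_def finite_ksubsets)
  have IE: thesis if "i \<in> I" "\<And>a b. i = Inl (a, b) \<Longrightarrow> a < k \<Longrightarrow> k \<le> b \<Longrightarrow> b < m \<Longrightarrow> thesis"
    "\<And>J. i = Inr J \<Longrightarrow> J \<in> ksubsets k m \<Longrightarrow> thesis" for i thesis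
    using that by (auto simp: I_def)
  have Inl: "Inl (a, b) \<in> I \<longleftrightarrow> a < k \<and> k \<le> b \<and> b < m" for a b by (auto simp: I_def)
  have Inr: "Inr J \<in> I \<longleftrightarrow> J \<in> ksubsets k m" for J by (auto simp: I_def)
  define co where "co N = (\<lambda>i\<in>I. case i of Inl (a, b) \<Rightarrow> N $$ (a, b) | Inr J \<Rightarrow> pluecker N J)" for N
  have co_Inl: "co N (Inl (a, b)) = N $$ (a, b)" if "a < k" "k \<le> b" "b < m" for N a b
    using that by (simp add: co_def Inl)
  have co_Inr: "co N (Inr J) = pluecker N J" if "J \<in> ksubsets k m" for N J
    using that by (simp add: co_def Inr)
  define \<phi> where "\<phi> x = co (?rep x)" for x
  define mt where "mt z = mat k m (\<lambda>(i, j). if j < k then (if i = j then 1 else 0) else z (Inl (i, j)))"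
    for z :: "nat \<times> nat + nat set \<Rightarrow> complex"
  define pl where "pl J z = det (mat k k (\<lambda>(i, j). if pick J j < k then (if i = pick J j then 1 else 0)
      else z (Inl (i, pick J j))))" for J and z :: "nat \<times> nat + nat set \<Rightarrow> complex"
  have pick: "pick J j < m" if "J \<in> ksubsets k m" "j < k" for J j
    using that pick_in_set_le[of j J] by (auto simp: ksubsets_def)
  have mtc: "mt z \<in> carrier_mat k m" for z by (simp add: mt_def)
  have pl: "pluecker (mt z) J = pl J z" if J: "J \<in> ksubsets k m" for J z
    unfolding pluecker_eq_vdet[OF mtc J] unfolding vdet_def mat_cols_def pl_def mt_def
    by (intro arg_cong[of _ _ det] eq_matI) (auto simp: pick[OF J])
  \<comment> \<open>The frame conditions, and the equations that tie the last coordinates to the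
    minors. Since torus coordinates are nonzero, the latter make the matrix of a solution a
    configuration.\<close>
  define G where "G = (\<lambda>j z. z (Inl (0, j)) - 1) ` {k..<m} \<union> (\<lambda>i z. z (Inl (i, k)) - 1) ` {..<k} \<union>
      (\<lambda>J z. z (Inr J) - pl J z) ` ksubsets k m"
  have plp: "pl J \<in> poly_funs I" if J: "J \<in> ksubsets k m" for J
    unfolding pl_def
  proof (rule poly_funs_det)
    fix i j assume "i < k" "j < k"
    then show "(\<lambda>z. if pick J j < k then if i = pick J j then 1 else 0 else z (Inl (i, pick J j))) \<in> poly_funs I"
      using pick[OF J] by (cases "pick J j < k") (auto simp: Inl intro: poly_funs.intros)
  qed
  have G: "G \<subseteq> poly_funs I"
    unfolding G_def using k m plp
    by (auto simp: Inl Inr intro!: poly_funs_diff poly_funs.const poly_funs.coord)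
  let ?A = "{z \<in> torus I. \<forall>p\<in>G. p z = 0}"
  have nf_co: "mt (co N) = N" if N: "normal_form k m N" for N
  proof (rule eq_matI)
    have Nc: "N \<in> carrier_mat k m" using N by (simp add: normal_form_def config_def)
    then show "dim_row (mt (co N)) = dim_row N" "dim_col (mt (co N)) = dim_col N" by (auto simp: mt_def)
    fix i j assume "i < dim_row N" "j < dim_col N"
    then have "i < k" "j < m" using Nc by auto
    then show "mt (co N) $$ (i, j) = N $$ (i, j)"
      using N by (auto simp: mt_def normal_form_def co_Inl)
  qed
  have entry_nz: "N $$ (i, j) \<noteq> 0" if N: "normal_form k m N" and "i < k" "k \<le> j" "j < m" for N i j
    using frame_coord_nonzero[of N k m i j] normal_form_coord[OF N \<open>i < k\<close> m, of j] that m
    by (simp add: normal_form_def)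
  have coA: "co N \<in> ?A" if N: "normal_form k m N" for N
  proof -
    have "co N i \<noteq> 0" if "i \<in> I" for i
      using that by (rule IE) (use N entry_nz in \<open>auto simp: co_Inl co_Inr normal_form_def config_def\<close>)
    moreover have "p (co N) = 0" if "p \<in> G" for p
    proof -
      have "co N (Inr J) - pl J (co N) = 0" if "J \<in> ksubsets k m" for J
        using pl[OF that, of "co N"] nf_co[OF N] that by (simp add: co_Inr)
      then show ?thesis using that N k m by (auto simp: G_def co_Inl normal_form_def)
    qed
    moreover have "co N \<in> extensional I" by (simp add: co_def)
    ultimately show ?thesis by (auto simp: torus_def topspace_complex_space)
  qed
  have mtA: "normal_form k m (mt z)" "co (mt z) = z" if z: "z \<in> ?A" for z
  proof -
    have nz: "\<And>i. i \<in> I \<Longrightarrow> z i \<noteq> 0" and ext: "z \<in> extensional I"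
      using z by (auto simp: torus_def topspace_complex_space)
    have Gz: "p z = 0" if "p \<in> G" for p using z that by blast
    have g1: "z (Inl (0, j)) = 1" if "j \<in> {k..<m}" for j
      using Gz[of "\<lambda>z. z (Inl (0, j)) - 1"] that by (simp add: G_def)
    have g2: "z (Inl (i, k)) = 1" if "i < k" for i
      using Gz[of "\<lambda>z. z (Inl (i, k)) - 1"] that by (simp add: G_def)
    have g3: "z (Inr J) = pl J z" if "J \<in> ksubsets k m" for J
      using Gz[of "\<lambda>z. z (Inr J) - pl J z"] that by (simp add: G_def)
    have "pluecker (mt z) J \<noteq> 0" if "J \<in> ksubsets k m" for J
      using pl[OF that, of z] g3[OF that] nz[of "Inr J"] that by (simp add: Inr)
    then have "mt z \<in> config k m" unfolding config_def using mtc by blast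
    then show "normal_form k m (mt z)"
      unfolding normal_form_def using g1 g2 k m by (auto simp: mt_def)
    show "co (mt z) = z"
    proof (rule extensionalityI[OF _ ext])
      show "co (mt z) \<in> extensional I" by (simp add: co_def)
      fix i assume "i \<in> I"
      then show "co (mt z) i = z i"
        by (rule IE) (auto simp: co_Inl co_Inr pl g3, simp add: mt_def)
    qed
  qed
  have rep: "normal_form k m (?rep x)" if "x \<in> points ?V" for x
    using representative_point(1)[OF that k m] .
  have "homeomorphic_maps (analytic ?V) (subtopology (complex_space I) ?A) \<phi> (\<lambda>z. config_rel k m `` {mt z})"
    unfolding homeomorphic_maps_def
  proof (intro conjI ballI)
    have "continuous_map (analytic ?V) (complex_space I) \<phi>"
    proof (rule continuous_map_into_complex_space)
      fix i assume "i \<in> I"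
      then show "continuous_map (analytic ?V) euclidean (\<lambda>x. \<phi> x i)"
      proof (rule IE)
        fix a b assume "i = Inl (a, b)" "a < k" "k \<le> b" "b < m"
        then show ?thesis using continuous_map_representative[OF k m] by (simp add: \<phi>_def co_Inl)
      next
        fix J assume J: "i = Inr J" "J \<in> ksubsets k m"
        have "continuous_map (analytic ?V) euclidean (\<lambda>x. vdet k (mat_cols (?rep x)) (map (pick J) [0..<k]))"
          unfolding mat_cols_def using pick[OF J(2)]
          by (intro continuous_map_vdet continuous_map_representative k m) auto
        then have "continuous_map (analytic ?V) euclidean (\<lambda>x. pluecker (?rep x) J)"
          by (rule continuous_map_eq)
             (use rep pluecker_eq_vdet[OF _ J(2)] in \<open>simp add: normal_form_def config_def\<close>)
        then show ?thesis using J by (simp add: \<phi>_def co_Inr)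
      qed
    qed (simp add: \<phi>_def co_def)
    then show "continuous_map (analytic ?V) (subtopology (complex_space I) ?A) \<phi>"
      unfolding continuous_map_in_subtopology using coA rep by (auto simp: \<phi>_def)
    show "continuous_map (subtopology (complex_space I) ?A) (analytic ?V) (\<lambda>z. config_rel k m `` {mt z})"
    proof (rule continuous_map_into_moduli_space)
      fix i j assume ij: "i < k" "j < m"
      show "continuous_map (subtopology (complex_space I) ?A) euclidean (\<lambda>z. mt z $$ (i, j))"
        using ij continuous_map_projection[of "Inl (i, j)" I ?A]
        by (cases "j < k") (simp_all add: mt_def Inl)
    next
      fix z assume "z \<in> topspace (subtopology (complex_space I) ?A)"
      then show "mt z \<in> config k m" using mtA(1)[of z] by (simp add: normal_form_def)
    qed
    show "config_rel k m `` {mt (\<phi> x)} = x" if "x \<in> points ?V" for x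
      using nf_co[OF rep[OF that]] representative_point(2)[OF that k m] by (simp add: \<phi>_def)
    show "\<phi> (config_rel k m `` {mt z}) = z" if "z \<in> topspace (subtopology (complex_space I) ?A)" for z
      using mtA[of z] that representative_normal_form[OF mtA(1) k m, of z] by (simp add: \<phi>_def)
  qed
  then have hom: "homeomorphic_map (analytic ?V) (subtopology (complex_space I) ?A) \<phi>"
    by (rule homeomorphic_maps_imp_map)
  have \<phi>A: "\<phi> x \<in> ?A" if "x \<in> points ?V" for x using coA[OF rep[OF that]] by (simp add: \<phi>_def)
  interpret loc: localization "points ?V" I \<phi> "\<lambda>x. \<Prod>i\<in>I. \<phi> x i" "\<lambda>z. \<Prod>i\<in>I. z i"
  proof
    show "(\<lambda>z. \<Prod>i\<in>I. z i) \<in> poly_funs I" by (intro poly_funs_prod finI poly_funs.coord)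
    show "(\<Prod>i\<in>I. \<phi> x i) \<noteq> 0" if "x \<in> points ?V" for x using \<phi>A[OF that] finI by (simp add: torus_def)
  qed simp
  have "regular ?V = frac_funs (points ?V) I \<phi> (\<lambda>x. \<Prod>i\<in>I. \<phi> x i)"
  proof (intro equalityI subsetI)
    fix g assume "g \<in> regular ?V"
    then obtain p N where p: "p \<in> poly_funs ({..<k} \<times> {..<m})"
      "\<And>M. M \<in> config k m \<Longrightarrow> g (config_rel k m `` {M}) = p (entries k m M) / pluecker_product k m M ^ N"
      unfolding regular_moduli_space config_funs_def frac_funs_def by blast
    have num: "(\<lambda>x. p (entries k m (?rep x))) \<in> loc.R"
    proof (rule loc.frac_poly[OF p(1)])
      fix ij assume ij: "ij \<in> {..<k} \<times> {..<m}"
      then obtain i j where ij: "ij = (i, j)" "i < k" "j < m" by auto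
      show "(\<lambda>x. entries k m (?rep x) ij) \<in> loc.R"
      proof (cases "j < k")
        case True
        have "(\<lambda>x. if i = j then 1 else 0) \<in> loc.R" by (rule loc.frac_const)
        then show ?thesis
          by (rule loc.frac_cong) (use rep True ij in \<open>auto simp: entries_def normal_form_def\<close>)
      next
        case False
        then show ?thesis using loc.frac_coord[of "Inl (i, j)"] ij
          by (simp add: Inl \<phi>_def co_Inl entries_def)
      qed
    qed
    \<comment> \<open>The product of all coordinates is the product of the entries times that of the
      minors, so this function is the inverse of the product of the minors.\<close>
    have den: "(\<lambda>x. (\<Prod>i\<in>Inl ` ({..<k} \<times> {k..<m}). \<phi> x i) * (1 / (\<Prod>i\<in>I. \<phi> x i))) \<in> loc.R"
      by (intro loc.frac_mult loc.frac_prod loc.frac_coord loc.frac_inverse) (auto simp: I_def)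
    show "g \<in> loc.R"
    proof (rule loc.frac_cong[OF loc.frac_mult[OF num loc.frac_power[OF den]]])
      fix x assume x: "x \<in> points ?V"
      note r = representative_point[OF x k m]
      have "(\<Prod>i\<in>I. \<phi> x i) = (\<Prod>i\<in>Inl ` ({..<k} \<times> {k..<m}). \<phi> x i) * (\<Prod>i\<in>Inr ` ksubsets k m. \<phi> x i)"
        unfolding I_def using finite_ksubsets by (intro prod.union_disjoint) auto
      also have "(\<Prod>i\<in>Inr ` ksubsets k m. \<phi> x i) = pluecker_product k m (?rep x)"
        by (simp add: prod.reindex \<phi>_def co_Inr)
      finally have "(\<Prod>i\<in>I. \<phi> x i) = (\<Prod>i\<in>Inl ` ({..<k} \<times> {k..<m}). \<phi> x i) * pluecker_product k m (?rep x)" .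
      moreover have "g x = p (entries k m (?rep x)) / pluecker_product k m (?rep x) ^ N"
        using p(2)[OF r(4)] r(2) by simp
      ultimately show "p (entries k m (?rep x)) *
          ((\<Prod>i\<in>Inl ` ({..<k} \<times> {k..<m}). \<phi> x i) * (1 / (\<Prod>i\<in>I. \<phi> x i))) ^ N = g x"
        using loc.nonzero[OF x] by (simp add: power_divide)
    qed
  next
    fix g assume "g \<in> loc.R"
    then obtain p N where p: "p \<in> poly_funs I" "\<And>x. x \<in> points ?V \<Longrightarrow> g x = p (\<phi> x) / (\<Prod>i\<in>I. \<phi> x i) ^ N"
      unfolding frac_funs_def by blast
    have 1: "(\<lambda>M. co (normal_mat k m M) i) \<in> config_funs k m"
      and 2: "(\<lambda>M. 1 / co (normal_mat k m M) i) \<in> config_funs k m" if "i \<in> I" for i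
      using that by (rule IE; simp add: co_Inl co_Inr config_funs_normal_entry config_funs_normal_pluecker)+
    have "(\<lambda>M. p (co (normal_mat k m M)) * (\<Prod>i\<in>I. 1 / co (normal_mat k m M) i) ^ N) \<in> config_funs k m"
      by (intro config_funs_mult config_funs_poly[OF p(1)] config_funs_power config_funs_prod finI 1 2)
    then have "(\<lambda>M. g (config_rel k m `` {M})) \<in> config_funs k m"
    proof (rule config_funs_cong)
      fix M assume M: "M \<in> config k m"
      then show "p (co (normal_mat k m M)) * (\<Prod>i\<in>I. 1 / co (normal_mat k m M) i) ^ N = g (config_rel k m `` {M})"
        using p(2)[OF class_point[OF M]] representative_class[OF M k m]
        by (simp add: \<phi>_def prod_dividef power_one_over)
    qed
    then show "g \<in> regular ?V" by (simp add: regular_moduli_space)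
  qed
  then show ?thesis by (rule very_affine_varietyI[OF finI G hom])
qed

section \<open>The discriminantal strata\<close>

lemma bases_representative:
  assumes x: "x \<in> points (moduli_space k m)" and M: "M \<in> x"
  shows "discriminantal_bases k m M = discriminantal_bases k m (representative k m x)"
proof -
  have "M \<in> config_rel k m `` {representative k m x}" using representative_point(2)[OF x k m] M by simp
  then show ?thesis using discriminantal_bases_rel[of "representative k m x" M k m] k by simp
qed

lemma discriminantal_stratum_eq:
  "discriminantal_stratum k m \<B> =
     {x \<in> points (moduli_space k m). discriminantal_bases k m (representative k m x) \<subseteq> \<B>}"
  unfolding discriminantal_stratum_def
  using bases_representative representative_point(3)[OF _ k m] by blast

text \<open>The smallest stratum containing \<open>x\<close>. As the matroids in question are those
  of points, all strata arise in this way.\<close>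

definition point_stratum :: "complex mat set \<Rightarrow> complex mat set set" where
  "point_stratum x = discriminantal_stratum k m (discriminantal_bases k m (representative k m x))"

lemma discriminantal_stratification_eq:
  "discriminantal_stratification k m = point_stratum ` points (moduli_space k m)"
proof (intro equalityI subsetI)
  fix S assume "S \<in> discriminantal_stratification k m"
  then obtain M where M: "M \<in> config k m" "S = discriminantal_stratum k m (discriminantal_bases k m M)"
    by (auto simp: discriminantal_stratification_def)
  have "S = point_stratum (config_rel k m `` {M})"
    using bases_representative[OF class_point[OF M(1)] config_class_self[OF M(1)]] M(2)
    by (simp add: point_stratum_def)
  then show "S \<in> point_stratum ` points (moduli_space k m)" using class_point[OF M(1)] by blast
next
  fix S assume "S \<in> point_stratum ` points (moduli_space k m)"
  then show "S \<in> discriminantal_stratification k m"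
    using representative_point(4)[OF _ k m] by (auto simp: point_stratum_def discriminantal_stratification_def)
qed

text \<open>The stratum of \<open>x\<close> contains \<open>x\<close> and lies in every stratum
  containing \<open>x\<close>. If it were strictly smaller than \<open>S\<close>, then
  \<open>x\<close> would have been removed from the open stratum of \<open>S\<close>.\<close>

lemma in_open_stratum:
  assumes S: "S \<in> discriminantal_stratification k m" and x: "x \<in> open_stratum (discriminantal_stratification k m) S"
  shows "x \<in> points (moduli_space k m)" "point_stratum x = S"
proof -
  obtain y where y: "y \<in> points (moduli_space k m)" "S = point_stratum y"
    using S unfolding discriminantal_stratification_eq by blast
  have xS: "x \<in> S" using x by (simp add: open_stratum_def)
  then show xp: "x \<in> points (moduli_space k m)"
    unfolding y(2) point_stratum_def discriminantal_stratum_eq by simp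
  have "discriminantal_bases k m (representative k m x) \<subseteq> discriminantal_bases k m (representative k m y)"
    using xS unfolding y(2) point_stratum_def discriminantal_stratum_eq by simp
  then have "point_stratum x \<subseteq> S" unfolding y(2) point_stratum_def discriminantal_stratum_eq by blast
  moreover have "x \<in> point_stratum x" using xp unfolding point_stratum_def discriminantal_stratum_eq by simp
  moreover have "point_stratum x \<in> discriminantal_stratification k m"
    unfolding discriminantal_stratification_eq using xp by blast
  ultimately show "point_stratum x = S" using x unfolding open_stratum_def by blast
qed

text \<open>\<open>x\<close> lies in \<open>S\<close>, which is also the stratum of
  \<open>y\<close>. Exchanging \<open>x\<close> and \<open>y\<close> gives equality: the matroid is
  constant on an open stratum.\<close>

lemma open_stratum_bases:
  assumes S: "S \<in> discriminantal_stratification k m"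
    and x: "x \<in> open_stratum (discriminantal_stratification k m) S"
    and y: "y \<in> open_stratum (discriminantal_stratification k m) S"
  shows "discriminantal_bases k m (representative k m x) \<subseteq> discriminantal_bases k m (representative k m y)"
proof -
  have "x \<in> S" using x by (simp add: open_stratum_def)
  then have "x \<in> point_stratum y" using in_open_stratum(2)[OF S y] by simp
  then show ?thesis unfolding point_stratum_def discriminantal_stratum_eq by simp
qed

text \<open>The equations are the determinants of the lists whose set is not in \<open>\<B>\<close>.
  Evaluated on the normal form, they are regular functions on the quotient.\<close>

lemma zariski_closed_stratum: "zariski_closed (moduli_space k m) (discriminantal_stratum k m \<B>)"
proof -
  let ?V = "moduli_space k m" and ?E = "ksubsets (k - 1) m"
  define L where "L = {es. length es = k \<and> set es \<subseteq> ?E \<and> set es \<notin> \<B>}"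
  define G where "G = (\<lambda>es x. vdet k (normals k (representative k m x)) es) ` L"
  have "(\<lambda>x. vdet k (normals k (representative k m x)) es) \<in> regular ?V" if es: "es \<in> L" for es
  proof -
    have "(\<lambda>M. vdet k (normals k (normal_mat k m M)) es) \<in> config_funs k m"
      using es by (intro config_funs_vdet config_funs_normals) (auto simp: L_def)
    then have "(\<lambda>M. vdet k (normals k (representative k m (config_rel k m `` {M}))) es) \<in> config_funs k m"
      by (rule config_funs_cong) (simp add: representative_class[OF _ k m])
    then show ?thesis by (simp add: regular_moduli_space)
  qed
  then have "G \<subseteq> regular ?V" by (auto simp: G_def)
  moreover have "discriminantal_bases k m N \<subseteq> \<B> \<longleftrightarrow> (\<forall>es\<in>L. vdet k (normals k N) es = 0)" for N
    unfolding discriminantal_bases_eq L_def by blast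
  then have "discriminantal_stratum k m \<B> = {x \<in> points ?V. \<forall>g\<in>G. g x = 0}"
    unfolding discriminantal_stratum_eq by (simp add: G_def)
  ultimately show ?thesis unfolding zariski_closed_def by blast
qed

lemma stratification_discriminantal: "stratification (moduli_space k m) (discriminantal_stratification k m)"
  unfolding stratification_def
proof (intro conjI ballI)
  let ?S = "discriminantal_stratification k m"
  have "discriminantal_bases k m M \<in> Pow (Pow (ksubsets (k - 1) m))" for M
    unfolding discriminantal_bases_eq by blast
  then have "discriminantal_bases k m ` config k m \<subseteq> Pow (Pow (ksubsets (k - 1) m))" by blast
  then have "finite (discriminantal_bases k m ` config k m)"
    by (rule finite_subset) (simp add: finite_ksubsets)
  then show "finite ?S" by (simp add: discriminantal_stratification_def)
  show "zariski_closed (moduli_space k m) S" if "S \<in> ?S" for S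
    using that zariski_closed_stratum by (auto simp: discriminantal_stratification_def)
  have "x \<in> point_stratum x" if "x \<in> points (moduli_space k m)" for x
    using that unfolding point_stratum_def discriminantal_stratum_eq by simp
  moreover have "point_stratum x \<subseteq> points (moduli_space k m)" for x
    unfolding point_stratum_def discriminantal_stratum_eq by blast
  ultimately show "\<Union>?S = points (moduli_space k m)"
    unfolding discriminantal_stratification_eq by blast
  show "disjoint_family_on (open_stratum ?S) ?S"
    unfolding disjoint_family_on_def
  proof (intro ballI impI)
    fix S S' assume S: "S \<in> ?S" "S' \<in> ?S" "S \<noteq> S'"
    show "open_stratum ?S S \<inter> open_stratum ?S S' = {}"
    proof (rule ccontr)
      assume "\<not> ?thesis"
      then obtain x where "x \<in> open_stratum ?S S" "x \<in> open_stratum ?S S'" by blast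
      then show False using in_open_stratum(2)[OF S(1)] in_open_stratum(2)[OF S(2)] S(3) by metis
    qed
  qed
qed

section \<open>The deletion map on normal forms\<close>

lemma config_ring_Suc: "config_ring k (m + 1)"
  using k m by unfold_locales auto

lemma deletion_map_class:
  assumes M: "M \<in> config k (m + 1)"
  shows "deletion_map k m (config_rel k (m + 1) `` {M}) = config_rel k m `` {delete_last_column k m M}"
proof (intro equalityI subsetI)
  fix N assume "N \<in> deletion_map k m (config_rel k (m + 1) `` {M})"
  then obtain M' where M': "(M, M') \<in> config_rel k (m + 1)" "(delete_last_column k m M', N) \<in> config_rel k m"
    by (auto simp: deletion_map_def)
  then show "N \<in> config_rel k m `` {delete_last_column k m M}"
    using config_class_eq[OF delete_rel[OF M'(1)]] by auto
next
  fix N assume "N \<in> config_rel k m `` {delete_last_column k m M}"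
  then show "N \<in> deletion_map k m (config_rel k (m + 1) `` {M})"
    using config_class_self[OF M] by (auto simp: deletion_map_def)
qed

text \<open>Deletion spares the frame, so the shortened representative is already in normal form and
  represents the image.\<close>

lemma deletion_map_point:
  assumes x: "x \<in> points (moduli_space k (m + 1))"
  shows "deletion_map k m x = config_rel k m `` {delete_last_column k m (representative k (m + 1) x)}"
    "deletion_map k m x \<in> points (moduli_space k m)"
    "representative k m (deletion_map k m x) = delete_last_column k m (representative k (m + 1) x)"
proof -
  interpret S: config_ring k "m + 1" by (rule config_ring_Suc)
  note r = representative_point[OF x S.k S.m]
  show *: "deletion_map k m x = config_rel k m `` {delete_last_column k m (representative k (m + 1) x)}"
    using deletion_map_class[OF r(4)] r(2) by simp
  show "deletion_map k m x \<in> points (moduli_space k m)"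
    unfolding * by (rule class_point[OF delete_config[OF r(4)]])
  show "representative k m (deletion_map k m x) = delete_last_column k m (representative k (m + 1) x)"
    unfolding * by (rule representative_normal_form[OF delete_normal_form[OF r(1) k m] k m])
qed

text \<open>Maximal minors of the shortened matrix are maximal minors of the full one, so the pulled
  back denominators are units on configurations of \<open>m + 1\<close> points.\<close>

lemma deletion_morphism:
  "variety_morphism (moduli_space k (m + 1)) (moduli_space k m) (deletion_map k m)"
  unfolding variety_morphism_def
proof (intro conjI ballI)
  interpret S: config_ring k "m + 1" by (rule config_ring_Suc)
  show "deletion_map k m \<in> points (moduli_space k (m + 1)) \<rightarrow> points (moduli_space k m)"
    using deletion_map_point(2) by blast
  fix g assume "g \<in> regular (moduli_space k m)"
  then obtain p N where p: "p \<in> poly_funs ({..<k} \<times> {..<m})"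
    "\<And>M. M \<in> config k m \<Longrightarrow> g (config_rel k m `` {M}) = p (entries k m M) / pluecker_product k m M ^ N"
    unfolding regular_moduli_space config_funs_def frac_funs_def by blast
  have "(\<lambda>M. p (entries k m (delete_last_column k m M)) * (\<Prod>J\<in>ksubsets k m. 1 / pluecker M J) ^ N)
      \<in> config_funs k (m + 1)"
  proof (intro S.config_funs_mult S.config_funs_poly[OF p(1)] S.config_funs_power S.config_funs_prod finite_ksubsets)
    fix ij assume "ij \<in> {..<k} \<times> {..<m}"
    then obtain i j where ij: "ij = (i, j)" "i < k" "j < m" by auto
    then show "(\<lambda>M. entries k m (delete_last_column k m M) ij) \<in> config_funs k (m + 1)"
      using S.config_funs_entry[of i j] by (simp add: entries_def delete_last_column_def)
  next
    fix J assume "J \<in> ksubsets k m"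
    then show "(\<lambda>M. 1 / pluecker M J) \<in> config_funs k (m + 1)"
      by (intro config_funs_pluecker_inverse) (auto simp: ksubsets_def)
  qed
  then have "(\<lambda>M. (g \<circ> deletion_map k m) (config_rel k (m + 1) `` {M})) \<in> config_funs k (m + 1)"
  proof (rule S.config_funs_cong)
    fix M assume M: "M \<in> config k (m + 1)"
    have "pluecker_product k m (delete_last_column k m M) = (\<Prod>J\<in>ksubsets k m. pluecker M J)"
      using M by (intro prod.cong) (auto simp: pluecker_delete config_def)
    then show "p (entries k m (delete_last_column k m M)) * (\<Prod>J\<in>ksubsets k m. 1 / pluecker M J) ^ N =
        (g \<circ> deletion_map k m) (config_rel k (m + 1) `` {M})"
      using p(2)[OF delete_config[OF M]] deletion_map_class[OF M] by (simp add: prod_dividef power_one_over)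
  qed
  then show "g \<circ> deletion_map k m \<in> regular (moduli_space k (m + 1))"
    by (simp add: regular_moduli_space)
qed

end

section \<open>The deletion map over an open stratum\<close>

lemma append_col_cong:
  "(\<And>i. i < k \<Longrightarrow> p i = q i) \<Longrightarrow> append_col k m N p = append_col k m N q"
  by (auto simp: append_col_def intro!: eq_matI)

context config_ring begin

lemma continuous_map_normals:
  assumes J: "J \<in> ksubsets (k - 1) m" and i: "i < k"
  shows "continuous_map (analytic (moduli_space k m)) euclidean (\<lambda>x. normals k (representative k m x) J i)"
proof -
  have N: "representative k m x \<in> carrier_mat k m" for x by (simp add: representative_def normal_mat_def)
  have lt: "pick J j < m" if "j < k - 1" for j using J pick_in_set_le[of j J] that by (auto simp: ksubsets_def)
  show ?thesis unfolding normals_eq_det[OF N J i]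
    by (intro continuous_map_complex_mult continuous_map_det continuous_map_representative k m)
       (use lt in auto)
qed

lemma continuous_map_deletion:
  "continuous_map (analytic (moduli_space k (m + 1))) (analytic (moduli_space k m)) (deletion_map k m)"
proof -
  interpret S: config_ring k "m + 1" by (rule config_ring_Suc)
  let ?X = "analytic (moduli_space k (m + 1))"
  have "continuous_map ?X (analytic (moduli_space k m))
      (\<lambda>x. config_rel k m `` {delete_last_column k m (representative k (m + 1) x)})"
  proof (rule continuous_map_into_moduli_space)
    show "continuous_map ?X euclidean (\<lambda>x. delete_last_column k m (representative k (m + 1) x) $$ (i, j))"
      if "i < k" "j < m" for i j
      using continuous_map_representative[OF S.k S.m, of i j] that by (simp add: delete_last_column_def)
    show "delete_last_column k m (representative k (m + 1) x) \<in> config k m" if "x \<in> topspace ?X" for x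
      using representative_point(4)[OF that S.k S.m] by (rule delete_config)
  qed
  then show ?thesis by (rule continuous_map_eq) (simp add: deletion_map_point(1))
qed

text \<open>The fibre over \<open>y\<close> consists of the possible last columns, normalized to have first entry 1; these
  form the complement of the hyperplanes spanned by the points of \<open>y\<close>.\<close>

lemma deletion_total_space:
  assumes U: "U \<subseteq> points (moduli_space k m)"
  shows "homeomorphic_map (subtopology (analytic (moduli_space k (m + 1))) (deletion_map k m -` U))
    (subtopology (prod_topology (analytic (moduli_space k m)) (complex_space {..<k}))
      {(b, q). b \<in> U \<and> q \<in> affine_complement k (ksubsets (k - 1) m) (normals k (representative k m b))})
    (\<lambda>x. (deletion_map k m x, \<lambda>i\<in>{..<k}. representative k (m + 1) x $$ (i, m)))"
proof -
  interpret S: config_ring k "m + 1" by (rule config_ring_Suc)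
  let ?X = "analytic (moduli_space k (m + 1))" and ?Y = "analytic (moduli_space k m)"
    and ?f = "deletion_map k m" and ?K = "complex_space {..<k}" and ?E = "ksubsets (k - 1) m"
  let ?Z = "{(b, q). b \<in> U \<and> q \<in> affine_complement k ?E (normals k (representative k m b))}"
  define last where "last x = (\<lambda>i\<in>{..<k}. representative k (m + 1) x $$ (i, m))" for x
  define glue where "glue z = append_col k m (representative k m (fst z)) (snd z)"
    for z :: "complex mat set \<times> (nat \<Rightarrow> complex)"
  have last: "append_col k m (representative k m (?f x)) (last x) = representative k (m + 1) x"
    "last x \<in> affine_complement k ?E (normals k (representative k m (?f x)))"
    if x: "x \<in> topspace ?X" for x
  proof -
    note r = representative_point[OF x S.k S.m]
    note d = deletion_map_point[OF x]
    have "representative k (m + 1) x \<in> carrier_mat k (m + 1)" using r(4) by (simp add: config_def)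
    from append_delete_col[OF this]
    show *: "append_col k m (representative k m (?f x)) (last x) = representative k (m + 1) x"
      unfolding d(3) by (subst append_col_cong[of k "last x" "\<lambda>i. representative k (m + 1) x $$ (i, m)"])
        (simp_all add: last_def)
    have "\<forall>J\<in>?E. pairing k (normals k (representative k m (?f x)) J) (last x) \<noteq> 0"
      using append_col_config[OF representative_point(4)[OF d(2) k m] k, of "last x"] r(4) * by simp
    moreover have "last x 0 = 1" using r(1) k m by (simp add: last_def normal_form_def)
    ultimately show "last x \<in> affine_complement k ?E (normals k (representative k m (?f x)))"
      by (simp add: affine_complement_def arrangement_complement_def last_def)
  qed
  have glue: "normal_form k (m + 1) (glue (b, q))" "glue (b, q) \<in> config k (m + 1)"
    "?f (config_rel k (m + 1) `` {glue (b, q)}) = b" "last (config_rel k (m + 1) `` {glue (b, q)}) = q"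
    if b: "b \<in> U" and q: "q \<in> affine_complement k ?E (normals k (representative k m b))" for b q
  proof -
    have bY: "b \<in> points (moduli_space k m)" using b U by blast
    note r = representative_point[OF bY k m]
    have q': "q 0 = 1" "\<forall>J\<in>?E. pairing k (normals k (representative k m b) J) q \<noteq> 0" "q \<in> extensional {..<k}"
      using q by (auto simp: affine_complement_def arrangement_complement_def)
    show nf: "normal_form k (m + 1) (glue (b, q))"
      unfolding glue_def fst_conv snd_conv by (rule append_col_normal_form[OF r(1) k m q'(1,2)])
    then show c: "glue (b, q) \<in> config k (m + 1)" by (simp add: normal_form_def)
    have "representative k m b \<in> carrier_mat k m" using r(4) by (simp add: config_def)
    from delete_append_col[OF this] show "?f (config_rel k (m + 1) `` {glue (b, q)}) = b"
      using deletion_map_class[OF c] r(2) by (simp add: glue_def)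
    show "last (config_rel k (m + 1) `` {glue (b, q)}) = q"
    proof (rule extensionalityI[OF _ q'(3)])
      show "last (config_rel k (m + 1) `` {glue (b, q)}) \<in> extensional {..<k}" by (simp add: last_def)
      fix i assume "i \<in> {..<k}"
      then show "last (config_rel k (m + 1) `` {glue (b, q)}) i = q i"
        unfolding last_def representative_normal_form[OF nf S.k S.m] by (simp add: glue_def append_col_def)
    qed
  qed
  have topZ: "topspace (subtopology (prod_topology ?Y ?K) ?Z) = ?Z"
    using U by (auto simp: topspace_complex_space affine_complement_def arrangement_complement_def)
  have "homeomorphic_maps (subtopology ?X (?f -` U)) (subtopology (prod_topology ?Y ?K) ?Z)
      (\<lambda>x. (?f x, last x)) (\<lambda>z. config_rel k (m + 1) `` {glue z})"
    unfolding homeomorphic_maps_def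
  proof (intro conjI ballI)
    have "continuous_map ?X ?K last"
    proof (rule continuous_map_into_complex_space)
      fix i assume "i \<in> {..<k}"
      then show "continuous_map ?X euclidean (\<lambda>x. last x i)"
        using continuous_map_representative[OF S.k S.m, of i m] by (simp add: last_def)
    qed (simp add: last_def)
    then have "continuous_map ?X (prod_topology ?Y ?K) (\<lambda>x. (?f x, last x))"
      unfolding continuous_map_pairwise o_def fst_conv snd_conv using continuous_map_deletion by blast
    then show "continuous_map (subtopology ?X (?f -` U)) (subtopology (prod_topology ?Y ?K) ?Z) (\<lambda>x. (?f x, last x))"
      unfolding continuous_map_in_subtopology using last(2) by (auto intro: continuous_map_from_subtopology)
    have fstZ: "continuous_map (subtopology (prod_topology ?Y ?K) ?Z) ?Y fst"
      and sndZ: "continuous_map (subtopology (prod_topology ?Y ?K) ?Z) ?K snd"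
      by (intro continuous_map_from_subtopology continuous_map_fst continuous_map_snd)+
    have "continuous_map (subtopology (prod_topology ?Y ?K) ?Z) ?X (\<lambda>z. config_rel k (m + 1) `` {glue z})"
    proof (rule continuous_map_into_moduli_space)
      fix i j assume ij: "i < k" "j < m + 1"
      show "continuous_map (subtopology (prod_topology ?Y ?K) ?Z) euclidean (\<lambda>z. glue z $$ (i, j))"
      proof (cases "j < m")
        case True
        then show ?thesis
          using continuous_map_compose[OF fstZ continuous_map_representative[OF k m ij(1) True]] ij
          by (simp add: glue_def append_col_def o_def)
      next
        case False
        then show ?thesis
          using continuous_map_complex_space_coordinate[OF sndZ, of i] ij
          by (simp add: glue_def append_col_def)
      qed
    next
      fix z assume "z \<in> topspace (subtopology (prod_topology ?Y ?K) ?Z)"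
      then show "glue z \<in> config k (m + 1)" unfolding topZ using glue(2) by auto
    qed
    then show "continuous_map (subtopology (prod_topology ?Y ?K) ?Z) (subtopology ?X (?f -` U))
        (\<lambda>z. config_rel k (m + 1) `` {glue z})"
      unfolding continuous_map_in_subtopology topZ using glue(3) by auto
    show "config_rel k (m + 1) `` {glue (?f x, last x)} = x" if "x \<in> topspace (subtopology ?X (?f -` U))" for x
      using that last(1)[of x] representative_point(2)[of x k "m + 1"] S.k S.m by (simp add: glue_def)
    show "(?f (config_rel k (m + 1) `` {glue z}), last (config_rel k (m + 1) `` {glue z})) = z"
      if "z \<in> topspace (subtopology (prod_topology ?Y ?K) ?Z)" for z
      using that glue(3,4) unfolding topZ by auto
  qed
  then show ?thesis unfolding last_def[abs_def] by (rule homeomorphic_maps_imp_map)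
qed

text \<open>Over the open stratum the normals of the representatives vary continuously with a
  constant matroid, so the complements form a locally trivial family;
  \<open>deletion_total_space\<close> identifies this family over \<open>U\<close> with the preimage
  of \<open>U\<close>.\<close>

lemma deletion_fibration:
  assumes S: "S \<in> discriminantal_stratification k m"
  shows "fibration_over (analytic (moduli_space k (m + 1))) (analytic (moduli_space k m)) (deletion_map k m)
    (open_stratum (discriminantal_stratification k m) S)"
proof (rule fibration_over_if_locally_trivial)
  let ?X = "analytic (moduli_space k (m + 1))" and ?Y = "analytic (moduli_space k m)"
    and ?f = "deletion_map k m" and ?K = "complex_space {..<k}" and ?E = "ksubsets (k - 1) m"
  let ?B = "open_stratum (discriminantal_stratification k m) S"
  let ?T = "subtopology ?Y ?B"
  define v where "v b = normals k (representative k m b)" for b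
  fix y assume y: "y \<in> topspace ?T"
  have BY: "b \<in> points (moduli_space k m)" "b \<in> ?B" if "b \<in> topspace ?T" for b using that by auto
  obtain U h where U: "openin ?T U" "y \<in> U"
    and hom: "homeomorphic_map
       (subtopology (prod_topology ?T ?K) {(b, q). b \<in> U \<and> q \<in> affine_complement k ?E (v b)})
       (prod_topology (subtopology ?T U) (subtopology ?K (affine_complement k ?E (v y)))) h"
    and fst_h: "\<And>x. fst (h x) = fst x"
  proof (rule arrangement_locally_trivial[of ?E k ?T v y])
    show "continuous_map ?T euclidean (\<lambda>b. v b J i)" if "J \<in> ?E" "i < k" for J i
      unfolding v_def by (intro continuous_map_from_subtopology continuous_map_normals that)
    show "\<exists>J\<in>?E. \<forall>p. cmod (pairing k (v b J) p) = cmod (p i)" if "b \<in> topspace ?T" "i < k" for b i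
      unfolding v_def by (rule coordinate_hyperplane[OF representative_point(1)[OF BY(1)[OF that(1)] k m] that(2) m])
    show "vdet k (v b) es \<noteq> 0 \<longleftrightarrow> vdet k (v b') es \<noteq> 0"
      if "b \<in> topspace ?T" "b' \<in> topspace ?T" "length es = k" "set es \<subseteq> ?E" for b b' es
      unfolding v_def
      using discriminantal_bases_vdet[OF open_stratum_bases[OF S BY(2)[OF that(1)] BY(2)[OF that(2)]] that(3,4)]
        discriminantal_bases_vdet[OF open_stratum_bases[OF S BY(2)[OF that(2)] BY(2)[OF that(1)]] that(3,4)]
      by blast
  qed (use finite_ksubsets k y in auto)
  let ?F = "subtopology ?K (affine_complement k ?E (v y))"
  have UB: "U \<subseteq> ?B" "U \<subseteq> points (moduli_space k m)" using openin_subset[OF U(1)] by auto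
  have TU: "subtopology ?T U = subtopology ?Y U"
    using UB(1) by (simp add: subtopology_subtopology Int_absorb1)
  let ?Z = "{(b, q). b \<in> U \<and> q \<in> affine_complement k ?E (v b)}"
  \<comment> \<open>The trivialization was obtained over the subspace \<open>?T\<close>; the family
    over \<open>U\<close> carries the same topology as a subspace of the product with all of
    \<open>?Y\<close>.\<close>
  have "prod_topology ?T ?K = subtopology (prod_topology ?Y ?K) (?B \<times> UNIV)"
    by (simp add: subtopology_Times)
  moreover have "(?B \<times> UNIV) \<inter> ?Z = ?Z" using UB(1) by auto
  ultimately have "subtopology (prod_topology ?T ?K) ?Z = subtopology (prod_topology ?Y ?K) ?Z"
    by (simp add: subtopology_subtopology)
  with hom have hom': "homeomorphic_map (subtopology (prod_topology ?Y ?K) ?Z)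
      (prod_topology (subtopology ?Y U) ?F) h" unfolding TU by simp
  define \<Psi> where "\<Psi> x = (?f x, \<lambda>i\<in>{..<k}. representative k (m + 1) x $$ (i, m))" for x
  have "homeomorphic_map (subtopology ?X (?f -` U)) (subtopology (prod_topology ?Y ?K) ?Z) \<Psi>"
    using deletion_total_space[OF UB(2)] by (simp add: v_def \<Psi>_def[abs_def])
  from homeomorphic_map_compose[OF this hom']
  have "trivial_over ?X ?Y ?f U ?F"
    unfolding trivial_over_def by (intro exI[of _ "h \<circ> \<Psi>"] conjI) (simp_all add: fst_h \<Psi>_def)
  then show "\<exists>U F. openin ?T U \<and> y \<in> U \<and> trivial_over ?X ?Y ?f U (F :: (nat \<Rightarrow> complex) topology)"
    using U by blast
qed

end

theorem proposition2p5:
  fixes k m :: nat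
  assumes "k \<ge> 2" and "m \<ge> k + 1"
  shows "very_affine_variety (moduli_space k m) \<and>
    stratified_fibration (moduli_space k (m + 1)) (moduli_space k m) (deletion_map k m)
      (discriminantal_stratification k m)"
proof -
  \<comment> \<open>\<open>m \<ge> k + 1\<close> provides the frame of \<open>k + 1\<close> points
    on which the normal form rests, for \<open>m\<close> as well as for \<open>m + 1\<close>
    points.\<close>
  interpret config_ring k m using assms by unfold_locales auto
  interpret S: config_ring k "m + 1" by (rule config_ring_Suc)
  show ?thesis
    unfolding stratified_fibration_def
    using very_affine_moduli_space S.very_affine_moduli_space very_affine_imp_affine
      deletion_morphism stratification_discriminantal deletion_fibration by blast
qed

end
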